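(* Let $d\ge 1$ be an integer and let $B=\mathbb{T}^{4d}\times\mathbb{R}^{4d}$ with coordinates $Z=(q,p,o)$, $Z^{\mathrm{odd}}$ and the matrices $J_1,J_2,J_3$ as described in the context. Let $W:\mathbb{T}^3\times\mathbb{T}^d\times\mathbb{R}^{3d}\to\mathbb{R}$, $(t,q,p)\mapsto W_t(q,p)$, be smooth with finite $C^2$-norm, and set $$H_t(Z)=\tfrac12|Z^{\mathrm{odd}}|^2+W_t(q,p).$$ Then there are at least $d+1$ different $\mathbb{T}^{3d}$-families of solutions $Z:\mathbb{T}^3\to B$ to the equation $$J_1\partial_1Z(t)+J_2\partial_2Z(t)+J_3\partial_3Z(t)=\nabla H_t(Z(t)).$$
   Context: Write $\mathbb{T}=\mathbb{R}/\mathbb{Z}$, let $t=(t_1,t_2,t_3)$ be the coordinates on $\mathbb{T}^3$ and $\partial_i=\partial/\partial t_i$. The space $B$: let $\bar B=\mathbb{R}^d\otimes\bigwedge(\mathbb{R}^3)^*\cong\mathbb{R}^{8d}$ with the standard Euclidean metric and coordinates $(q^\alpha,p_1^\alpha,p_2^\alpha,p_3^\alpha,o_{23}^\alpha,o_{31}^\alpha,o_{12}^\alpha,o_{123}^\alpha)_{\alpha=1,\dots,d}$, which are the coefficients of the form $q^\alpha+\sum_i p_i^\alpha dt_i+o_{23}^\alpha dt_2\wedge dt_3+o_{31}^\alpha dt_3\wedge dt_1+o_{12}^\alpha dt_1\wedge dt_2+o_{123}^\alpha dt_1\wedge dt_2\wedge dt_3$. The space $B$ is the quotient of $\bar B$ by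 the translation action of $\mathbb{Z}^{4d}$ on the even-degree coordinates $Z^{\mathrm{even}}=(q,o_{23},o_{31},o_{12})$; the odd-degree coordinates are $Z^{\mathrm{odd}}=(p_1,p_2,p_3,o_{123})\in\mathbb{R}^{4d}$. So $B=\mathbb{T}^{4d}\times\mathbb{R}^{4d}$, $Z=(Z^{\mathrm{even}},Z^{\mathrm{odd}})$, $TB=B\times\bar B$, and gradients $\nabla$ are taken with respect to the Euclidean metric. The operator: $J_\partial=J_1\partial_1+J_2\partial_2+J_3\partial_3$ (each $J_i$ acting on $\bar B$ as $\mathrm{Id}_{\mathbb{R}^d}\otimes J_i$) is $\mathrm{Id}_{\mathbb{R}^d}\otimes(d+d^* )$, with $d$ and $d^*$ the exterior differential and codifferential. Explicitly, the equation $J_\partial Z=\nabla H_t(Z)$ is the system, for every $\alpha=1,\dots,d$, $$\begin{aligned} -\partial_1p_1^\alpha-\partial_2p_2^\alpha-\partial_3p_3^\alpha&=\partial_{q^\alpha}H, & \partial_1q^\alpha+\partial_2o_{12}^\alpha-\partial_3o_{31}^\alpha&=\partial_{p_1^\alpha}H,\\ -\partial_1o_{12}^\alpha+\partial_2q^\alpha+\partial_3o_{23}^\alpha&=\partial_{p_2^\alpha}H, & \partial_1o_{31}^\alpha-\partial_2o_{23}^\alpha+\partial_3q^\alpha&=\partial_{p_3^\alpha}H,\\ -\partial_1o_{123}^\alpha+\partial_2p_3^\alpha-\partial_3p_2^\alpha&=\partial_{o_{23}^\alpha}H, & -\partial_1p_3^\alpha-\partial_2o_{123}^\alpha+\partial_3p_1^\alpha&=\partial_{o_{31}^\alpha}H,\\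 \partial_1p_2^\alpha-\partial_2p_1^\alpha-\partial_3o_{123}^\alpha&=\partial_{o_{12}^\alpha}H, & \partial_1o_{23}^\alpha+\partial_2o_{31}^\alpha+\partial_3o_{12}^\alpha&=\partial_{o_{123}^\alpha}H. \end{aligned}$$ Solutions are smooth maps. Since $H$ does not depend on $(o_{23},o_{31},o_{12})\in\mathbb{T}^{3d}$, the group $\mathbb{T}^{3d}$ acts on the set of solutions by constant translations of the coordinates $(o_{23},o_{31},o_{12})$; a $\mathbb{T}^{3d}$-family of solutions is an orbit of this action. The $C^2$-norm of $W$ is the supremum over $\mathbb{T}^3\times\mathbb{T}^d\times\mathbb{R}^{3d}$ of the absolute values of $W$ and its partial derivatives of order at most $2$. *)

theory Defs
  imports "HOL-Analysis.Analysis"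
begin

section \<open>The circle \<open>\<real>/\<int>\<close> as a group\<close>

quotient_type circle = real / "\<lambda>x y :: real. x - y \<in> \<int>"
  morphisms rep_circle circ
proof (rule equivpI)
  show "reflp (\<lambda>x y :: real. x - y \<in> \<int>)"
    by (rule reflpI) simp
  show "symp (\<lambda>x y :: real. x - y \<in> \<int>)"
    by (rule sympI) (metis Ints_minus minus_diff_eq)
  show "transp (\<lambda>x y :: real. x - y \<in> \<int>)"
  proof (rule transpI)
    fix x y z :: real
    assume "x - y \<in> \<int>" "y - z \<in> \<int>"
    then have "(x - y) + (y - z) \<in> \<int>" by (rule Ints_add)
    then show "x - z \<in> \<int>" by simp
  qed
qed

lemma circ_eq_iff: "circ x = circ y \<longleftrightarrow> x - y \<in> \<int>"
  by (rule circle.abs_eq_iff)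

instantiation circle :: ab_group_add
begin

lift_definition zero_circle :: circle is "0 :: real" .

lift_definition plus_circle :: "circle \<Rightarrow> circle \<Rightarrow> circle" is "(+) :: real \<Rightarrow> real \<Rightarrow> real"
proof -
  fix a b c d :: real
  assume "a - b \<in> \<int>" "c - d \<in> \<int>"
  then have "(a - b) + (c - d) \<in> \<int>" by (rule Ints_add)
  then show "(a + c) - (b + d) \<in> \<int>" by (simp add: algebra_simps)
qed

lift_definition uminus_circle :: "circle \<Rightarrow> circle" is "uminus :: real \<Rightarrow> real"
proof -
  fix a b :: real
  assume "a - b \<in> \<int>"
  then have "- (a - b) \<in> \<int>" by (rule Ints_minus)
  then show "- a - - b \<in> \<int>" by simp
qed

lift_definition minus_circle :: "circle \<Rightarrow> circle \<Rightarrow> circle" is "(-) :: real \<Rightarrow> real \<Rightarrow> real"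
proof -
  fix a b c d :: real
  assume "a - b \<in> \<int>" "c - d \<in> \<int>"
  then have "(a - b) - (c - d) \<in> \<int>" by (rule Ints_diff)
  then show "(a - c) - (b - d) \<in> \<int>" by (simp add: algebra_simps)
qed

instance
  by standard (transfer, simp add: algebra_simps)+

end

type_synonym 'n torus = "(circle, 'n) vec"

definition to_torus :: "real ^ 'n \<Rightarrow> 'n torus" where
  "to_torus x = (\<chi> i. circ (x $ i))"

section \<open>Derivatives\<close>

text \<open>Derivative in the direction \<open>v\<close>; it is only used for differentiable functions.\<close>

definition pdiff :: "'a::euclidean_space \<Rightarrow> ('a \<Rightarrow> 'b::euclidean_space) \<Rightarrow> 'a \<Rightarrow> 'b" where
  "pdiff v f = (\<lambda>x. frechet_derivative f (at x) v)"

primrec Ck :: "nat \<Rightarrow> ('a::euclidean_space \<Rightarrow> 'b::euclidean_space) \<Rightarrow> bool" where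
  "Ck 0 f \<longleftrightarrow> continuous_on UNIV f"
| "Ck (Suc k) f \<longleftrightarrow> (\<forall>x. f differentiable (at x)) \<and> (\<forall>v. Ck k (pdiff v f))"

definition smooth :: "('a::euclidean_space \<Rightarrow> 'b::euclidean_space) \<Rightarrow> bool" where
  "smooth f \<longleftrightarrow> (\<forall>k. Ck k f)"

definition C2_norm :: "('a::euclidean_space \<Rightarrow> real) \<Rightarrow> ereal" where
  "C2_norm f = Sup ({ereal \<bar>f x\<bar> | x. True}
     \<union> {ereal \<bar>pdiff b f x\<bar> | b x. b \<in> Basis}
     \<union> {ereal \<bar>pdiff b (pdiff c f) x\<bar> | b c x. b \<in> Basis \<and> c \<in> Basis})"

section \<open>The phase space \<open>B\<close>\<close>

text \<open>The integer \<open>d \<ge> 1\<close> is \<open>CARD('d)\<close>. A point of either space below is a tuple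
  \<open>(q, p, o, o123)\<close>, where \<open>p $ 1, p $ 2, p $ 3\<close> are \<open>p1, p2, p3\<close>, and
  \<open>o $ 1, o $ 2, o $ 3\<close> are \<open>o23, o31, o12\<close>, in this cyclic order.
  The library's inner product on these product types is the standard Euclidean one.\<close>

type_synonym 'd Bbar =
  "(real, 'd) vec \<times> ((real, 'd) vec, 3) vec \<times> ((real, 'd) vec, 3) vec \<times> (real, 'd) vec"

type_synonym 'd B =
  "'d torus \<times> ((real, 'd) vec, 3) vec \<times> ('d torus, 3) vec \<times> (real, 'd) vec"

fun to_B :: "'d::finite Bbar \<Rightarrow> 'd B" where
  "to_B (q, p, om, r) = (to_torus q, p, (\<chi> i. to_torus (om $ i)), r)"

fun J1 :: "'d::finite Bbar \<Rightarrow> 'd Bbar" where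
  "J1 (q, p, om, r) =
    (- (p $ 1), vector [q, - (om $ 3), om $ 2], vector [- r, - (p $ 3), p $ 2], om $ 1)"

fun J2 :: "'d::finite Bbar \<Rightarrow> 'd Bbar" where
  "J2 (q, p, om, r) =
    (- (p $ 2), vector [om $ 3, q, - (om $ 1)], vector [p $ 3, - r, - (p $ 1)], om $ 2)"

fun J3 :: "'d::finite Bbar \<Rightarrow> 'd Bbar" where
  "J3 (q, p, om, r) =
    (- (p $ 3), vector [- (om $ 2), om $ 1, q], vector [- (p $ 2), p $ 1, - r], om $ 3)"

section \<open>The Hamiltonian and the equation\<close>

type_synonym 'd W_dom = "3 torus \<times> 'd torus \<times> ((real, 'd) vec, 3) vec"

text \<open>\<open>W\<close> in the coordinates of the universal cover of its domain: smoothness and the partial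
  derivatives of \<open>W\<close> are those of this periodic function.\<close>

definition W_lift ::
  "('d::finite W_dom \<Rightarrow> real) \<Rightarrow> (real ^ 3) \<times> (real ^ 'd) \<times> (real ^ 'd ^ 3) \<Rightarrow> real" where
  "W_lift W = (\<lambda>(t, q, p). W (to_torus t, to_torus q, p))"

fun Z_odd :: "'d::finite B \<Rightarrow> (real ^ 'd ^ 3) \<times> (real ^ 'd)" where
  "Z_odd (q, p, om, r) = (p, r)"

fun Ham :: "('d::finite W_dom \<Rightarrow> real) \<Rightarrow> 3 torus \<Rightarrow> 'd B \<Rightarrow> real" where
  "Ham W t (q, p, om, r) = 1/2 * (norm (Z_odd (q, p, om, r)))\<^sup>2 + W (t, q, p)"

text \<open>As \<open>real ^ 3\<close> is simply connected and \<open>to_B\<close> is a covering, a map \<open>Z\<close> from the 3-torus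
  to \<open>B\<close> is smooth iff it is induced by a smooth \<open>F\<close> as in the following definition. Here \<open>Z\<close> may lie
  in any homotopy class, and \<open>F\<close> is unique up to a constant integer translation of the even
  coordinates, which affects neither the derivatives of \<open>F\<close> nor the gradient.\<close>

definition lifts_to :: "(3 torus \<Rightarrow> 'd::finite B) \<Rightarrow> (real ^ 3 \<Rightarrow> 'd Bbar) \<Rightarrow> bool" where
  "lifts_to Z F \<longleftrightarrow> smooth F \<and> (\<forall>t. Z (to_torus t) = to_B (F t))"

definition solution :: "('d::finite W_dom \<Rightarrow> real) \<Rightarrow> (3 torus \<Rightarrow> 'd B) \<Rightarrow> bool" where
  "solution W Z \<longleftrightarrow> (\<exists>F. lifts_to Z F \<and>
     (\<forall>t. GDERIV (\<lambda>z. Ham W (to_torus t) (to_B z)) (F t) :>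
        J1 (pdiff (axis 1 1) F t) + J2 (pdiff (axis 2 1) F t) + J3 (pdiff (axis 3 1) F t)))"

section \<open>Families of solutions\<close>

fun translate :: "('d::finite torus, 3) vec \<Rightarrow> 'd B \<Rightarrow> 'd B" where
  "translate c (q, p, om, r) = (q, p, om + c, r)"

definition orbit :: "(3 torus \<Rightarrow> 'd::finite B) \<Rightarrow> (3 torus \<Rightarrow> 'd B) set" where
  "orbit Z = {\<lambda>t. translate c (Z t) | c. True}"

definition solution_families ::
  "('d::finite W_dom \<Rightarrow> real) \<Rightarrow> (3 torus \<Rightarrow> 'd B) set set" where
  "solution_families W = {orbit Z | Z. solution W Z}"

end

theory Submission
  imports Defs "HOL-Complex_Analysis.Great_Picard"
begin

text \<open>Families of solutions are counted over all homotopy classes of maps from the torus to \<open>B\<close>,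
  and this reduces the theorem to the existence of one solution. Let \<open>Z\<close> be a solution and
  \<open>v = (1, \<dots>, 1)\<close>. Adding \<open>n t1 v\<close> to \<open>o23\<close> and \<open>n v\<close> to \<open>o123\<close> gives another solution: for an
  integer \<open>n\<close> the new map still descends to the torus, both sides of the equation \<open>div o = o123\<close>
  grow by \<open>n v\<close>, and in all the others \<open>o23\<close> occurs only through \<open>\<partial>2\<close> and \<open>\<partial>3\<close> and \<open>o123\<close> only
  through its derivatives, which do not change. Translations of \<open>o\<close> leave \<open>o123\<close> unchanged, so
  different \<open>n\<close> give different families (\<open>J_lift\<close>, \<open>orbit_sol_inj\<close>).

  For one solution put \<open>q = q0 + \<phi> - div \<chi>\<close>, \<open>p = a + \<nabla>\<phi>\<close>, \<open>o = curl \<chi>\<close>, \<open>o123 = 0\<close> with periodic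
  \<open>\<phi>\<close>, \<open>\<chi>\<close> and constants \<open>q0\<close>, \<open>a\<close>. As \<open>curl curl = \<nabla> div - \<Delta>\<close>, the system becomes \<open>-\<Delta>\<phi> = \<partial>q W\<close> and
  \<open>-\<Delta>\<chi>i = \<partial>pi W + ai\<close>, nonlinear Poisson equations whose right-hand sides must have mean zero. These
  are solved in \<open>poisson_system_solution\<close>.

  The equations are first truncated to the frequencies \<open>k\<close> with \<open>\<bar>ki\<bar> \<le> n\<close>. The truncated equations
  say that a function on a finite-dimensional space is critical; it is the sum of the indefinite
  quadratic form \<open>\<integral> \<nabla>\<phi> \<cdot> \<nabla>q - \<bar>\<nabla>\<phi>\<bar>\<^sup>2/2 - \<bar>a\<bar>\<^sup>2/2\<close> and of \<open>-\<integral> W\<close>, which has a bounded and Lipschitz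
  gradient and is periodic in the mean of \<open>q\<close>, the only directions in which the quadratic form is
  degenerate. Such a function has a critical point: otherwise gradient descent would lower it at a
  fixed rate for ever, while the Poincare-Miranda theorem yields arbitrarily long trajectories that
  start where it is bounded above and end where it is bounded below (\<open>saddle_critical_point\<close>,
  \<open>Galerkin_solution\<close>).

  The truncated solutions are bounded in every \<open>C\<^sup>k\<close>-norm uniformly in \<open>n\<close>. The \<open>C\<^sup>2\<close>-bound on \<open>W\<close>
  bounds the right-hand sides in \<open>L\<^sup>2\<close>; the inverse Laplacian gains two derivatives in \<open>L\<^sup>2\<close>, and
  turns \<open>L\<^sup>2\<close>-bounds into sup-bounds because \<open>\<Sum> \<bar>k\<bar>\<^sup>-\<^sup>4\<close> converges in dimension three. Two rounds
  bound \<open>p\<close> in the sup-norm, so that also the higher derivatives of \<open>W\<close> are bounded along the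
  solutions, and an induction bounds all derivatives (\<open>regular_phi\<close>, \<open>regular_chi\<close>). By
  Arzela-Ascoli a subsequence converges uniformly with all its derivatives, and comparing Fourier
  coefficients shows that the limit solves the equations without truncation (\<open>poisson_limit\<close>).\<close>

section \<open>Critical points of saddle functions\<close>

text \<open>A Lipschitz map of a cube which points outward on every face nearly has a zero. By Kuhn's
  labelling lemma, applied to the signs of the components on a fine grid, some cell carries both
  signs of every component; by the Lipschitz bound all components are small there. The coordinates
  are indexed by a finite set instead of a type, because the lemma is applied to the negative
  directions of a quadratic form, which are only some of the variables.\<close>
lemma approx_Poincare_Miranda:
  fixes h :: "('i \<Rightarrow> real) \<Rightarrow> 'i \<Rightarrow> real"
  assumes fin: "finite N" and R: "R > 0" and eps: "e > 0"
    and lip: "\<And>x y i. i \<in> N \<Longrightarrow> (\<And>j. j \<notin> N \<Longrightarrow> x j = y j) \<Longrightarrow>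
        \<bar>h x i - h y i\<bar> \<le> L * (\<Sum>j\<in>N. \<bar>x j - y j\<bar>)"
    and up: "\<And>x i. i \<in> N \<Longrightarrow> x i = R \<Longrightarrow> 0 \<le> h x i"
    and down: "\<And>x i. i \<in> N \<Longrightarrow> x i = - R \<Longrightarrow> h x i \<le> 0"
  shows "\<exists>x. (\<forall>j. j \<notin> N \<longrightarrow> x j = 0) \<and> (\<forall>j\<in>N. \<bar>x j\<bar> \<le> R) \<and> (\<forall>i\<in>N. \<bar>h x i\<bar> \<le> e)"
proof -
  define m where "m = card N"
  obtain b where b: "bij_betw b {..<m} N"
    using fin unfolding m_def by (metis atLeast0LessThan ex_bij_betw_nat_finite)
  define c where "c = the_inv_into {..<m} b"
  have cb: "c (b i) = i" if "i < m" for i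
    using b that unfolding c_def by (auto simp: bij_betw_def the_inv_into_f_f)
  have bc: "b (c j) = j" "c j < m" if "j \<in> N" for j
    using b that unfolding c_def bij_betw_def
    by (auto simp: f_the_inv_into_f dest: the_inv_into_into[of b "{..<m}" j "{..<m}"])
  obtain p :: nat where p: "p > 0" "\<bar>L\<bar> * (real m * (2 * R)) / real p \<le> e"
  proof -
    obtain p :: nat where "real p > \<bar>L\<bar> * (real m * (2 * R)) / e"
      using reals_Archimedean2 by blast
    moreover have "\<bar>L\<bar> * (real m * (2 * R)) / e \<ge> 0" using R eps by simp
    ultimately have "p > 0" "\<bar>L\<bar> * (real m * (2 * R)) \<le> e * real p"
      using eps by (auto simp: field_simps intro: Nat.gr0I)
    then show ?thesis using that[of p] by (simp add: field_simps)
  qed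
  define z where "z = (\<lambda>(x :: nat \<Rightarrow> nat) j. if j \<in> N then - R + 2 * R * (real (x (c j)) / real p) else 0)"
  \<comment> \<open>On the faces the label is prescribed, as Kuhn's lemma requires, and it agrees there with the
    sign of \<open>h\<close>.\<close>
  define lab :: "(nat \<Rightarrow> nat) \<Rightarrow> nat \<Rightarrow> nat" where
    "lab = (\<lambda>x i. if x i = 0 then 0 else if x i = p then 1 else if h (z x) (b i) > 0 then 1 else 0)"
  have lab0: "h (z x) (b i) \<le> 0" if "i < m" "lab x i = 0" for x i
  proof (cases "x i = 0")
    case True
    then have "z x (b i) = - R" using that b cb by (auto simp: z_def bij_betw_def)
    then show ?thesis using down that b by (auto simp: bij_betw_def)
  next
    case False
    with that show ?thesis by (auto simp: lab_def split: if_splits)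
  qed
  have lab1: "h (z x) (b i) \<ge> 0" if "i < m" "lab x i = 1" for x i
  proof (cases "x i = p")
    case True
    then have "z x (b i) = R" using that b cb p by (auto simp: z_def bij_betw_def)
    then show ?thesis using up that b by (auto simp: bij_betw_def)
  next
    case False
    with that show ?thesis by (auto simp: lab_def split: if_splits)
  qed
  obtain q where q1: "\<forall>i<m. q i < p"
    and q2: "\<forall>i<m. \<exists>r s. (\<forall>j<m. q j \<le> r j \<and> r j \<le> q j + 1) \<and> (\<forall>j<m. q j \<le> s j \<and> s j \<le> q j + 1) \<and> lab r i \<noteq> lab s i"
    by (rule kuhn_lemma[of p m lab]) (use p in \<open>auto simp: lab_def\<close>)
  have near: "\<bar>h (z q) (b i) - h (z r) (b i)\<bar> \<le> e"
    if "i < m" "\<forall>j<m. q j \<le> r j \<and> r j \<le> q j + 1" for i r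
  proof -
    have "\<bar>h (z q) (b i) - h (z r) (b i)\<bar> \<le> L * (\<Sum>j\<in>N. \<bar>z q j - z r j\<bar>)"
      using that b by (intro lip) (auto simp: bij_betw_def z_def)
    also have "\<dots> \<le> \<bar>L\<bar> * (\<Sum>j\<in>N. \<bar>z q j - z r j\<bar>)"
      by (intro mult_right_mono sum_nonneg) auto
    also have "\<dots> \<le> \<bar>L\<bar> * (\<Sum>j\<in>N. 2 * R / real p)"
    proof (intro mult_left_mono sum_mono)
      fix j assume j: "j \<in> N"
      have "z q j - z r j = 2 * R / real p * (real (q (c j)) - real (r (c j)))"
        using j by (simp add: z_def algebra_simps diff_divide_distrib)
      moreover have "\<bar>real (q (c j)) - real (r (c j))\<bar> \<le> 1"
        using that(2) bc(2)[OF j] by (auto simp: abs_if dest!: spec[of _ "c j"])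
      ultimately show "\<bar>z q j - z r j\<bar> \<le> 2 * R / real p"
        using R p(1) by (simp add: abs_mult mult_left_le divide_right_mono)
    qed auto
    also have "\<dots> = \<bar>L\<bar> * (real m * (2 * R)) / real p" by (simp add: m_def)
    finally show ?thesis using p by linarith
  qed
  have "\<bar>h (z q) i\<bar> \<le> e" if i: "i \<in> N" for i
  proof -
    have ci: "c i < m" "b (c i) = i" using bc i by auto
    obtain r s where rs: "\<forall>j<m. q j \<le> r j \<and> r j \<le> q j + 1" "\<forall>j<m. q j \<le> s j \<and> s j \<le> q j + 1"
      "lab r (c i) \<noteq> lab s (c i)" using q2 ci by blast
    have "lab r (c i) \<in> {0, 1}" "lab s (c i) \<in> {0, 1}" by (auto simp: lab_def)
    with rs have "\<exists>u v. (\<forall>j<m. q j \<le> u j \<and> u j \<le> q j + 1) \<and> (\<forall>j<m. q j \<le> v j \<and> v j \<le> q j + 1)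
        \<and> lab u (c i) = 0 \<and> lab v (c i) = 1" by auto
    then obtain u v where uv: "\<forall>j<m. q j \<le> u j \<and> u j \<le> q j + 1" "\<forall>j<m. q j \<le> v j \<and> v j \<le> q j + 1"
        "lab u (c i) = 0" "lab v (c i) = 1" by blast
    show ?thesis
      using near[OF ci(1) uv(1)] near[OF ci(1) uv(2)] lab0[OF ci(1) uv(3)] lab1[OF ci(1) uv(4)] ci(2)
      by auto
  qed
  moreover have "\<bar>z q j\<bar> \<le> R" if "j \<in> N" for j
  proof -
    have "real (q (c j)) \<le> real p" using q1 bc(2)[OF that] by (simp add: less_imp_le)
    then have "real (q (c j)) / real p \<le> 1" using p by simp
    then have "0 \<le> 2 * R * (real (q (c j)) / real p)" "2 * R * (real (q (c j)) / real p) \<le> 2 * R * 1"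
      using R by (simp, intro mult_left_mono) auto
    moreover have "z q j = - R + 2 * R * (real (q (c j)) / real p)" using that by (simp add: z_def)
    ultimately show ?thesis by linarith
  qed
  moreover have "z q j = 0" if "j \<notin> N" for j using that by (simp add: z_def)
  ultimately show ?thesis by blast
qed

text \<open>The functions \<open>D\<close> are the partial derivatives of \<open>g\<close>, and the conclusion is that
  \<open>f x = (\<Sum>i\<in>I. \<kappa> i * (x i)\<^sup>2 / 2) + g x\<close> has a critical point. If the gradient stayed away from
  \<open>0\<close>, a gradient step of fixed size would lower \<open>f\<close> by a fixed amount. In a negative direction the
  step does not decrease \<open>\<bar>x i\<bar>\<close> once it is large. So the iterated step maps the faces of a cube in
  the negative directions outward, and by the Poincare-Miranda theorem some point of this cube
  returns close to \<open>0\<close> in all these directions. Both at this point and at its image \<open>f\<close> is under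
  control: \<open>f \<le> C\<close> at the first, since only negative squares enter, and \<open>f\<close> is bounded below at the
  second. That contradicts the decrease. Hence the gradient is arbitrarily small somewhere in a
  compact set, by periodicity in the directions with \<open>\<kappa> i = 0\<close>, and by continuity it vanishes
  somewhere in this set.\<close>
lemma saddle_critical_point:
  fixes g :: "('i \<Rightarrow> real) \<Rightarrow> real" and D :: "('i \<Rightarrow> real) \<Rightarrow> 'i \<Rightarrow> real" and \<kappa> :: "'i \<Rightarrow> real"
  assumes fin: "finite I" and L: "L \<ge> 0"
    and gC: "\<And>x. \<bar>g x\<bar> \<le> C" and DC: "\<And>x i. i \<in> I \<Longrightarrow> \<bar>D x i\<bar> \<le> C"
    and lip: "\<And>x y i. i \<in> I \<Longrightarrow> \<bar>D x i - D y i\<bar> \<le> L * (\<Sum>j\<in>I. \<bar>x j - y j\<bar>)"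
    and tay: "\<And>x y. \<bar>g y - g x - (\<Sum>i\<in>I. D x i * (y i - x i))\<bar> \<le> L * (\<Sum>i\<in>I. (y i - x i)\<^sup>2)"
    and per: "\<And>x m i. i \<in> I \<Longrightarrow> (\<And>j. m j \<in> \<int>) \<Longrightarrow> (\<And>j. \<kappa> j \<noteq> 0 \<Longrightarrow> m j = 0) \<Longrightarrow>
        D (\<lambda>j. x j + m j) i = D x i"
  shows "\<exists>x. (\<forall>i\<in>I. \<kappa> i * x i + D x i = 0) \<and> (\<forall>i\<in>I. \<kappa> i = 0 \<longrightarrow> 0 \<le> x i \<and> x i \<le> 1)"
proof -
  define gr where "gr = (\<lambda>x i. \<kappa> i * x i + D x i)"
  have C0: "C \<ge> 0" using gC[of undefined] by linarith
  have approx: "\<exists>x. \<forall>i\<in>I. \<bar>gr x i\<bar> \<le> d" if d: "d > 0" for d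
  proof (rule ccontr)
    assume "\<not> ?thesis"
    then have far: "\<exists>i\<in>I. \<bar>gr x i\<bar> > d" for x by (auto simp: not_le)
    have sq: "(\<Sum>i\<in>I. (gr x i)\<^sup>2) \<ge> d\<^sup>2" for x
    proof -
      obtain i where i: "i \<in> I" "\<bar>gr x i\<bar> > d" using far by blast
      then have "d\<^sup>2 \<le> (gr x i)\<^sup>2" using d by (simp add: abs_le_square_iff[symmetric])
      also have "\<dots> \<le> (\<Sum>i\<in>I. (gr x i)\<^sup>2)" using fin i by (intro member_le_sum) auto
      finally show ?thesis .
    qed
    define f where "f = (\<lambda>x. (\<Sum>i\<in>I. \<kappa> i * (x i)\<^sup>2 / 2) + g x)"
    define N where "N = {i\<in>I. \<kappa> i < 0}"
    define K where "K = (\<Sum>i\<in>I. \<bar>\<kappa> i\<bar>)"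
    have K0: "K \<ge> 0" unfolding K_def by (intro sum_nonneg) auto
    have Ki: "\<bar>\<kappa> i\<bar> \<le> K" if "i \<in> I" for i
      unfolding K_def using fin that by (intro member_le_sum) auto
    \<comment> \<open>Small enough for the second-order error of a step to be at most half of its first-order
      gain.\<close>
    define \<eta> where "\<eta> = 1 / (2 * (K + L + 1))"
    have \<eta>: "\<eta> > 0" "\<eta> * (K + L) \<le> 1 / 2" using K0 L by (auto simp: \<eta>_def field_simps)
    define step where "step = (\<lambda>x i. if i \<in> I then x i - \<eta> * gr x i else x i)"
    have expand: "f y - f x - (\<Sum>i\<in>I. gr x i * (y i - x i)) \<le> (K + L) * (\<Sum>i\<in>I. (y i - x i)\<^sup>2)" for x y
    proof -
      have "f y - f x - (\<Sum>i\<in>I. gr x i * (y i - x i)) =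
          (\<Sum>i\<in>I. \<kappa> i * (y i - x i)\<^sup>2 / 2) + (g y - g x - (\<Sum>i\<in>I. D x i * (y i - x i)))"
        by (simp add: f_def gr_def sum_subtractf[symmetric] sum.distrib[symmetric] algebra_simps)
           (simp add: algebra_simps power2_eq_square sum_subtractf sum.distrib sum_negf[symmetric]
             add_divide_distrib diff_divide_distrib flip: sum.distrib sum_subtractf)
      also have "(\<Sum>i\<in>I. \<kappa> i * (y i - x i)\<^sup>2 / 2) \<le> (\<Sum>i\<in>I. K * (y i - x i)\<^sup>2)"
      proof (intro sum_mono)
        fix i assume "i \<in> I"
        then have "\<kappa> i * (y i - x i)\<^sup>2 \<le> K * (y i - x i)\<^sup>2" "0 \<le> K * (y i - x i)\<^sup>2"
          using Ki[of i] K0 by (auto intro: mult_right_mono)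
        then show "\<kappa> i * (y i - x i)\<^sup>2 / 2 \<le> K * (y i - x i)\<^sup>2" by linarith
      qed
      finally show ?thesis using tay[of y x] by (simp add: sum_distrib_left[symmetric] algebra_simps)
    qed
    have desc: "f (step x) \<le> f x - \<eta> / 2 * d\<^sup>2" for x
    proof -
      define s where "s = (\<Sum>i\<in>I. (gr x i)\<^sup>2)"
      have "(\<Sum>i\<in>I. gr x i * (step x i - x i)) = - \<eta> * s"
        by (auto simp: s_def step_def sum_distrib_left power2_eq_square intro!: sum.cong)
      moreover have "(\<Sum>i\<in>I. (step x i - x i)\<^sup>2) = \<eta>\<^sup>2 * s"
        by (auto simp: s_def step_def sum_distrib_left power_mult_distrib intro!: sum.cong)
      ultimately have "f (step x) \<le> f x - \<eta> * s + (K + L) * (\<eta>\<^sup>2 * s)"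
        using expand[of "step x" x] by simp
      also have "(K + L) * (\<eta>\<^sup>2 * s) = (\<eta> * (K + L)) * (\<eta> * s)" by (simp add: power2_eq_square)
      also have "\<dots> \<le> 1 / 2 * (\<eta> * s)"
        using \<eta> by (intro mult_right_mono) (auto simp: s_def intro!: sum_nonneg mult_nonneg_nonneg)
      finally have "f (step x) \<le> f x - \<eta> / 2 * s" by simp
      moreover have "\<eta> / 2 * d\<^sup>2 \<le> \<eta> / 2 * s" using \<eta> sq[of x] by (simp add: s_def)
      ultimately show ?thesis by linarith
    qed
    have descn: "f ((step ^^ n) x) \<le> f x - real n * (\<eta> / 2 * d\<^sup>2)" for n x
    proof (induction n)
      case (Suc n)
      then show ?case using desc[of "(step ^^ n) x"] by (simp add: algebra_simps add_divide_distrib)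
    qed simp
    \<comment> \<open>From \<open>\<bar>x i\<bar> = R\<close> on, the quadratic term of the gradient dominates that of \<open>g\<close>.\<close>
    define R where "R = (\<Sum>i\<in>N. C / \<bar>\<kappa> i\<bar>) + 1"
    have N: "finite N" "N \<subseteq> I" using fin by (auto simp: N_def)
    have RC: "C \<le> \<bar>\<kappa> i\<bar> * R" if "i \<in> N" for i
    proof -
      have "C / \<bar>\<kappa> i\<bar> \<le> (\<Sum>i\<in>N. C / \<bar>\<kappa> i\<bar>)"
        using N that C0 by (intro member_le_sum) auto
      then have "C / \<bar>\<kappa> i\<bar> \<le> R" by (simp add: R_def)
      then show ?thesis using that by (auto simp: N_def field_simps)
    qed
    have R: "R > 0" unfolding R_def using C0 by (intro add_nonneg_pos sum_nonneg) auto
    have up1: "R \<le> step x i" if "i \<in> N" "R \<le> x i" for x i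
    proof -
      have "\<bar>\<kappa> i\<bar> * R \<le> \<bar>\<kappa> i\<bar> * x i" using that by (intro mult_left_mono) auto
      moreover have "\<kappa> i * x i = - (\<bar>\<kappa> i\<bar> * x i)" using that by (simp add: N_def)
      ultimately have "gr x i \<le> 0" using RC[OF that(1)] DC[of i x] that N unfolding gr_def by auto
      then have "\<eta> * gr x i \<le> 0" using \<eta> by (simp add: mult_le_0_iff)
      then show ?thesis using that N by (auto simp: step_def)
    qed
    have down1: "step x i \<le> - R" if "i \<in> N" "x i \<le> - R" for x i
    proof -
      have "\<bar>\<kappa> i\<bar> * x i \<le> \<bar>\<kappa> i\<bar> * (- R)" using that by (intro mult_left_mono) auto
      moreover have "\<kappa> i * x i = - (\<bar>\<kappa> i\<bar> * x i)" using that by (simp add: N_def)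
      ultimately have "gr x i \<ge> 0" using RC[OF that(1)] DC[of i x] that N unfolding gr_def by auto
      then have "\<eta> * gr x i \<ge> 0" using \<eta> by simp
      then show ?thesis using that N by (auto simp: step_def)
    qed
    have upn: "R \<le> (step ^^ n) x i" if "i \<in> N" "R \<le> x i" for x i n
      using that by (induction n) (auto intro: up1)
    have downn: "(step ^^ n) x i \<le> - R" if "i \<in> N" "x i \<le> - R" for x i n
      using that by (induction n) (auto intro: down1)
    define \<Lambda> where "\<Lambda> = 1 + \<eta> * K + \<eta> * (real (card I) * L)"
    have lip1: "(\<Sum>i\<in>I. \<bar>step x i - step y i\<bar>) \<le> \<Lambda> * (\<Sum>i\<in>I. \<bar>x i - y i\<bar>)" for x y
    proof -
      define s where "s = (\<Sum>i\<in>I. \<bar>x i - y i\<bar>)"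
      have "\<bar>step x i - step y i\<bar> \<le> (1 + \<eta> * K) * \<bar>x i - y i\<bar> + \<eta> * (L * s)" if i: "i \<in> I" for i
      proof -
        have "step x i - step y i = (x i - y i) - \<eta> * (\<kappa> i * (x i - y i)) - \<eta> * (D x i - D y i)"
          using i by (simp add: step_def gr_def algebra_simps)
        also have "\<bar>\<dots>\<bar> \<le> \<bar>x i - y i\<bar> + \<bar>\<eta> * (\<kappa> i * (x i - y i))\<bar> + \<bar>\<eta> * (D x i - D y i)\<bar>" by linarith
        also have "\<bar>\<eta> * (\<kappa> i * (x i - y i))\<bar> = \<eta> * (\<bar>\<kappa> i\<bar> * \<bar>x i - y i\<bar>)" using \<eta> by (simp add: abs_mult)
        also have "\<dots> \<le> \<eta> * (K * \<bar>x i - y i\<bar>)"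
          using \<eta> Ki[OF i] by (intro mult_left_mono mult_right_mono) auto
        also have "\<bar>\<eta> * (D x i - D y i)\<bar> = \<eta> * \<bar>D x i - D y i\<bar>" using \<eta> by (simp add: abs_mult)
        also have "\<dots> \<le> \<eta> * (L * s)" using \<eta> lip[OF i, of x y] by (intro mult_left_mono) (auto simp: s_def)
        finally show ?thesis by (simp add: algebra_simps)
      qed
      then have "(\<Sum>i\<in>I. \<bar>step x i - step y i\<bar>) \<le> (\<Sum>i\<in>I. (1 + \<eta> * K) * \<bar>x i - y i\<bar> + \<eta> * (L * s))"
        by (intro sum_mono) auto
      also have "\<dots> = \<Lambda> * s"
        by (simp add: sum.distrib sum_distrib_left[symmetric] s_def[symmetric] \<Lambda>_def algebra_simps)
      finally show ?thesis by (simp add: s_def)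
    qed
    have \<Lambda>: "\<Lambda> \<ge> 0" using \<eta> K0 L by (simp add: \<Lambda>_def)
    have lipn: "(\<Sum>i\<in>I. \<bar>(step ^^ n) x i - (step ^^ n) y i\<bar>) \<le> \<Lambda> ^ n * (\<Sum>i\<in>I. \<bar>x i - y i\<bar>)" for x y n
    proof (induction n)
      case (Suc n)
      have "(\<Sum>i\<in>I. \<bar>(step ^^ Suc n) x i - (step ^^ Suc n) y i\<bar>)
          \<le> \<Lambda> * (\<Sum>i\<in>I. \<bar>(step ^^ n) x i - (step ^^ n) y i\<bar>)"
        using lip1 by simp
      also have "\<dots> \<le> \<Lambda> * (\<Lambda> ^ n * (\<Sum>i\<in>I. \<bar>x i - y i\<bar>))"
        using Suc \<Lambda> by (intro mult_left_mono)
      finally show ?case by (simp add: mult.assoc)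
    qed simp
    obtain n :: nat where n: "real n * (\<eta> / 2 * d\<^sup>2) > 2 * C + K"
    proof -
      have "0 < \<eta> / 2 * d\<^sup>2" using \<eta> d by simp
      then show ?thesis using reals_Archimedean3 that by blast
    qed
    have "\<exists>x. (\<forall>j. j \<notin> N \<longrightarrow> x j = 0) \<and> (\<forall>j\<in>N. \<bar>x j\<bar> \<le> R) \<and> (\<forall>i\<in>N. \<bar>(step ^^ n) x i\<bar> \<le> 1)"
    proof (rule approx_Poincare_Miranda[where L = "\<Lambda> ^ n"])
      fix x y :: "'i \<Rightarrow> real" and i
      assume i: "i \<in> N" and eq: "\<And>j. j \<notin> N \<Longrightarrow> x j = y j"
      have "\<bar>(step ^^ n) x i - (step ^^ n) y i\<bar> \<le> (\<Sum>i\<in>I. \<bar>(step ^^ n) x i - (step ^^ n) y i\<bar>)"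
        using fin i N by (intro member_le_sum) auto
      also have "\<dots> \<le> \<Lambda> ^ n * (\<Sum>i\<in>I. \<bar>x i - y i\<bar>)" by (rule lipn)
      also have "(\<Sum>i\<in>I. \<bar>x i - y i\<bar>) = (\<Sum>i\<in>N. \<bar>x i - y i\<bar>)"
        using fin N eq by (intro sum.mono_neutral_right) auto
      finally show "\<bar>(step ^^ n) x i - (step ^^ n) y i\<bar> \<le> \<Lambda> ^ n * (\<Sum>j\<in>N. \<bar>x j - y j\<bar>)" .
    next
      fix x :: "'i \<Rightarrow> real" and i assume "i \<in> N" "x i = R"
      then show "0 \<le> (step ^^ n) x i" using upn[of i x n] R by simp
    next
      fix x :: "'i \<Rightarrow> real" and i assume "i \<in> N" "x i = - R"
      then show "(step ^^ n) x i \<le> 0" using downn[of i x n] R by simp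
    qed (use N R in auto)
    then obtain x where x: "\<And>j. j \<notin> N \<Longrightarrow> x j = 0" "\<And>i. i \<in> N \<Longrightarrow> \<bar>(step ^^ n) x i\<bar> \<le> 1"
      by blast
    define z where "z = (step ^^ n) x"
    have "(\<Sum>i\<in>I. \<kappa> i * (x i)\<^sup>2 / 2) \<le> 0"
    proof (intro sum_nonpos)
      fix i assume "i \<in> I"
      show "\<kappa> i * (x i)\<^sup>2 / 2 \<le> 0"
        using x(1)[of i] by (cases "i \<in> N") (auto simp: N_def mult_le_0_iff)
    qed
    then have "f x \<le> C" using gC[of x] by (simp add: f_def)
    moreover have "(\<Sum>i\<in>I. \<kappa> i * (z i)\<^sup>2 / 2) \<ge> (\<Sum>i\<in>I. - \<bar>\<kappa> i\<bar>)"
    proof (intro sum_mono)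
      fix i assume i: "i \<in> I"
      show "\<kappa> i * (z i)\<^sup>2 / 2 \<ge> - \<bar>\<kappa> i\<bar>"
      proof (cases "i \<in> N")
        case True
        then have "(z i)\<^sup>2 \<le> 1" using x(2)[of i] by (simp add: z_def abs_square_le_1)
        then have "\<bar>\<kappa> i\<bar> * (z i)\<^sup>2 \<le> \<bar>\<kappa> i\<bar> * 1" by (intro mult_left_mono) auto
        then show ?thesis using True by (auto simp: N_def)
      next
        case False
        then have "\<kappa> i \<ge> 0" using i by (auto simp: N_def)
        then have "\<kappa> i * (z i)\<^sup>2 \<ge> 0" by simp
        then show ?thesis by linarith
      qed
    qed
    then have "(\<Sum>i\<in>I. \<kappa> i * (z i)\<^sup>2 / 2) \<ge> - K" by (simp add: K_def sum_negf)
    then have "f z \<ge> - K - C" using gC[of z] by (simp add: f_def)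
    ultimately show False using descn[of n x] n by (simp add: z_def)
  qed
  \<comment> \<open>A compact box containing, after translation by integers in the directions with \<open>\<kappa> i = 0\<close>,
    every point at which the components of the gradient are at most \<open>1\<close>; the coordinates outside \<open>I\<close>
    are set to \<open>0\<close>.\<close>
  define A where "A = (\<lambda>i. if i \<in> I then (if \<kappa> i = 0 then {0..1} else {- ((C + 1) / \<bar>\<kappa> i\<bar>) .. (C + 1) / \<bar>\<kappa> i\<bar>}) else {0::real})"
  have Dcong: "D x i = D y i" if "i \<in> I" "\<And>j. j \<in> I \<Longrightarrow> x j = y j" for x y i
    using lip[OF that(1), of x y] that(2) by simp
  have near: "\<exists>x\<in>PiE UNIV A. \<forall>i\<in>I. \<bar>gr x i\<bar> \<le> d" if d: "d > 0" "d \<le> 1" for d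
  proof -
    obtain x where x: "\<And>i. i \<in> I \<Longrightarrow> \<bar>gr x i\<bar> \<le> d" using approx[OF d(1)] by blast
    define m where "m = (\<lambda>j. if \<kappa> j = 0 then - of_int \<lfloor>x j\<rfloor> else 0 :: real)"
    define y where "y = (\<lambda>i. if i \<in> I then x i + m i else 0)"
    have Dy: "D y i = D x i" if "i \<in> I" for i
    proof -
      have "D y i = D (\<lambda>j. x j + m j) i" using that by (intro Dcong) (auto simp: y_def)
      also have "\<dots> = D x i" using that by (intro per) (auto simp: m_def)
      finally show ?thesis .
    qed
    have g: "gr y i = gr x i" if "i \<in> I" for i
      using that Dy[OF that] by (auto simp: gr_def y_def m_def)
    have "y i \<in> A i" for i
    proof -
      have "\<bar>x i\<bar> \<le> (C + 1) / \<bar>\<kappa> i\<bar>" if "i \<in> I" "\<kappa> i \<noteq> 0"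
      proof -
        have "\<bar>\<kappa> i\<bar> * \<bar>x i\<bar> \<le> C + 1"
          using x[OF that(1)] DC[OF that(1), of x] d unfolding gr_def abs_mult[symmetric] by linarith
        then show ?thesis using that by (simp add: field_simps)
      qed
      then show ?thesis
        by (auto simp: A_def y_def m_def abs_le_iff; linarith)
    qed
    then have "y \<in> PiE UNIV A" by auto
    then show ?thesis using g x by (intro bexI[of _ y]) auto
  qed
  have cA: "compact (PiE UNIV A)"
  proof -
    have "compactin (product_topology (\<lambda>i::'i. euclidean) UNIV) (PiE UNIV A)"
      unfolding compactin_PiE by (auto simp: A_def)
    then show ?thesis by (simp add: euclidean_product_topology)
  qed
  define F where "F = (\<lambda>x. \<Sum>i\<in>I. \<bar>gr x i\<bar>)"
  have cD: "continuous_on UNIV (\<lambda>x. D x i)" if i: "i \<in> I" for i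
    unfolding continuous_on
  proof
    fix x :: "'i \<Rightarrow> real"
    have co: "((\<lambda>y. y j) \<longlongrightarrow> x j) (at x)" for j
      using continuous_on_product_coordinates[of j] by (auto simp: continuous_on)
    have "((\<lambda>y. L * (\<Sum>j\<in>I. \<bar>y j - x j\<bar>)) \<longlongrightarrow> L * (\<Sum>j\<in>I. \<bar>x j - x j\<bar>)) (at x)"
      by (intro tendsto_intros co)
    then have lim: "((\<lambda>y. L * (\<Sum>j\<in>I. \<bar>y j - x j\<bar>)) \<longlongrightarrow> 0) (at x)" by simp
    have "((\<lambda>y. D y i - D x i) \<longlongrightarrow> 0) (at x)"
    proof (rule Lim_null_comparison[OF _ lim])
      show "\<forall>\<^sub>F y in at x. norm (D y i - D x i) \<le> L * (\<Sum>j\<in>I. \<bar>y j - x j\<bar>)"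
        using lip[OF i] by (simp add: always_eventually)
    qed
    then show "((\<lambda>x. D x i) \<longlongrightarrow> D x i) (at x within UNIV)" by (simp add: LIM_zero_iff)
  qed
  have cF: "continuous_on (PiE UNIV A) F"
    unfolding F_def gr_def
  proof (intro continuous_on_sum continuous_on_rabs continuous_on_add continuous_on_mult continuous_on_const)
    fix i assume i: "i \<in> I"
    show "continuous_on (PiE UNIV A) (\<lambda>x. x i)"
      by (rule continuous_on_subset[OF continuous_on_product_coordinates]) simp
    show "continuous_on (PiE UNIV A) (\<lambda>x. D x i)"
      by (rule continuous_on_subset[OF cD[OF i]]) simp
  qed
  have "PiE UNIV A \<noteq> {}" using near[of 1] by auto
  then obtain x where x: "x \<in> PiE UNIV A" "\<And>y. y \<in> PiE UNIV A \<Longrightarrow> F x \<le> F y"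
    using continuous_attains_inf[OF cA _ cF] by blast
  have F0: "F x \<le> real (card I) * d" if d: "d > 0" "d \<le> 1" for d
  proof -
    obtain y where y: "y \<in> PiE UNIV A" "\<And>i. i \<in> I \<Longrightarrow> \<bar>gr y i\<bar> \<le> d" using near[OF d] by blast
    have "F y \<le> (\<Sum>i\<in>I. d)" unfolding F_def by (intro sum_mono y(2))
    then show ?thesis using x(2)[OF y(1)] by simp
  qed
  have "F x \<le> 0"
  proof (rule field_le_epsilon)
    fix e :: real assume e: "e > 0"
    define d where "d = min 1 (e / (real (card I) + 1))"
    have "d > 0" "d \<le> 1" using e by (auto simp: d_def)
    moreover have "real (card I) * d \<le> real (card I) * (e / (real (card I) + 1))"
      by (intro mult_left_mono) (auto simp: d_def)
    moreover have "\<dots> \<le> e" using e by (simp add: field_simps)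
    ultimately show "F x \<le> 0 + e" using F0[of d] by linarith
  qed
  moreover have "F x \<ge> 0" by (auto simp: F_def intro: sum_nonneg)
  ultimately have "F x = 0" by linarith
  then have "\<forall>i\<in>I. gr x i = 0" using fin by (simp add: F_def sum_nonneg_eq_0_iff)
  moreover have "0 \<le> x i \<and> x i \<le> 1" if "i \<in> I" "\<kappa> i = 0" for i
  proof -
    have "x i \<in> A i" using x(1) by auto
    then show ?thesis using that by (simp add: A_def)
  qed
  ultimately show ?thesis unfolding gr_def by blast
qed

section \<open>The mean of a function on the torus\<close>

text \<open>The mean over the torus is built from averages over unit segments, and not from a measure on
  the cube: then a derivative in direction \<open>i\<close> is annihilated by the average in that direction, and
  continuity is all that the calculus below asks for.\<close>
definition avg :: "3 \<Rightarrow> (real ^ 3 \<Rightarrow> real) \<Rightarrow> real ^ 3 \<Rightarrow> real" where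
  "avg i f = (\<lambda>t. integral {0..1} (\<lambda>s. f (t + s *\<^sub>R axis i 1)))"

definition mean :: "(real ^ 3 \<Rightarrow> real) \<Rightarrow> real" where
  "mean f = avg 1 (avg 2 (avg 3 f)) 0"

definition periodic3 :: "(real ^ 3 \<Rightarrow> 'a) \<Rightarrow> bool" where
  "periodic3 f \<longleftrightarrow> (\<forall>i t. f (t + axis i 1) = f t)"

lemma continuous_line:
  fixes f :: "real ^ 3 \<Rightarrow> 'b::topological_space"
  assumes "continuous_on UNIV f"
  shows "continuous_on S (\<lambda>s. f (t + s *\<^sub>R v))"
  using assms by (intro continuous_on_compose2[OF assms] continuous_intros) auto

lemma integrable_line:
  fixes f :: "real ^ 3 \<Rightarrow> real"
  assumes "continuous_on UNIV f"
  shows "(\<lambda>s. f (t + s *\<^sub>R v)) integrable_on {0..1}"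
  by (intro integrable_continuous_interval continuous_line assms)

lemma continuous_avg:
  assumes "continuous_on UNIV f"
  shows "continuous_on UNIV (avg i f)"
proof -
  have "continuous_on UNIV (\<lambda>t. integral (cbox 0 1) (\<lambda>s. f (t + s *\<^sub>R axis i 1)))"
    by (intro integral_continuous_on_param)
       (auto simp: split_beta intro!: continuous_on_compose2[OF assms] continuous_intros)
  then show ?thesis by (simp add: avg_def cbox_interval)
qed

lemma avg_add:
  assumes "continuous_on UNIV f" "continuous_on UNIV g"
  shows "avg i (\<lambda>t. f t + g t) = (\<lambda>t. avg i f t + avg i g t)"
  by (simp add: avg_def integral_add integrable_line assms)

lemma avg_cmult: "avg i (\<lambda>t. c * f t) = (\<lambda>t. c * avg i f t)"
  by (simp add: avg_def)

lemma avg_const: "avg i (\<lambda>t. c) = (\<lambda>t. c)"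
  by (simp add: avg_def)

lemma avg_mono:
  assumes "continuous_on UNIV f" "continuous_on UNIV g" "\<And>t. f t \<le> g t"
  shows "avg i f t \<le> avg i g t"
  by (simp add: avg_def integral_le integrable_line assms)

lemma avg_commute:
  assumes "continuous_on UNIV f"
  shows "avg i (avg j f) = avg j (avg i f)"
proof
  fix t
  have "integral (cbox 0 1) (\<lambda>s. integral (cbox 0 1) (\<lambda>r. f (t + s *\<^sub>R axis i 1 + r *\<^sub>R axis j 1))) =
    integral (cbox 0 1) (\<lambda>r. integral (cbox 0 1) (\<lambda>s. f (t + s *\<^sub>R axis i 1 + r *\<^sub>R axis j 1)))"
    by (rule integral_swap_continuous)
       (auto simp: split_beta intro!: continuous_on_compose2[OF assms] continuous_intros)
  then show "avg i (avg j f) t = avg j (avg i f) t"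
    by (simp add: avg_def cbox_interval algebra_simps)
qed

lemma mean_add:
  assumes "continuous_on UNIV f" "continuous_on UNIV g"
  shows "mean (\<lambda>t. f t + g t) = mean f + mean g"
  by (simp add: mean_def avg_add continuous_avg assms)

lemma mean_cmult: "mean (\<lambda>t. c * f t) = c * mean f"
  by (simp add: mean_def avg_cmult)

lemma mean_cmult_right: "mean (\<lambda>t. f t * c) = mean f * c"
  using mean_cmult[of c f] by (simp add: mult.commute)

lemma mean_const [simp]: "mean (\<lambda>t. c) = c"
  by (simp add: mean_def avg_const)

lemma mean_uminus: "mean (\<lambda>t. - f t) = - mean f"
  using mean_cmult[of "-1" f] by simp

lemma mean_diff:
  assumes "continuous_on UNIV f" "continuous_on UNIV g"
  shows "mean (\<lambda>t. f t - g t) = mean f - mean g"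
  using mean_add[of f "\<lambda>t. - g t"] assms by (simp add: mean_uminus continuous_on_minus)

lemma mean_sum:
  assumes "\<And>i. i \<in> I \<Longrightarrow> continuous_on UNIV (f i)"
  shows "mean (\<lambda>t. \<Sum>i\<in>I. f i t) = (\<Sum>i\<in>I. mean (f i))"
  using assms by (induction I rule: infinite_finite_induct)
    (simp_all add: mean_add continuous_on_sum)

lemma mean_mono:
  assumes "continuous_on UNIV f" "continuous_on UNIV g" "\<And>t. f t \<le> g t"
  shows "mean f \<le> mean g"
  unfolding mean_def by (intro avg_mono continuous_avg assms)

lemma mean_abs_le:
  assumes "continuous_on UNIV f" "\<And>t. \<bar>f t\<bar> \<le> B"
  shows "\<bar>mean f\<bar> \<le> B"
proof -
  have "mean f \<le> mean (\<lambda>t. B)" using assms by (intro mean_mono) (auto simp: abs_le_iff)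
  moreover have "mean (\<lambda>t. - B) \<le> mean f" using assms by (intro mean_mono) (auto simp: abs_le_iff minus_le_iff)
  ultimately show ?thesis by (simp add: abs_le_iff)
qed

lemma mean_nonneg: "continuous_on UNIV f \<Longrightarrow> (\<And>t. 0 \<le> f t) \<Longrightarrow> 0 \<le> mean f"
  using mean_mono[of "\<lambda>t. 0" f] by simp

text \<open>The averages commute, so that the one in direction \<open>i\<close> can be taken first; it vanishes by
  the fundamental theorem of calculus.\<close>
lemma mean_pdiff_eq_0:
  assumes per: "periodic3 f" and d: "\<And>t. f differentiable (at t)"
    and c: "continuous_on UNIV (pdiff (axis i 1) f)"
  shows "mean (pdiff (axis i 1) f) = 0"
proof -
  have a: "avg i (pdiff (axis i 1) f) = (\<lambda>t. 0)"
  proof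
    fix t
    have "((\<lambda>s. pdiff (axis i 1) f (t + s *\<^sub>R axis i 1)) has_integral
        (f (t + 1 *\<^sub>R axis i 1) - f (t + 0 *\<^sub>R axis i 1))) {0..1}"
    proof (rule fundamental_theorem_of_calculus)
      fix s :: real
      have "(f has_derivative frechet_derivative f (at (t + s *\<^sub>R axis i 1))) (at (t + s *\<^sub>R axis i 1))"
        using d frechet_derivative_works by blast
      then have "((\<lambda>s. f (t + s *\<^sub>R axis i 1)) has_derivative
          (\<lambda>h. frechet_derivative f (at (t + s *\<^sub>R axis i 1)) (h *\<^sub>R axis i 1))) (at s within {0..1})"
        by (intro has_derivative_compose[of "\<lambda>s. t + s *\<^sub>R axis i 1" "\<lambda>h. h *\<^sub>R axis i 1" s "{0..1}" f])
           (auto intro!: derivative_eq_intros)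
      moreover have "frechet_derivative f (at (t + s *\<^sub>R axis i 1)) (h *\<^sub>R axis i 1) =
          h *\<^sub>R pdiff (axis i 1) f (t + s *\<^sub>R axis i 1)" for h
        unfolding pdiff_def using d by (intro linear_scale linear_frechet_derivative) auto
      ultimately show "((\<lambda>s. f (t + s *\<^sub>R axis i 1)) has_vector_derivative
          pdiff (axis i 1) f (t + s *\<^sub>R axis i 1)) (at s within {0..1})"
        by (simp add: has_vector_derivative_def)
    qed simp
    then show "avg i (pdiff (axis i 1) f) t = 0"
      using per by (simp add: avg_def periodic3_def integral_unique)
  qed
  define g where "g = pdiff (axis i 1) f"
  have cg: "continuous_on UNIV g" and ag: "avg i g = (\<lambda>t. 0)" using c a by (auto simp: g_def)
  have "mean g = avg 1 (avg 3 (avg 2 g)) 0" "mean g = avg 2 (avg 3 (avg 1 g)) 0"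
    unfolding mean_def
    using avg_commute[OF cg, of 2 3] avg_commute[OF cg, of 3 1] avg_commute[OF continuous_avg[OF cg], of 1 2 3]
    by simp_all
  moreover have "i = 1 \<or> i = 2 \<or> i = 3" by (rule exhaust_3)
  ultimately have "mean g = 0" using ag by (auto simp: mean_def avg_const)
  then show ?thesis by (simp add: g_def)
qed

section \<open>The Hartley basis\<close>

text \<open>The functions \<open>cas (j x)\<close> with \<open>j\<close> ranging over the integers form a real orthonormal basis
  of the periodic functions. The derivative of the \<open>j\<close>-th is \<open>2 \<pi> j\<close> times the \<open>- j\<close>-th, so one
  formula replaces the case distinctions between sines, cosines and constants.\<close>
definition cas :: "real \<Rightarrow> real" where
  "cas x = cos (2 * pi * x) + sin (2 * pi * x)"

lemma continuous_cas [continuous_intros]: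
  fixes f :: "'a::t2_space \<Rightarrow> real"
  shows "continuous_on S f \<Longrightarrow> continuous_on S (\<lambda>x. cas (f x))"
  unfolding cas_def by (intro continuous_intros)

lemma abs_cas_le: "\<bar>cas x\<bar> \<le> 2"
  unfolding cas_def using abs_cos_le_one[of "2 * pi * x"] abs_sin_le_one[of "2 * pi * x"] by linarith

lemma integral_cos_int:
  "((\<lambda>s. cos (2 * pi * (of_int m * s))) has_integral (if m = 0 then 1 else 0)) {0..1}"
proof (cases "m = 0")
  case False
  have "((\<lambda>s. cos (2 * pi * (of_int m * s))) has_integral
      (sin (2 * pi * (of_int m * 1)) / (2 * pi * of_int m) - sin (2 * pi * (of_int m * 0)) / (2 * pi * of_int m))) {0..1}"
    using False by (intro fundamental_theorem_of_calculus)
      (auto intro!: derivative_eq_intros simp flip: has_real_derivative_iff_has_vector_derivative)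
  moreover have "sin (2 * pi * of_int m) = 0"
    using sin_integer_2pi[of "of_int m"] by simp
  ultimately show ?thesis using False by simp
qed (use has_integral_const_real[of "1::real" 0 1] in simp)

lemma integral_sin_int:
  "((\<lambda>s. sin (2 * pi * (of_int m * s))) has_integral 0) {0..1}"
proof (cases "m = 0")
  case False
  have "((\<lambda>s. sin (2 * pi * (of_int m * s))) has_integral
      (- cos (2 * pi * (of_int m * 1)) / (2 * pi * of_int m) - - cos (2 * pi * (of_int m * 0)) / (2 * pi * of_int m))) {0..1}"
    using False by (intro fundamental_theorem_of_calculus)
      (auto intro!: derivative_eq_intros simp flip: has_real_derivative_iff_has_vector_derivative)
  moreover have "cos (2 * pi * of_int m) = 1"
    using cos_integer_2pi[of "of_int m"] by simp
  ultimately show ?thesis by simp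
qed simp

lemma cas_mult: "cas x * cas y = cos (2 * pi * (x - y)) + sin (2 * pi * (x + y))"
  by (simp add: cas_def cos_diff sin_add algebra_simps)

lemma integral_cas_cas:
  "integral {0..1} (\<lambda>s. cas (of_int j * s) * cas (of_int l * s)) = (if j = l then 1 else 0)"
proof -
  have "((\<lambda>s. cos (2 * pi * (of_int (j - l) * s)) + sin (2 * pi * (of_int (j + l) * s))) has_integral
     ((if j - l = 0 then 1 else 0) + 0)) {0..1}"
    by (intro has_integral_add integral_cos_int integral_sin_int)
  then show ?thesis
    by (auto simp: cas_mult algebra_simps dest: integral_unique)
qed

lemma integral_periodic_shift:
  fixes u :: "real \<Rightarrow> real"
  assumes c: "continuous_on UNIV u" and per: "\<And>x. u (x + 1) = u x"
  shows "integral {0..1} (\<lambda>s. u (s + h)) = integral {0..1} u"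
proof -
  have peri: "u (x + of_int m) = u x" for x m
  proof (induction m rule: int_induct[where k = 0])
    case (step1 i) then show ?case using per[of "x + of_int i"] by (simp add: algebra_simps)
  next
    case (step2 i) then show ?case using per[of "x + of_int (i - 1)"] by (simp add: algebra_simps)
  qed simp
  have i: "u integrable_on {a..b}" for a b
    by (intro integrable_continuous_interval continuous_on_subset[OF c]) auto
  define r where "r = frac h"
  have r: "0 \<le> r" "r < 1" by (auto simp: r_def frac_lt_1)
  have sh: "integral {a..b} (\<lambda>s. u (s + d)) = integral {a + d..b + d} u" for a b d
    using integral_shift[OF continuous_on_subset[OF c], of a d b] by (simp add: o_def)
  have "u (s + h) = u (s + r)" for s
    using peri[of "s + r" "\<lfloor>h\<rfloor>"] by (simp add: r_def frac_def)
  then have "integral {0..1} (\<lambda>s. u (s + h)) = integral {r..1 + r} u"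
    using sh[of 0 1 r] by simp
  also have "\<dots> = integral {r..1} u + integral {1..1 + r} u"
    using r by (intro Henstock_Kurzweil_Integration.integral_combine[symmetric] i) auto
  also have "integral {1..1 + r} u = integral {0..r} u"
    using sh[of 0 r 1] per by (simp add: add.commute)
  also have "integral {r..1} u + integral {0..r} u = integral {0..1} u"
    using r Henstock_Kurzweil_Integration.integral_combine[of 0 r 1 u] i by auto
  finally show ?thesis .
qed

text \<open>After a translation the point in question is \<open>1/2\<close>, where the trigonometric polynomial
  \<open>\<phi> s = (1 - cos (2 \<pi> s)) / 2\<close> has its only maximum in the period. All integrals \<open>\<integral> v \<phi>\<^sup>m\<close> vanish,
  but for large \<open>m\<close> they are dominated by values of \<open>v\<close> near \<open>1/2\<close>, so \<open>v\<close> vanishes there.\<close>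
lemma Fourier_uniqueness_1d:
  fixes u :: "real \<Rightarrow> real"
  assumes c: "continuous_on UNIV u" and per: "\<And>x. u (x + 1) = u x"
    and orth: "\<And>j::int. integral {0..1} (\<lambda>s. u s * cas (of_int j * s)) = 0"
  shows "u x = 0"
proof -
  note cu [continuous_intros] = continuous_on_compose2[OF c _ subset_UNIV]
  define co si where "co = (\<lambda>j::int. integral {0..1} (\<lambda>s. u s * cos (2 * pi * (of_int j * s))))"
    and "si = (\<lambda>j::int. integral {0..1} (\<lambda>s. u s * sin (2 * pi * (of_int j * s))))"
  \<comment> \<open>The coefficients for \<open>j\<close> and \<open>- j\<close> separate cosines from sines.\<close>
  have "co j + si j = 0" for j
    using orth[of j] unfolding co_def si_def cas_def
    by (subst integral_add[symmetric]) (auto intro!: integrable_continuous_interval continuous_intros simp: algebra_simps)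
  moreover have "co (- j) = co j" "si (- j) = - si j" for j by (simp_all add: co_def si_def)
  ultimately have cosi: "co j = 0" "si j = 0" for j
    by (metis add.right_neutral add_eq_0_iff eq_neg_iff_add_eq_0 neg_equal_zero)+
  define v where "v = (\<lambda>s. u (s + (x - 1/2)))"
  have cv [continuous_intros]: "continuous_on S (\<lambda>s. v (f s))" if "continuous_on S f" for S and f :: "real \<Rightarrow> real"
    unfolding v_def using that by (intro continuous_intros)
  have vco: "integral {0..1} (\<lambda>s. v s * cos (2 * pi * (of_int j * s))) = 0" for j :: int
  proof -
    define a where "a = 2 * pi * (of_int j * (x - 1/2))"
    have per2: "cos (2 * pi * (of_int j * (y + 1)) - a) = cos (2 * pi * (of_int j * y) - a)" for y
    proof -
      have "cos (2 * pi * (of_int j * (y + 1)) - a) = cos ((2 * pi * (of_int j * y) - a) + 2 * pi * of_int j)"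
        by (simp add: algebra_simps)
      also have "\<dots> = cos (2 * pi * (of_int j * y) - a)"
        by (simp only: cos_add[of _ "2 * pi * of_int j"] cos_int_2pin sin_int_2pin)
      finally show ?thesis .
    qed
    have "integral {0..1} (\<lambda>s. v s * cos (2 * pi * (of_int j * s))) =
        integral {0..1} (\<lambda>s. (\<lambda>y. u y * cos (2 * pi * (of_int j * y) - a)) (s + (x - 1/2)))"
      by (intro integral_cong) (simp add: v_def a_def algebra_simps)
    also have "\<dots> = integral {0..1} (\<lambda>y. u y * cos (2 * pi * (of_int j * y) - a))"
      by (rule integral_periodic_shift) (auto intro!: continuous_intros simp: per per2)
    also have "\<dots> = integral {0..1} (\<lambda>y. cos a * (u y * cos (2 * pi * (of_int j * y))) + sin a * (u y * sin (2 * pi * (of_int j * y))))"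
      by (intro integral_cong) (simp add: cos_diff algebra_simps)
    also have "\<dots> = cos a * co j + sin a * si j"
      unfolding co_def si_def
      by (subst integral_add) (auto intro!: integrable_continuous_interval continuous_intros)
    finally show ?thesis by (simp add: cosi)
  qed
  define \<phi> where "\<phi> = (\<lambda>s. (1 - cos (2 * pi * s)) / 2)"
  have c\<phi> [continuous_intros]: "continuous_on S (\<lambda>s. \<phi> (f s))" if "continuous_on S f" for S and f :: "real \<Rightarrow> real"
    unfolding \<phi>_def using that by (intro continuous_intros) auto
  have "\<forall>j::int. integral {0..1} (\<lambda>s. v s * \<phi> s ^ m * cos (2 * pi * (of_int j * s))) = 0" for m
  proof (induction m)
    case 0
    then show ?case by (simp add: vco)
  next
    case (Suc m)
    show ?case
    proof
      fix j :: int
      have e: "\<phi> s * cos (2 * pi * (of_int j * s)) = 1/2 * cos (2 * pi * (of_int j * s))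
         - 1/4 * cos (2 * pi * (of_int (j + 1) * s)) - 1/4 * cos (2 * pi * (of_int (j - 1) * s))" for s
        by (simp add: \<phi>_def cos_add cos_diff distrib_left distrib_right left_diff_distrib right_diff_distrib)
      define w where "w = (\<lambda>j::int. \<lambda>s. v s * \<phi> s ^ m * cos (2 * pi * (of_int j * s)))"
      have wi: "w j integrable_on {0..1}" for j
        unfolding w_def by (intro integrable_continuous_interval continuous_intros)
      have "integral {0..1} (\<lambda>s. v s * \<phi> s ^ Suc m * cos (2 * pi * (of_int j * s))) =
        integral {0..1} (\<lambda>s. 1/2 * w j s - 1/4 * w (j + 1) s - 1/4 * w (j - 1) s)"
      proof (intro integral_cong)
        fix s
        have "v s * \<phi> s ^ Suc m * cos (2 * pi * (of_int j * s)) = v s * \<phi> s ^ m * (\<phi> s * cos (2 * pi * (of_int j * s)))"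
          by simp
        also have "\<dots> = 1/2 * w j s - 1/4 * w (j + 1) s - 1/4 * w (j - 1) s"
          unfolding e w_def by (simp add: algebra_simps)
        finally show "v s * \<phi> s ^ Suc m * cos (2 * pi * (of_int j * s)) = 1/2 * w j s - 1/4 * w (j + 1) s - 1/4 * w (j - 1) s" .
      qed
      also have "\<dots> = 1/2 * integral {0..1} (w j) - 1/4 * integral {0..1} (w (j + 1)) - 1/4 * integral {0..1} (w (j - 1))"
        using wi by (simp add: integral_diff integrable_diff integrable_on_cmult_left)
      also have "\<dots> = 0"
      proof -
        have "integral {0..1} (w j) = 0" for j using Suc unfolding w_def by blast
        then show ?thesis by simp
      qed
      finally show "integral {0..1} (\<lambda>s. v s * \<phi> s ^ Suc m * cos (2 * pi * (of_int j * s))) = 0" .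
    qed
  qed
  from this have K0: "integral {0..1} (\<lambda>s. v s * \<phi> s ^ m) = 0" for m
    by (elim meta_allE[of _ m] allE[of _ 0]) simp
  have no: False if w: "continuous_on UNIV w" "w (1/2) > 0" "\<And>m. integral {0..1} (\<lambda>s. w s * \<phi> s ^ m) = 0" for w
  proof -
    note cw [continuous_intros] = continuous_on_compose2[OF w(1) _ subset_UNIV]
    define k where "k = w (1/2)"
    have "isCont w (1/2)" using w(1) by (simp add: continuous_on_eq_continuous_at)
    then obtain d0 where d0: "d0 > 0" "\<And>s. \<bar>s - 1/2\<bar> < d0 \<Longrightarrow> \<bar>w s - k\<bar> < k / 2"
      using w(2) unfolding continuous_at_eps_delta k_def[symmetric] dist_real_def
      by (metis half_gt_zero k_def)
    define d where "d = min (d0 / 2) (1/4)"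
    have d: "d > 0" "d < d0" "d < 1/2" using d0 by (auto simp: d_def min_def)
    have wk: "w s \<ge> k / 2" if "\<bar>s - 1/2\<bar> \<le> d" for s
      using d0(2)[of s] that d by linarith
    \<comment> \<open>The kernel as a decreasing function of the distance to \<open>1/2\<close>. Its values within \<open>d / 2\<close>
      exceed those beyond \<open>d\<close> by the factor \<open>r > 1\<close> below, whose powers outgrow every bound.\<close>
    define F where "F = (\<lambda>y. (1 + cos (2 * pi * y)) / 2)"
    have \<phi>F: "\<phi> s = F \<bar>s - 1/2\<bar>" for s
    proof -
      have "cos (2 * pi * \<bar>s - 1/2\<bar>) = cos \<bar>2 * pi * (s - 1/2)\<bar>" by (simp add: abs_mult)
      also have "\<dots> = cos (2 * pi * s - pi)" by (simp add: algebra_simps)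
      also have "\<dots> = - cos (2 * pi * s)" by (simp add: cos_diff)
      finally show ?thesis by (simp add: F_def \<phi>_def)
    qed
    have Fmono: "F z \<le> F y" if "0 \<le> y" "y \<le> z" "z \<le> 1/2" for y z
      unfolding F_def using that by (intro divide_right_mono add_left_mono cos_monotone_0_pi_le) auto
    have Fs: "F d < F (d / 2)"
      unfolding F_def using d by (intro divide_strict_right_mono add_strict_left_mono cos_monotone_0_pi) auto
    have "F (1/2) < F d"
      unfolding F_def using d by (intro divide_strict_right_mono add_strict_left_mono cos_monotone_0_pi) auto
    then have F0: "F d > 0" by (simp add: F_def)
    have "\<exists>B. \<forall>s\<in>{0..1}. \<bar>w s\<bar> \<le> B"
    proof -
      have "compact (w ` {0..1})" by (intro compact_continuous_image continuous_on_subset[OF w(1)]) auto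
      then have "bounded (w ` {0..1})" by (rule compact_imp_bounded)
      then show ?thesis by (auto simp: bounded_iff)
    qed
    then obtain B where B: "\<And>s. s \<in> {0..1} \<Longrightarrow> \<bar>w s\<bar> \<le> B" by blast
    have B0: "B \<ge> 0" using B[of 0] by auto
    have key: "k / 2 * F (d/2) ^ m * d \<le> B * F d ^ m" for m
    proof -
      define J where "J = {1/2 - d/2..1/2 + d/2}"
      have J: "J \<subseteq> {0..1}" using d by (auto simp: J_def)
      have hi: "((\<lambda>s. (if s \<in> J then k / 2 * F (d/2) ^ m else 0) - B * F d ^ m) has_integral
          (k / 2 * F (d/2) ^ m * d - B * F d ^ m)) {0..1}"
      proof (rule has_integral_diff)
        have "((\<lambda>s. k / 2 * F (d/2) ^ m) has_integral (k / 2 * F (d/2) ^ m * d)) J"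
          unfolding J_def using has_integral_const_real[of "k / 2 * F (d/2) ^ m" "1/2 - d/2" "1/2 + d/2"] d by (simp add: mult.commute)
        then show "((\<lambda>s. if s \<in> J then k / 2 * F (d/2) ^ m else 0) has_integral (k / 2 * F (d/2) ^ m * d)) {0..1}"
          using J unfolding J_def by (intro has_integral_restrict_closed_subinterval[where 'a = real, unfolded cbox_interval]) auto
        show "((\<lambda>s. B * F d ^ m) has_integral (B * F d ^ m)) {0..1::real}"
          using has_integral_const_real[of "B * F d ^ m" 0 1] by simp
      qed
      have "k / 2 * F (d/2) ^ m * d - B * F d ^ m \<le> integral {0..1} (\<lambda>s. w s * \<phi> s ^ m)"
      proof (rule has_integral_le[OF hi integrable_integral])
        show "(\<lambda>s. w s * \<phi> s ^ m) integrable_on {0..1}"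
          by (intro integrable_continuous_interval continuous_intros)
        fix s :: real assume s: "s \<in> {0..1}"
        have sh: "\<bar>s - 1/2\<bar> \<le> 1/2" using s unfolding abs_le_iff by auto
        have \<phi>0: "\<phi> s \<ge> 0" unfolding \<phi>_def by simp
        have near: "k / 2 * F (d/2) ^ m \<le> w s * \<phi> s ^ m" if "s \<in> J"
        proof -
          have "\<bar>s - 1/2\<bar> \<le> d / 2" using that unfolding J_def abs_le_iff by auto
          then have "F (d/2) \<le> \<phi> s" unfolding \<phi>F using d by (intro Fmono) auto
          moreover have "k / 2 \<le> w s" using \<open>\<bar>s - 1/2\<bar> \<le> d / 2\<close> d by (intro wk) auto
          moreover have "F (d/2) \<ge> 0" using Fs F0 by simp
          moreover have "k \<ge> 0" using w(2) by (simp add: k_def)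
          ultimately show ?thesis by (intro mult_mono power_mono) auto
        qed
        have mid: "0 \<le> w s * \<phi> s ^ m" if "\<bar>s - 1/2\<bar> \<le> d"
          using wk[OF that] w(2) \<phi>0 by (simp add: k_def)
        have farr: "- (B * F d ^ m) \<le> w s * \<phi> s ^ m" if "\<bar>s - 1/2\<bar> > d"
        proof -
          have "\<phi> s \<le> F d" unfolding \<phi>F using that d sh by (intro Fmono) auto
          then have "\<bar>w s\<bar> * \<phi> s ^ m \<le> B * F d ^ m"
            using B[OF s] \<phi>0 B0 by (intro mult_mono power_mono) auto
          then have "\<bar>w s * \<phi> s ^ m\<bar> \<le> B * F d ^ m" using \<phi>0 by (simp add: abs_mult)
          then show ?thesis by linarith
        qed
        have B1: "0 \<le> B * F d ^ m" using B0 F0 by simp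
        show "(if s \<in> J then k / 2 * F (d/2) ^ m else 0) - B * F d ^ m \<le> w s * \<phi> s ^ m"
        proof (cases "s \<in> J")
          case True
          then show ?thesis using near B1 by simp
        next
          case False
          then show ?thesis using mid farr B1 by (cases "\<bar>s - 1/2\<bar> \<le> d") simp_all
        qed
      qed
      then show ?thesis using w(3)[of m] by simp
    qed
    define r where "r = F (d/2) / F d"
    have "r > 1" using Fs F0 by (simp add: r_def)
    then obtain m where m: "r ^ m > B / (k / 2 * d)" using real_arch_pow by blast
    have kd: "k / 2 * d > 0" using w(2) d by (simp add: k_def)
    have "F (d/2) = r * F d" using F0 by (simp add: r_def)
    then have "(r ^ m * (k / 2 * d)) * F d ^ m \<le> B * F d ^ m"
      using key[of m] by (simp add: power_mult_distrib mult_ac)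
    then have "r ^ m * (k / 2 * d) \<le> B" using F0 by (simp only: mult_le_cancel_right_pos zero_less_power)
    moreover have "B < r ^ m * (k / 2 * d)" using m kd by (simp only: pos_divide_less_eq)
    ultimately show False by linarith
  qed
  have cvU: "continuous_on UNIV v" using cv[of UNIV "\<lambda>s. s"] by simp
  have "\<not> v (1/2) > 0" using no[OF cvU _ K0] by blast
  moreover have "\<not> - v (1/2) > 0"
  proof
    assume "- v (1/2) > 0"
    moreover have "integral {0..1} (\<lambda>s. - v s * \<phi> s ^ m) = 0" for m using K0[of m] by simp
    ultimately show False by (intro no[OF continuous_on_minus[OF cvU]])
  qed
  ultimately show ?thesis by (simp add: v_def)
qed

definition hartley :: "int ^ 3 \<Rightarrow> real ^ 3 \<Rightarrow> real" where
  "hartley k t = (\<Prod>i\<in>UNIV. cas (of_int (k $ i) * t $ i))"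

lemma continuous_hartley [continuous_intros]:
  fixes f :: "'a::t2_space \<Rightarrow> real ^ 3"
  shows "continuous_on S f \<Longrightarrow> continuous_on S (\<lambda>x. hartley k (f x))"
  unfolding hartley_def
  by (intro continuous_on_prod continuous_cas continuous_on_mult continuous_on_const continuous_on_component)

lemma abs_hartley_le: "\<bar>hartley k t\<bar> \<le> 8"
proof -
  have "\<bar>hartley k t\<bar> = (\<Prod>i\<in>UNIV. \<bar>cas (of_int (k $ i) * t $ i)\<bar>)" by (simp add: hartley_def abs_prod)
  also have "\<dots> \<le> (\<Prod>i\<in>(UNIV::3 set). 2)" by (intro prod_mono) (auto simp: abs_cas_le)
  finally show ?thesis by simp
qed

lemma prod_UNIV_3: "(\<Prod>i\<in>UNIV. f i) = f 1 * (f 2 * f 3)" for f :: "3 \<Rightarrow> 'a::comm_monoid_mult"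
  unfolding UNIV_3 by (simp add: ac_simps)

lemma mean_prod:
  "mean (\<lambda>t. \<Prod>i\<in>UNIV. g i (t $ i)) = (\<Prod>i\<in>UNIV. integral {0..1} (g i))"
proof -
  have "mean (\<lambda>t. \<Prod>i\<in>UNIV. g i (t $ i)) =
      integral {0..1} (\<lambda>x. integral {0..1} (\<lambda>y. integral {0..1} (\<lambda>z. g 1 x * (g 2 y * g 3 z))))"
    unfolding mean_def avg_def prod_UNIV_3 by (simp add: axis_def)
  also have "\<dots> = integral {0..1} (g 1) * (integral {0..1} (g 2) * integral {0..1} (g 3))"
    by (simp only: integral_mult_right integral_mult_left)
  finally show ?thesis by (simp only: prod_UNIV_3)
qed

lemma mean_hartley_hartley: "mean (\<lambda>t. hartley k t * hartley l t) = (if k = l then 1 else 0)"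
proof -
  have "mean (\<lambda>t. hartley k t * hartley l t) =
      mean (\<lambda>t. \<Prod>i\<in>UNIV. (\<lambda>s. cas (of_int (k $ i) * s) * cas (of_int (l $ i) * s)) (t $ i))"
    by (simp add: hartley_def prod.distrib)
  also have "\<dots> = (\<Prod>i\<in>UNIV. if k $ i = l $ i then 1 else 0)"
    by (subst mean_prod) (simp add: integral_cas_cas)
  also have "\<dots> = (if k = l then 1 else 0)"
  proof (cases "k = l")
    case False
    then obtain i where "k $ i \<noteq> l $ i" by (auto simp: vec_eq_iff)
    then have "(\<Prod>i\<in>UNIV. if k $ i = l $ i then 1 else 0 :: real) = 0"
      by (intro prod_zero) (auto intro!: bexI[of _ i])
    then show ?thesis using False by simp
  qed simp
  finally show ?thesis .
qed

text \<open>The one-dimensional statement is applied to one coordinate after another: first to the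
  function of \<open>x\<close> obtained by integrating the other two coordinates against basis functions, then to
  that of \<open>y\<close> with only \<open>z\<close> integrated, then to that of \<open>z\<close>.\<close>
lemma Fourier_uniqueness:
  assumes c: "continuous_on UNIV g" and per: "periodic3 g"
    and orth: "\<And>k. mean (\<lambda>t. g t * hartley k t) = 0"
  shows "g t = 0"
proof -
  define G where "G = (\<lambda>x y z. g (x *\<^sub>R axis 1 1 + y *\<^sub>R axis 2 1 + z *\<^sub>R axis 3 1))"
  define G2 where "G2 = (\<lambda>c x y. integral {0..1} (\<lambda>z. G x y z * cas (of_int c * z)))"
  define G1 where "G1 = (\<lambda>b c x. integral {0..1} (\<lambda>y. G2 c x y * cas (of_int b * y)))"
  have cG: "continuous_on UNIV (\<lambda>w. G (f1 w) (f2 w) (f3 w))"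
    if "continuous_on UNIV f1" "continuous_on UNIV f2" "continuous_on UNIV f3"
    for f1 f2 f3 :: "'x::topological_space \<Rightarrow> real"
    unfolding G_def
    by (rule continuous_on_compose2[OF c _ subset_UNIV])
       (intro continuous_on_add continuous_on_scaleR continuous_on_const that)
  have cG2': "continuous_on UNIV (\<lambda>w. G2 k (fst w) (snd w))" for k
  proof -
    have "continuous_on UNIV (\<lambda>w. integral (cbox 0 1) (\<lambda>z. G (fst w) (snd w) z * cas (of_int k * z)))"
      by (intro integral_continuous_on_param)
         (auto simp: split_beta intro!: continuous_intros continuous_on_subset[OF cG])
    then show ?thesis by (simp add: G2_def cbox_interval)
  qed
  have cG2: "continuous_on S (\<lambda>w. G2 k (f1 w) (f2 w))"
    if "continuous_on S f1" "continuous_on S f2" for f1 f2 :: "'x::topological_space \<Rightarrow> real" and k S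
    using continuous_on_compose2[OF cG2' continuous_on_Pair[OF that]] by simp
  have cG1: "continuous_on UNIV (G1 b k)" for b k
  proof -
    have "continuous_on UNIV (\<lambda>w. integral (cbox 0 1) (\<lambda>y. G2 k w y * cas (of_int b * y)))"
      by (intro integral_continuous_on_param)
         (auto simp: split_beta intro!: continuous_intros cG2)
    then show ?thesis by (simp add: G1_def cbox_interval)
  qed
  have p1: "G (x + 1) y z = G x y z" and p2: "G x (y + 1) z = G x y z" and p3: "G x y (z + 1) = G x y z" for x y z
  proof -
    have per': "g (t + axis i 1) = g t" for i t using per by (simp add: periodic3_def)
    show "G (x + 1) y z = G x y z"
      using per'[of "x *\<^sub>R axis 1 1 + y *\<^sub>R axis 2 1 + z *\<^sub>R axis 3 1" 1] by (simp add: G_def algebra_simps)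
    show "G x (y + 1) z = G x y z"
      using per'[of "x *\<^sub>R axis 1 1 + y *\<^sub>R axis 2 1 + z *\<^sub>R axis 3 1" 2] by (simp add: G_def algebra_simps)
    show "G x y (z + 1) = G x y z"
      using per'[of "x *\<^sub>R axis 1 1 + y *\<^sub>R axis 2 1 + z *\<^sub>R axis 3 1" 3] by (simp add: G_def algebra_simps)
  qed
  have "G1 b k x = 0" for b k x
  proof (rule Fourier_uniqueness_1d[where u = "G1 b k"])
    fix j :: int
    have "mean (\<lambda>t. g t * hartley (vector [j, b, k]) t) =
        integral {0..1} (\<lambda>x. integral {0..1} (\<lambda>y. integral {0..1} (\<lambda>z.
          (cas (of_int j * x) * cas (of_int b * y)) * (G x y z * cas (of_int k * z)))))"
      by (simp add: mean_def avg_def hartley_def prod_UNIV_3 axis_def G_def mult_ac)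
    also have "\<dots> = integral {0..1} (\<lambda>x. integral {0..1} (\<lambda>y.
          cas (of_int j * x) * (cas (of_int b * y) * G2 k x y)))"
      by (simp only: integral_mult_right G2_def mult.assoc)
    also have "\<dots> = integral {0..1} (\<lambda>s. cas (of_int j * s) * integral {0..1} (\<lambda>y. cas (of_int b * y) * G2 k s y))"
      by (simp only: integral_mult_right)
    also have "\<dots> = integral {0..1} (\<lambda>s. G1 b k s * cas (of_int j * s))"
      unfolding G1_def by (simp only: mult.commute)
    finally have "mean (\<lambda>t. g t * hartley (vector [j, b, k]) t) = integral {0..1} (\<lambda>s. G1 b k s * cas (of_int j * s))" .
    then show "integral {0..1} (\<lambda>s. G1 b k s * cas (of_int j * s)) = 0" by (simp add: orth)
  next
    show "continuous_on UNIV (G1 b k)" by (rule cG1)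
    show "G1 b k (x + 1) = G1 b k x" for x by (simp add: G1_def G2_def p1)
  qed
  then have z1: "integral {0..1} (\<lambda>y. G2 k x y * cas (of_int b * y)) = 0" for b k x
    by (simp add: G1_def)
  have p2': "G2 k x (y + 1) = G2 k x y" for k x y by (simp add: G2_def p2)
  have z2: "G2 k x y = 0" for k x y
    by (intro Fourier_uniqueness_1d[where u = "G2 k x"] cG2 continuous_on_const continuous_on_id z1 p2')
  have "G x y z = 0" for x y z
    by (intro Fourier_uniqueness_1d[where u = "G x y"] cG continuous_on_const continuous_on_id p3
        z2[unfolded G2_def])
  then have "G (t $ 1) (t $ 2) (t $ 3) = 0" .
  moreover have "t $ 1 *\<^sub>R axis 1 1 + t $ 2 *\<^sub>R axis 2 1 + t $ 3 *\<^sub>R axis 3 1 = t"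
    by (simp add: vec_eq_iff forall_3 axis_def)
  ultimately show ?thesis by (simp add: G_def)
qed

section \<open>Smooth functions\<close>

lemma pdiff_eq: "(f has_derivative D) (at x) \<Longrightarrow> pdiff v f x = D v"
  unfolding pdiff_def by (metis frechet_derivative_at)

lemma Ck_Suc_imp: "Ck (Suc k) f \<Longrightarrow> Ck k f"
proof (induction k arbitrary: f)
  case 0
  then show ?case
    by (auto intro!: continuous_at_imp_continuous_on differentiable_imp_continuous_within)
next
  case (Suc k)
  then show ?case by (metis Ck.simps(2))
qed

lemma smooth_differentiable: "smooth f \<Longrightarrow> f differentiable (at x)"
  unfolding smooth_def by (metis Ck.simps(2))

lemma smooth_has_derivative: "smooth f \<Longrightarrow> (f has_derivative (\<lambda>v. pdiff v f x)) (at x)"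
  unfolding pdiff_def using smooth_differentiable[of f x] frechet_derivative_works by blast

lemma smooth_continuous: "smooth f \<Longrightarrow> continuous_on S f"
  unfolding smooth_def by (metis Ck.simps(1) continuous_on_subset subset_UNIV)

lemma smooth_pdiff: "smooth f \<Longrightarrow> smooth (pdiff v f)"
  unfolding smooth_def by (metis Ck.simps(2))

lemma Ck_differentiable: "Ck (Suc k) f \<Longrightarrow> (f has_derivative (\<lambda>v. pdiff v f x)) (at x)"
  unfolding pdiff_def using frechet_derivative_works by force

lemma Ck_SucI:
  assumes "\<And>x. (f has_derivative D x) (at x)" "\<And>v. Ck k (\<lambda>x. D x v)"
  shows "Ck (Suc k) f"
proof -
  have "pdiff v f = (\<lambda>x. D x v)" for v using pdiff_eq[OF assms(1)] by auto
  then show ?thesis using assms by (auto simp: differentiable_def)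
qed

lemma Ck_pdiff: "Ck (Suc k) f \<Longrightarrow> Ck k (pdiff v f)"
  by simp

lemma Ck_const: "Ck k (\<lambda>x. c)"
proof (induction k arbitrary: c)
  case (Suc k)
  show ?case by (rule Ck_SucI[OF has_derivative_const Suc])
qed simp

lemma Ck_add: "Ck k f \<Longrightarrow> Ck k g \<Longrightarrow> Ck k (\<lambda>x. f x + g x)"
proof (induction k arbitrary: f g)
  case 0
  then show ?case by (auto intro: continuous_on_add)
next
  case (Suc k)
  show ?case
    by (rule Ck_SucI[OF has_derivative_add[OF Suc.prems[THEN Ck_differentiable]]])
       (intro Suc.IH Suc.prems[THEN Ck_pdiff])
qed

lemma Ck_mult:
  fixes f g :: "'a::euclidean_space \<Rightarrow> real"
  shows "Ck k f \<Longrightarrow> Ck k g \<Longrightarrow> Ck k (\<lambda>x. f x * g x)"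
proof (induction k arbitrary: f g)
  case 0
  then show ?case by (auto intro: continuous_on_mult)
next
  case (Suc k)
  show ?case
    by (rule Ck_SucI[OF has_derivative_mult[OF Suc.prems[THEN Ck_differentiable]]])
       (intro Ck_add Suc.IH Suc.prems[THEN Ck_pdiff] Suc.prems[THEN Ck_Suc_imp])
qed

lemma Ck_linear_compose:
  assumes L: "bounded_linear L"
  shows "Ck k f \<Longrightarrow> Ck k (\<lambda>x. L (f x))"
proof (induction k arbitrary: f)
  case 0
  then show ?case using bounded_linear.continuous_on[OF L] by auto
next
  case (Suc k)
  show ?case
    by (rule Ck_SucI[OF bounded_linear.has_derivative[OF L Ck_differentiable[OF Suc.prems]]])
       (intro Suc.IH Ck_pdiff[OF Suc.prems])
qed

lemma has_derivative_pdiff_Basis_sum: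
  fixes F :: "'b::euclidean_space \<Rightarrow> real"
  assumes "(F has_derivative (\<lambda>v. pdiff v F z)) (at z)"
  shows "pdiff w F z = (\<Sum>b\<in>Basis. (w \<bullet> b) * pdiff b F z)"
proof -
  note lin = has_derivative_linear[OF assms]
  have "pdiff (\<Sum>b\<in>Basis. (w \<bullet> b) *\<^sub>R b) F z = (\<Sum>b\<in>Basis. (w \<bullet> b) * pdiff b F z)"
    by (simp add: linear_sum[OF lin] linear_scale[OF lin])
  then show ?thesis by (simp only: euclidean_representation)
qed

lemma has_derivative_compose_Basis:
  fixes F :: "'b::euclidean_space \<Rightarrow> real"
  assumes F: "(F has_derivative (\<lambda>v. pdiff v F (Y x))) (at (Y x))"
    and Y: "(Y has_derivative (\<lambda>v. pdiff v Y x)) (at x)"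
  shows "((\<lambda>x. F (Y x)) has_derivative (\<lambda>v. \<Sum>b\<in>Basis. (pdiff v Y x \<bullet> b) * pdiff b F (Y x))) (at x)"
proof -
  have "((\<lambda>x. F (Y x)) has_derivative (\<lambda>v. pdiff (pdiff v Y x) F (Y x))) (at x)"
    using has_derivative_compose[OF Y F] .
  moreover have "(\<lambda>v. pdiff (pdiff v Y x) F (Y x)) = (\<lambda>v. \<Sum>b\<in>Basis. (pdiff v Y x \<bullet> b) * pdiff b F (Y x))"
    by (rule ext) (rule has_derivative_pdiff_Basis_sum[OF F])
  ultimately show ?thesis by (simp only:)
qed

lemma Ck_sum: "(\<And>i. i \<in> I \<Longrightarrow> Ck k (f i)) \<Longrightarrow> Ck k (\<lambda>x. \<Sum>i\<in>I. f i x)"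
  by (induction I rule: infinite_finite_induct) (auto intro: Ck_const Ck_add)

text \<open>In the chain rule the derivative of the composition is written with respect to the standard
  basis, so that only products of scalar functions occur in the induction.\<close>
lemma Ck_compose:
  fixes F :: "'b::euclidean_space \<Rightarrow> real"
  shows "Ck k F \<Longrightarrow> Ck k Y \<Longrightarrow> Ck k (\<lambda>x. F (Y x))"
proof (induction k arbitrary: F Y)
  case 0
  then show ?case by (auto intro: continuous_on_compose2)
next
  case (Suc k)
  show ?case
    by (rule Ck_SucI[OF has_derivative_compose_Basis[OF Ck_differentiable[OF Suc.prems(1)] Ck_differentiable[OF Suc.prems(2)]]])
       (rule Ck_sum, rule Ck_mult, rule Ck_linear_compose[OF bounded_linear_inner_left],
         rule Ck_pdiff[OF Suc.prems(2)], rule Suc.IH[OF Ck_pdiff[OF Suc.prems(1)] Ck_Suc_imp[OF Suc.prems(2)]])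
qed

lemma smooth_const: "smooth (\<lambda>x. c)"
  by (simp add: smooth_def Ck_const)

lemma smooth_add: "smooth f \<Longrightarrow> smooth g \<Longrightarrow> smooth (\<lambda>x. f x + g x)"
  unfolding smooth_def using Ck_add[of _ f g] by simp

lemma smooth_mult:
  fixes f g :: "'a::euclidean_space \<Rightarrow> real"
  shows "smooth f \<Longrightarrow> smooth g \<Longrightarrow> smooth (\<lambda>x. f x * g x)"
  unfolding smooth_def using Ck_mult[of _ f g] by simp

lemma smooth_sum: "(\<And>i. i \<in> I \<Longrightarrow> smooth (f i)) \<Longrightarrow> smooth (\<lambda>x. \<Sum>i\<in>I. f i x)"
  unfolding smooth_def using Ck_sum[of I _ f] by simp

lemma smooth_linear_compose: "bounded_linear L \<Longrightarrow> smooth f \<Longrightarrow> smooth (\<lambda>x. L (f x))"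
  unfolding smooth_def using Ck_linear_compose[of L _ f] by simp

lemma smooth_compose:
  fixes F :: "'b::euclidean_space \<Rightarrow> real"
  shows "smooth F \<Longrightarrow> smooth Y \<Longrightarrow> smooth (\<lambda>x. F (Y x))"
  unfolding smooth_def using Ck_compose[of _ F Y] by simp

lemma smooth_linear: "bounded_linear L \<Longrightarrow> smooth L"
proof -
  assume L: "bounded_linear L"
  have h: "(L has_derivative L) (at x)" for x by (rule bounded_linear_imp_has_derivative[OF L])
  have "Ck k L" for k
  proof (cases k)
    case 0
    then show ?thesis using linear_continuous_on[OF L] by simp
  next
    case (Suc l)
    then show ?thesis using Ck_SucI[OF h Ck_const] by simp
  qed
  then show ?thesis by (simp add: smooth_def)
qed

lemma smooth_uminus: "smooth f \<Longrightarrow> smooth (\<lambda>x. - f x)"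
  by (rule smooth_linear_compose[of uminus]) (auto intro: bounded_linear_minus bounded_linear_ident)

lemma smooth_diff: "smooth f \<Longrightarrow> smooth g \<Longrightarrow> smooth (\<lambda>x. f x - g x)"
  using smooth_add[of f "\<lambda>x. - g x"] smooth_uminus[of g] by simp

lemma smooth_euclidean:
  assumes "\<And>b. b \<in> Basis \<Longrightarrow> smooth (\<lambda>x. f x \<bullet> b)"
  shows "smooth f"
proof -
  have "smooth (\<lambda>x. \<Sum>b\<in>Basis. (f x \<bullet> b) *\<^sub>R b)"
    by (rule smooth_sum, rule smooth_linear_compose[OF bounded_linear_scaleR_left assms])
  then show ?thesis by (simp add: euclidean_representation)
qed

lemma pdiff_const: "pdiff v (\<lambda>x. c) = (\<lambda>x. 0)"
  by (rule ext, rule pdiff_eq) simp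

lemma pdiff_add: "smooth f \<Longrightarrow> smooth g \<Longrightarrow> pdiff v (\<lambda>x. f x + g x) = (\<lambda>x. pdiff v f x + pdiff v g x)"
  by (rule ext, rule pdiff_eq[OF has_derivative_add[OF smooth_has_derivative smooth_has_derivative]])

lemma pdiff_mult:
  fixes f g :: "'a::euclidean_space \<Rightarrow> real"
  shows "smooth f \<Longrightarrow> smooth g \<Longrightarrow> pdiff v (\<lambda>x. f x * g x) = (\<lambda>x. f x * pdiff v g x + pdiff v f x * g x)"
  by (rule ext, rule pdiff_eq[OF has_derivative_mult[OF smooth_has_derivative smooth_has_derivative]])

lemma pdiff_sum: "(\<And>i. i \<in> I \<Longrightarrow> smooth (f i)) \<Longrightarrow> pdiff v (\<lambda>x. \<Sum>i\<in>I. f i x) = (\<lambda>x. \<Sum>i\<in>I. pdiff v (f i) x)"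
  by (rule ext, rule pdiff_eq[OF has_derivative_sum[OF smooth_has_derivative]])

lemma pdiff_linear_compose: "bounded_linear L \<Longrightarrow> smooth f \<Longrightarrow> pdiff v (\<lambda>x. L (f x)) = (\<lambda>x. L (pdiff v f x))"
  by (rule ext, rule pdiff_eq[OF bounded_linear.has_derivative[OF _ smooth_has_derivative]])

lemma pdiff_cmult:
  fixes f :: "'a::euclidean_space \<Rightarrow> real"
  shows "smooth f \<Longrightarrow> pdiff v (\<lambda>x. c * f x) = (\<lambda>x. c * pdiff v f x)"
  by (rule pdiff_linear_compose) (auto intro: bounded_linear_mult_right)

lemma pdiff_compose:
  fixes F :: "'b::euclidean_space \<Rightarrow> real"
  assumes "smooth F" "smooth Y"
  shows "pdiff v (\<lambda>x. F (Y x)) = (\<lambda>x. \<Sum>b\<in>Basis. pdiff v (\<lambda>x. Y x \<bullet> b) x * pdiff b F (Y x))"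
proof
  fix x
  have "pdiff v (\<lambda>x. Y x \<bullet> b) x = pdiff v Y x \<bullet> b" for b
    by (simp add: pdiff_linear_compose[OF bounded_linear_inner_left assms(2)])
  then show "pdiff v (\<lambda>x. F (Y x)) x = (\<Sum>b\<in>Basis. pdiff v (\<lambda>x. Y x \<bullet> b) x * pdiff b F (Y x))"
    using pdiff_eq[OF has_derivative_compose_Basis[OF smooth_has_derivative[OF assms(1)] smooth_has_derivative[OF assms(2)]]]
    by simp
qed

lemma pdiff_linear: "smooth f \<Longrightarrow> linear (\<lambda>v. pdiff v f x)"
  by (rule has_derivative_linear[OF smooth_has_derivative])

lemma pdiff_translate:
  assumes "smooth f" "\<And>x. f (x + a) = f x"
  shows "pdiff v f (x + a) = pdiff v f x"
proof -
  have "((\<lambda>x. f (x + a)) has_derivative (\<lambda>v. pdiff v f (x + a))) (at x)"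
    by (rule has_derivative_compose[of "\<lambda>x. x + a" "\<lambda>v. v" x UNIV f])
       (auto intro!: derivative_eq_intros smooth_has_derivative assms)
  moreover have "(\<lambda>x. f (x + a)) = f" using assms(2) by auto
  ultimately have "(f has_derivative (\<lambda>v. pdiff v f (x + a))) (at x)" by (simp only:)
  from pdiff_eq[OF this, of v] show ?thesis by (rule sym)
qed

abbreviation \<delta> :: "3 \<Rightarrow> (real ^ 3 \<Rightarrow> real) \<Rightarrow> real ^ 3 \<Rightarrow> real" where
  "\<delta> i \<equiv> pdiff (axis i 1)"

definition smooth_periodic :: "(real ^ 3 \<Rightarrow> real) \<Rightarrow> bool" where
  "smooth_periodic u \<longleftrightarrow> smooth u \<and> periodic3 u"

lemma smooth_periodicD:
  assumes "smooth_periodic u"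
  shows "smooth u" "periodic3 u" "continuous_on S u"
  using assms smooth_continuous by (auto simp: smooth_periodic_def)

lemma smooth_periodic_pdiff: "smooth_periodic u \<Longrightarrow> smooth_periodic (pdiff v u)"
  unfolding smooth_periodic_def periodic3_def by (auto intro: smooth_pdiff pdiff_translate)

lemma smooth_periodic_const: "smooth_periodic (\<lambda>t. c)"
  by (simp add: smooth_periodic_def periodic3_def smooth_const)

lemma smooth_periodic_add: "smooth_periodic f \<Longrightarrow> smooth_periodic g \<Longrightarrow> smooth_periodic (\<lambda>t. f t + g t)"
  by (simp add: smooth_periodic_def periodic3_def smooth_add)

lemma smooth_periodic_mult: "smooth_periodic f \<Longrightarrow> smooth_periodic g \<Longrightarrow> smooth_periodic (\<lambda>t. f t * g t)"
  by (simp add: smooth_periodic_def periodic3_def smooth_mult)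

lemma mean_by_parts:
  assumes u: "smooth_periodic u" and v: "smooth_periodic v"
  shows "mean (\<lambda>t. u t * \<delta> i v t) = - mean (\<lambda>t. \<delta> i u t * v t)"
proof -
  note uv = smooth_periodic_mult[OF u v] smooth_periodicD[OF smooth_periodic_mult[OF u v]]
  have "mean (\<delta> i (\<lambda>t. u t * v t)) = 0"
    by (intro mean_pdiff_eq_0 uv smooth_differentiable smooth_periodicD(3)[OF smooth_periodic_pdiff])
  also have "\<delta> i (\<lambda>t. u t * v t) = (\<lambda>t. u t * \<delta> i v t + \<delta> i u t * v t)"
    using u v by (simp add: pdiff_mult smooth_periodic_def)
  also have "mean (\<lambda>t. u t * \<delta> i v t + \<delta> i u t * v t) = mean (\<lambda>t. u t * \<delta> i v t) + mean (\<lambda>t. \<delta> i u t * v t)"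
    by (intro mean_add smooth_periodicD(3) smooth_periodic_mult smooth_periodic_pdiff u v)
  finally show ?thesis by simp
qed

section \<open>Trigonometric polynomials\<close>

text \<open>Differentiating a basis function in direction \<open>i\<close> changes the sign of the \<open>i\<close>-th component
  of its frequency.\<close>
definition flip :: "3 \<Rightarrow> int ^ 3 \<Rightarrow> int ^ 3" where
  "flip i k = (\<chi> j. if j = i then - k $ j else k $ j)"

lemma flip_flip [simp]: "flip i (flip i k) = k"
  by (simp add: flip_def vec_eq_iff)

lemma flip_nth: "flip i k $ j = (if j = i then - k $ j else k $ j)"
  by (simp add: flip_def)

lemma flip_eq_0_iff [simp]: "flip i k = 0 \<longleftrightarrow> k = 0"
  by (auto simp: vec_eq_iff flip_nth split: if_splits)

lemma has_derivative_cas: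
  "((\<lambda>x. cas (c * x)) has_field_derivative (2 * pi * c * cas (- c * x))) (at x)"
  unfolding cas_def by (auto intro!: derivative_eq_intros simp: algebra_simps)

lemma has_derivative_hartley:
  "(hartley k has_derivative (\<lambda>h. \<Sum>i\<in>UNIV. h $ i * (2 * pi * of_int (k $ i) * hartley (flip i k) t))) (at t)"
proof -
  have "((\<lambda>t. cas (of_int (k $ i) * t $ i)) has_derivative
      (\<lambda>h. h $ i * (2 * pi * of_int (k $ i) * cas (- of_int (k $ i) * t $ i)))) (at t)" for i
  proof -
    have "((\<lambda>t::real^3. t $ i) has_derivative (\<lambda>h. h $ i)) (at t)"
      by (intro bounded_linear_imp_has_derivative bounded_linear_vec_nth)
    from has_derivative_compose[OF this has_derivative_cas[of "of_int (k $ i)" "t $ i", unfolded has_field_derivative_def]]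
    show ?thesis by (simp add: mult_ac)
  qed
  then have "(hartley k has_derivative (\<lambda>h. \<Sum>i\<in>UNIV. h $ i * (2 * pi * of_int (k $ i) * cas (- of_int (k $ i) * t $ i)) *
      (\<Prod>j\<in>UNIV - {i}. cas (of_int (k $ j) * t $ j)))) (at t)"
    unfolding hartley_def by (intro has_derivative_prod)
  moreover have "cas (- of_int (k $ i) * t $ i) * (\<Prod>j\<in>UNIV - {i}. cas (of_int (k $ j) * t $ j)) = hartley (flip i k) t" for i
  proof -
    have "hartley (flip i k) t = cas (of_int (flip i k $ i) * t $ i) * (\<Prod>j\<in>UNIV - {i}. cas (of_int (flip i k $ j) * t $ j))"
      unfolding hartley_def by (rule prod.remove) auto
    also have "(\<Prod>j\<in>UNIV - {i}. cas (of_int (flip i k $ j) * t $ j)) = (\<Prod>j\<in>UNIV - {i}. cas (of_int (k $ j) * t $ j))"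
      by (intro prod.cong) (auto simp: flip_nth)
    finally show ?thesis by (simp add: flip_nth)
  qed
  ultimately show ?thesis by (simp add: mult.assoc)
qed

definition freq_box :: "nat \<Rightarrow> (int ^ 3) set" where
  "freq_box n = {k. \<forall>i. \<bar>k $ i\<bar> \<le> int n}"

lemma flip_in_freq_box [simp]: "flip i k \<in> freq_box n \<longleftrightarrow> k \<in> freq_box n"
  unfolding freq_box_def mem_Collect_eq flip_nth by (intro iff_allI) auto

lemma freq_box_eq: "freq_box n = vec_lambda ` (PiE UNIV (\<lambda>_. {- int n..int n}))"
proof (intro set_eqI iffI)
  fix k assume "k \<in> freq_box n"
  then have "k = vec_lambda (\<lambda>i. k $ i)" "(\<lambda>i. k $ i) \<in> PiE UNIV (\<lambda>_. {- int n..int n})"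
    by (auto simp: freq_box_def abs_le_iff minus_le_iff)
  then show "k \<in> vec_lambda ` (PiE UNIV (\<lambda>_. {- int n..int n}))" by blast
qed (auto simp: freq_box_def PiE_iff abs_le_iff minus_le_iff)

lemma finite_freq_box [simp, intro]: "finite (freq_box n)"
  unfolding freq_box_eq by (intro finite_imageI finite_PiE) auto

lemma sum_flip: "(\<Sum>k\<in>freq_box n. f (flip i k)) = (\<Sum>k\<in>freq_box n. f k)"
  by (rule sum.reindex_bij_witness[of _ "flip i" "flip i"]) auto

definition trig_poly :: "nat \<Rightarrow> (int ^ 3 \<Rightarrow> real) \<Rightarrow> real ^ 3 \<Rightarrow> real" where
  "trig_poly n c t = (\<Sum>k\<in>freq_box n. c k * hartley k t)"

text \<open>The coefficients of the \<open>i\<close>-th derivative of a trigonometric polynomial with coefficients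
  \<open>c\<close>; the sign is that of \<open>flip i k\<close>, whose derivative contributes to the frequency \<open>k\<close>.\<close>
definition dcoef :: "3 \<Rightarrow> (int ^ 3 \<Rightarrow> real) \<Rightarrow> int ^ 3 \<Rightarrow> real" where
  "dcoef i c k = - 2 * pi * of_int (k $ i) * c (flip i k)"

lemma has_derivative_trig_poly: "(trig_poly n c has_derivative (\<lambda>h. trig_poly n (\<lambda>k. \<Sum>i\<in>UNIV. h $ i * dcoef i c k) t)) (at t)"
proof -
  have "(trig_poly n c has_derivative (\<lambda>h. \<Sum>k\<in>freq_box n. c k * (\<Sum>i\<in>UNIV. h $ i * (2 * pi * of_int (k $ i) * hartley (flip i k) t)))) (at t)"
    unfolding trig_poly_def by (intro has_derivative_sum has_derivative_mult_right has_derivative_hartley)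
  moreover have "(\<Sum>k\<in>freq_box n. c k * (\<Sum>i\<in>UNIV. h $ i * (2 * pi * of_int (k $ i) * hartley (flip i k) t))) =
      trig_poly n (\<lambda>k. \<Sum>i\<in>UNIV. h $ i * dcoef i c k) t" for h :: "real ^ 3"
  proof -
    have "(\<Sum>k\<in>freq_box n. c k * (\<Sum>i\<in>UNIV. h $ i * (2 * pi * of_int (k $ i) * hartley (flip i k) t))) =
      (\<Sum>i\<in>UNIV. \<Sum>k\<in>freq_box n. c k * (h $ i * (2 * pi * of_int (k $ i) * hartley (flip i k) t)))"
      unfolding sum_distrib_left by (rule sum.swap)
    also have "\<dots> = (\<Sum>i\<in>UNIV. \<Sum>k\<in>freq_box n. h $ i * dcoef i c k * hartley k t)"
    proof (rule sum.cong[OF refl])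
      fix i :: 3
      show "(\<Sum>k\<in>freq_box n. c k * (h $ i * (2 * pi * of_int (k $ i) * hartley (flip i k) t))) =
          (\<Sum>k\<in>freq_box n. h $ i * dcoef i c k * hartley k t)"
        using sum_flip[of "\<lambda>k. h $ i * dcoef i c k * hartley k t" i n] by (simp add: dcoef_def flip_nth mult_ac)
    qed
    also have "\<dots> = (\<Sum>k\<in>freq_box n. \<Sum>i\<in>UNIV. h $ i * dcoef i c k * hartley k t)" by (rule sum.swap)
    finally show ?thesis by (simp add: trig_poly_def sum_distrib_right)
  qed
  ultimately show ?thesis by simp
qed

lemma pdiff_trig_poly: "\<delta> i (trig_poly n c) = trig_poly n (dcoef i c)"
proof
  fix t
  have "\<delta> i (trig_poly n c) t = trig_poly n (\<lambda>k. \<Sum>j\<in>UNIV. axis i 1 $ j * dcoef j c k) t"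
    by (rule pdiff_eq[OF has_derivative_trig_poly])
  also have "(\<lambda>k. \<Sum>j\<in>UNIV. axis i 1 $ j * dcoef j c k) = dcoef i c"
    by (rule ext) (simp add: axis_def if_distrib[of "\<lambda>x. x * _"] cong: if_cong)
  finally show "\<delta> i (trig_poly n c) t = trig_poly n (dcoef i c) t" .
qed

lemma smooth_trig_poly: "smooth (trig_poly n c)"
proof -
  have "Ck k (trig_poly n c)" for k
  proof (induction k arbitrary: c)
    case 0
    show ?case unfolding trig_poly_def by (auto intro!: continuous_intros)
  next
    case (Suc k)
    show ?case by (rule Ck_SucI[OF has_derivative_trig_poly]) (rule Suc)
  qed
  then show ?thesis by (simp add: smooth_def)
qed

lemma cas_periodic: "cas (of_int m * (x + 1)) = cas (of_int m * x)"
proof -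
  have "2 * pi * (of_int m * (x + 1)) = 2 * pi * (of_int m * x) + 2 * pi * of_int m"
    by (simp add: algebra_simps)
  then show ?thesis by (simp add: cas_def cos_add sin_add cos_int_2pin sin_int_2pin)
qed

lemma periodic3_hartley: "periodic3 (hartley k)"
  unfolding periodic3_def hartley_def
proof (intro allI prod.cong refl)
  fix i t j
  show "cas (of_int (k $ j) * (t + axis i 1) $ j) = cas (of_int (k $ j) * t $ j)"
    using cas_periodic[of "k $ j" "t $ j"] by (auto simp: axis_def)
qed

lemma smooth_periodic_trig_poly: "smooth_periodic (trig_poly n c)"
  unfolding smooth_periodic_def using smooth_trig_poly periodic3_hartley by (simp add: periodic3_def trig_poly_def)

lemma hartley_eq_trig_poly: "k \<in> freq_box n \<Longrightarrow> hartley k = trig_poly n (\<lambda>l. if l = k then 1 else 0)"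
  by (rule ext) (simp add: trig_poly_def if_distrib[of "\<lambda>x. x * _"] sum.delta cong: if_cong)

lemma ex_freq_box: "\<exists>n. k \<in> freq_box n"
proof
  show "k \<in> freq_box (nat (\<Sum>i\<in>UNIV. \<bar>k $ i\<bar>))"
    by (auto simp: freq_box_def intro: member_le_sum sum_nonneg)
qed

lemma smooth_periodic_hartley: "smooth_periodic (hartley k)"
  using hartley_eq_trig_poly ex_freq_box smooth_periodic_trig_poly by metis

lemma pdiff_hartley: "\<delta> i (hartley k) = (\<lambda>t. 2 * pi * of_int (k $ i) * hartley (flip i k) t)"
proof
  fix t
  have "\<delta> i (hartley k) t = (\<Sum>j\<in>UNIV. axis i 1 $ j * (2 * pi * of_int (k $ j) * hartley (flip j k) t))"
    by (rule pdiff_eq[OF has_derivative_hartley])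
  then show "\<delta> i (hartley k) t = 2 * pi * of_int (k $ i) * hartley (flip i k) t"
    by (simp add: axis_def if_distrib[of "\<lambda>x. x * _"] cong: if_cong)
qed

definition coef :: "(real ^ 3 \<Rightarrow> real) \<Rightarrow> int ^ 3 \<Rightarrow> real" where
  "coef G k = mean (\<lambda>t. G t * hartley k t)"

text \<open>The rule for trigonometric polynomials persists for all smooth functions, by integration by
  parts.\<close>
lemma coef_pdiff:
  assumes "smooth_periodic G"
  shows "coef (\<delta> i G) = dcoef i (coef G)"
proof
  fix k
  have "coef (\<delta> i G) k = - mean (\<lambda>t. G t * \<delta> i (hartley k) t)"
    unfolding coef_def using mean_by_parts[OF assms smooth_periodic_hartley[of k], of i] by simp
  also have "mean (\<lambda>t. G t * \<delta> i (hartley k) t) = 2 * pi * of_int (k $ i) * coef G (flip i k)"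
    unfolding pdiff_hartley coef_def mean_cmult[symmetric] by (simp add: mult_ac)
  finally show "coef (\<delta> i G) k = dcoef i (coef G) k" by (simp add: dcoef_def)
qed

lemma mean_trig_poly_mult:
  assumes "continuous_on UNIV G"
  shows "mean (\<lambda>t. G t * trig_poly n c t) = (\<Sum>k\<in>freq_box n. c k * coef G k)"
proof -
  have "mean (\<lambda>t. G t * trig_poly n c t) = mean (\<lambda>t. \<Sum>k\<in>freq_box n. c k * (G t * hartley k t))"
    by (simp add: trig_poly_def sum_distrib_left mult_ac)
  also have "\<dots> = (\<Sum>k\<in>freq_box n. mean (\<lambda>t. c k * (G t * hartley k t)))"
    by (intro mean_sum continuous_intros assms)
  finally show ?thesis by (simp add: mean_cmult coef_def)
qed

lemma coef_trig_poly: "coef (trig_poly n c) k = (if k \<in> freq_box n then c k else 0)"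
proof -
  have "continuous_on UNIV (hartley k)" using smooth_periodicD(3)[OF smooth_periodic_hartley] .
  then have "coef (trig_poly n c) k = (\<Sum>l\<in>freq_box n. c l * mean (\<lambda>t. hartley k t * hartley l t))"
    unfolding coef_def using mean_trig_poly_mult[of "hartley k" n c] by (simp add: mult.commute coef_def)
  then show ?thesis by (simp add: mean_hartley_hartley if_distrib[of "\<lambda>x. _ * x"] sum.delta cong: if_cong)
qed

lemma mean_trig_poly_sq: "mean (\<lambda>t. (trig_poly n c t)\<^sup>2) = (\<Sum>k\<in>freq_box n. (c k)\<^sup>2)"
proof -
  have "mean (\<lambda>t. trig_poly n c t * trig_poly n c t) = (\<Sum>k\<in>freq_box n. c k * coef (trig_poly n c) k)"
    by (intro mean_trig_poly_mult smooth_periodicD(3)[OF smooth_periodic_trig_poly])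
  then show ?thesis by (simp add: coef_trig_poly power2_eq_square)
qed

lemma Bessel:
  assumes "continuous_on UNIV G"
  shows "(\<Sum>k\<in>freq_box n. (coef G k)\<^sup>2) \<le> mean (\<lambda>t. (G t)\<^sup>2)"
proof -
  let ?S = "trig_poly n (coef G)"
  have c: "continuous_on UNIV ?S" by (intro smooth_periodicD(3)[OF smooth_periodic_trig_poly])
  have "0 \<le> mean (\<lambda>t. (G t - ?S t)\<^sup>2)"
    by (intro mean_nonneg continuous_intros assms c) auto
  also have "(\<lambda>t. (G t - ?S t)\<^sup>2) = (\<lambda>t. ((G t)\<^sup>2 - 2 * (G t * ?S t)) + (?S t)\<^sup>2)"
    by (auto simp: power2_eq_square algebra_simps)
  also have "mean \<dots> = (mean (\<lambda>t. (G t)\<^sup>2) - 2 * mean (\<lambda>t. G t * ?S t)) + mean (\<lambda>t. (?S t)\<^sup>2)"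
    by (subst mean_add, (intro continuous_intros assms c)+,
        subst mean_diff, (intro continuous_intros assms c)+, simp add: mean_cmult)
  also have "mean (\<lambda>t. G t * ?S t) = (\<Sum>k\<in>freq_box n. (coef G k)\<^sup>2)"
    by (simp add: mean_trig_poly_mult assms power2_eq_square)
  finally show ?thesis by (simp add: mean_trig_poly_sq)
qed

section \<open>The truncated Poisson equation\<close>

text \<open>The eigenvalue of \<open>-\<Delta>\<close> on the functions of frequency \<open>k\<close>.\<close>
definition mu :: "int ^ 3 \<Rightarrow> real" where
  "mu k = (2 * pi)\<^sup>2 * (\<Sum>i\<in>UNIV. (of_int (k $ i))\<^sup>2)"

text \<open>The solution \<open>u\<close> of mean zero of \<open>-\<Delta>u = G - mean G\<close>, with both sides truncated to the
  frequencies in \<open>freq_box n\<close>.\<close>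
definition poisson :: "nat \<Rightarrow> (real ^ 3 \<Rightarrow> real) \<Rightarrow> real ^ 3 \<Rightarrow> real" where
  "poisson n G = trig_poly n (\<lambda>k. if k = 0 then 0 else coef G k / mu k)"

lemma mu_flip [simp]: "mu (flip i k) = mu k"
  unfolding mu_def by (intro arg_cong[of _ _ "(*) _"] sum.cong) (auto simp: flip_nth)

lemma sum_sq_ge_1:
  assumes "k \<noteq> (0 :: int ^ 3)"
  shows "1 \<le> (\<Sum>i\<in>UNIV. (of_int (k $ i))\<^sup>2 :: real)"
proof -
  obtain i where "k $ i \<noteq> 0" using assms by (auto simp: vec_eq_iff)
  then have "1 \<le> (k $ i)\<^sup>2" using power2_eq_square[of "k $ i"]
    by (metis int_one_le_iff_zero_less zero_less_power2)
  then have "of_int 1 \<le> (of_int ((k $ i)\<^sup>2) :: real)" by (simp only: of_int_le_iff)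
  then have "1 \<le> (of_int (k $ i) :: real)\<^sup>2" by simp
  also have "(of_int (k $ i))\<^sup>2 \<le> (\<Sum>i\<in>UNIV. (of_int (k $ i))\<^sup>2 :: real)"
    by (intro member_le_sum) auto
  finally show ?thesis .
qed

lemma two_pi_bounds: "(2 * pi)\<^sup>2 \<ge> 2 * pi" "(2 * pi)\<^sup>2 \<ge> 2" "2 * pi \<ge> 1"
proof -
  show p: "2 * pi \<ge> 1" using pi_ge_two by linarith
  have "2 * pi * 1 \<le> 2 * pi * (2 * pi)" using p by (intro mult_left_mono) auto
  then show "(2 * pi)\<^sup>2 \<ge> 2 * pi" by (simp add: power2_eq_square)
  then show "(2 * pi)\<^sup>2 \<ge> 2" using pi_ge_two by linarith
qed

lemma mu_ge_1: "k \<noteq> 0 \<Longrightarrow> 1 \<le> mu k"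
  unfolding mu_def using sum_sq_ge_1[of k] two_pi_bounds(2)
    mult_mono[of 1 "(2 * pi)\<^sup>2" 1 "\<Sum>i\<in>UNIV. (of_int (k $ i))\<^sup>2"] by simp

lemma abs_freq_le_mu: "2 * pi * \<bar>of_int (k $ i)\<bar> \<le> mu k"
proof -
  have "\<bar>k $ i\<bar> \<le> \<bar>k $ i\<bar> * \<bar>k $ i\<bar>"
    using mult_left_mono[of 1 "\<bar>k $ i\<bar>" "\<bar>k $ i\<bar>"] by (cases "k $ i = 0") auto
  then have "of_int \<bar>k $ i\<bar> \<le> (of_int (\<bar>k $ i\<bar> * \<bar>k $ i\<bar>) :: real)" by (simp only: of_int_le_iff)
  then have "\<bar>of_int (k $ i)\<bar> \<le> ((of_int (k $ i))\<^sup>2 :: real)" by (simp add: power2_eq_square)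
  also have "\<dots> \<le> (\<Sum>i\<in>UNIV. (of_int (k $ i))\<^sup>2 :: real)" by (intro member_le_sum) auto
  finally show ?thesis unfolding mu_def using two_pi_bounds by (intro mult_mono sum_nonneg) auto
qed

lemma abs_freq_freq_le_mu: "(2 * pi * \<bar>of_int (k $ i)\<bar>) * (2 * pi * \<bar>of_int (k $ j)\<bar>) \<le> mu k"
proof -
  let ?S = "\<Sum>i\<in>UNIV. (of_int (k $ i))\<^sup>2 :: real"
  let ?a = "\<bar>of_int (k $ i)\<bar> :: real" and ?b = "\<bar>of_int (k $ j)\<bar> :: real"
  have "(of_int (k $ i))\<^sup>2 \<le> ?S" for i by (intro member_le_sum) auto
  then have "?a\<^sup>2 \<le> ?S" "?b\<^sup>2 \<le> ?S" by simp_all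
  moreover have "2 * (?a * ?b) \<le> ?a\<^sup>2 + ?b\<^sup>2"
    using sum_squares_bound[of ?a ?b] by (simp add: mult.assoc)
  ultimately have "?a * ?b \<le> ?S" by linarith
  then have "(2 * pi)\<^sup>2 * (?a * ?b) \<le> (2 * pi)\<^sup>2 * ?S" by (intro mult_left_mono) auto
  then show ?thesis by (simp add: mu_def power2_eq_square mult_ac)
qed

text \<open>Both operators act on single frequencies, and the flip preserves the eigenvalue.\<close>
lemma pdiff_poisson:
  assumes "smooth_periodic G"
  shows "\<delta> i (poisson n G) = poisson n (\<delta> i G)"
  unfolding poisson_def pdiff_trig_poly coef_pdiff[OF assms]
  by (intro arg_cong[of _ _ "trig_poly n"] ext) (simp add: dcoef_def)

lemma smooth_periodic_poisson: "smooth_periodic (poisson n G)"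
  unfolding poisson_def by (rule smooth_periodic_trig_poly)

lemma mean_trig_poly_le:
  assumes "continuous_on UNIV G" "\<And>k. \<bar>c k\<bar> \<le> \<bar>coef G (s k)\<bar>"
    and "\<And>f. (\<Sum>k\<in>freq_box n. f (s k)) = (\<Sum>k\<in>freq_box n. f k :: real)"
  shows "mean (\<lambda>t. (trig_poly n c t)\<^sup>2) \<le> mean (\<lambda>t. (G t)\<^sup>2)"
proof -
  have "mean (\<lambda>t. (trig_poly n c t)\<^sup>2) \<le> (\<Sum>k\<in>freq_box n. (coef G (s k))\<^sup>2)"
    unfolding mean_trig_poly_sq using assms(2) by (intro sum_mono) (simp add: abs_le_square_iff)
  also have "\<dots> = (\<Sum>k\<in>freq_box n. (coef G k)\<^sup>2)" by (rule assms(3))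
  also have "\<dots> \<le> mean (\<lambda>t. (G t)\<^sup>2)" by (rule Bessel[OF assms(1)])
  finally show ?thesis .
qed

text \<open>The gain of two derivatives in \<open>L\<^sup>2\<close>: on frequency \<open>k\<close>, two derivatives cost a factor of at
  most \<open>mu k\<close>, which the inverse Laplacian provides.\<close>
lemma poisson_bounds:
  assumes c: "continuous_on UNIV G"
  shows "mean (\<lambda>t. (poisson n G t)\<^sup>2) \<le> mean (\<lambda>t. (G t)\<^sup>2)"
    and "mean (\<lambda>t. (\<delta> i (poisson n G) t)\<^sup>2) \<le> mean (\<lambda>t. (G t)\<^sup>2)"
    and "mean (\<lambda>t. (\<delta> j (\<delta> i (poisson n G)) t)\<^sup>2) \<le> mean (\<lambda>t. (G t)\<^sup>2)"
proof -
  have small: "\<bar>a * (coef G l / mu k)\<bar> \<le> \<bar>coef G l\<bar>" if "\<bar>a\<bar> \<le> mu k" "k \<noteq> 0" for a k l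
  proof -
    have "\<bar>a\<bar> * \<bar>coef G l\<bar> \<le> mu k * \<bar>coef G l\<bar>" using that by (intro mult_right_mono) auto
    then show ?thesis using mu_ge_1[OF that(2)] by (simp add: abs_mult abs_divide field_simps)
  qed
  show "mean (\<lambda>t. (poisson n G t)\<^sup>2) \<le> mean (\<lambda>t. (G t)\<^sup>2)"
    unfolding poisson_def
  proof (rule mean_trig_poly_le[OF c, where s = "\<lambda>k. k"])
    fix k show "\<bar>if k = 0 then 0 else coef G k / mu k\<bar> \<le> \<bar>coef G k\<bar>"
      using small[of 1 k k] mu_ge_1[of k] by auto
  qed simp
  show "mean (\<lambda>t. (\<delta> i (poisson n G) t)\<^sup>2) \<le> mean (\<lambda>t. (G t)\<^sup>2)"
    unfolding poisson_def pdiff_trig_poly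
  proof (rule mean_trig_poly_le[OF c, where s = "flip i"])
    fix k show "\<bar>dcoef i (\<lambda>k. if k = 0 then 0 else coef G k / mu k) k\<bar> \<le> \<bar>coef G (flip i k)\<bar>"
      using small[of "- 2 * pi * of_int (k $ i)" k "flip i k"] abs_freq_le_mu[of k i]
      by (auto simp: dcoef_def abs_mult)
  qed (rule sum_flip)
  show "mean (\<lambda>t. (\<delta> j (\<delta> i (poisson n G)) t)\<^sup>2) \<le> mean (\<lambda>t. (G t)\<^sup>2)"
    unfolding poisson_def pdiff_trig_poly
  proof (rule mean_trig_poly_le[OF c, where s = "\<lambda>k. flip i (flip j k)"])
    fix k
    have e: "\<bar>of_int (flip j k $ i)\<bar> = (\<bar>of_int (k $ i)\<bar> :: real)" by (auto simp: flip_nth)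
    show "\<bar>dcoef j (dcoef i (\<lambda>k. if k = 0 then 0 else coef G k / mu k)) k\<bar> \<le> \<bar>coef G (flip i (flip j k))\<bar>"
      using small[of "(2 * pi * of_int (k $ j)) * (2 * pi * of_int (flip j k $ i))" k "flip i (flip j k)"]
        abs_freq_freq_le_mu[of k j i] e
      by (auto simp: dcoef_def abs_mult mult_ac)
  next
    fix f :: "int ^ 3 \<Rightarrow> real"
    show "(\<Sum>k\<in>freq_box n. f (flip i (flip j k))) = (\<Sum>k\<in>freq_box n. f k)"
      using sum_flip[of "\<lambda>k. f (flip i k)" j n] sum_flip[of f i n] by simp
  qed
qed

text \<open>This is where the dimension enters: \<open>\<Sum> \<bar>k\<bar>\<^sup>-\<^sup>4\<close> converges over the integer points of a space
  of dimension less than four. Each term is at most the product over the three coordinates of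
  \<open>(1 + ki\<^sup>2) powr (- 2/3)\<close>, since each of the three factors \<open>1 + ki\<^sup>2\<close> is at most \<open>1 + \<bar>k\<bar>\<^sup>2\<close> and
  \<open>3 * 2/3 = 2\<close>; and the one-dimensional sums converge as \<open>2 * 2/3 > 1\<close>.\<close>
lemma sum_inverse_mu_sq_bounded: "\<exists>C. \<forall>n. (\<Sum>k\<in>freq_box n - {0}. 1 / (mu k)\<^sup>2) \<le> C"
proof -
  define a :: "int \<Rightarrow> real" where "a = (\<lambda>j. (1 + (of_int j)\<^sup>2) powr (- (2/3)))"
  define b :: "nat \<Rightarrow> real" where "b = (\<lambda>j. a (int j))"
  have a0: "a j \<ge> 0" for j by (simp add: a_def)
  have "summable (\<lambda>j. of_nat j powr (- (4/3)) :: real)" by (simp add: summable_real_powr_iff)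
  moreover have "norm (b j) \<le> of_nat j powr (- (4/3))" if "j \<ge> 1" for j
  proof -
    have "b j \<le> ((real j)\<^sup>2) powr (- (2/3))"
      unfolding b_def a_def using that by (intro powr_mono2') auto
    also have "\<dots> = real j powr (- (4/3))"
      using powr_powr[of "real j" 2 "- (2/3)"] that by (simp add: powr_numeral)
    finally show ?thesis using a0 by (simp add: b_def)
  qed
  ultimately have sb: "summable b" by (rule summable_comparison_test'[where N = 1])
  define A where "A = 2 * suminf b"
  have An: "(\<Sum>j\<in>{- int n..int n}. a j) \<le> A" for n
  proof -
    have "{- int n..int n} \<subseteq> int ` {..n} \<union> (\<lambda>j. - int j) ` {..n}"
    proof
      fix j assume "j \<in> {- int n..int n}"
      then have "nat \<bar>j\<bar> \<in> {..n}" "j = int (nat \<bar>j\<bar>) \<or> j = - int (nat \<bar>j\<bar>)" by auto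
      then show "j \<in> int ` {..n} \<union> (\<lambda>j. - int j) ` {..n}" by blast
    qed
    then have "(\<Sum>j\<in>{- int n..int n}. a j) \<le> (\<Sum>j\<in>int ` {..n} \<union> (\<lambda>j. - int j) ` {..n}. a j)"
      by (intro sum_mono2) (auto simp: a0)
    also have "\<dots> \<le> (\<Sum>j\<in>int ` {..n}. a j) + (\<Sum>j\<in>(\<lambda>j. - int j) ` {..n}. a j)"
      by (subst sum.union_inter[symmetric]) (auto intro!: sum_nonneg a0)
    also have "\<dots> = (\<Sum>j\<le>n. b j) + (\<Sum>j\<le>n. b j)"
      by (subst (1 2) sum.reindex) (auto simp: inj_on_def b_def a_def)
    also have "\<dots> \<le> A"
      unfolding A_def using sum_le_suminf[OF sb, of "{..n}"] a0 by (auto simp: b_def)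
    finally show ?thesis .
  qed
  have A0: "0 \<le> A" using An[of 0] a0[of 0] by simp
  have "(\<Sum>k\<in>freq_box n - {0}. 1 / (mu k)\<^sup>2) \<le> A ^ 3" for n
  proof -
    have le: "1 / (mu k)\<^sup>2 \<le> (\<Prod>i\<in>UNIV. a (k $ i))" if "k \<noteq> 0" for k
    proof -
      let ?S = "\<Sum>i\<in>UNIV. (of_int (k $ i))\<^sup>2 :: real"
      have S1: "1 \<le> ?S" by (rule sum_sq_ge_1[OF that])
      have "1 + ?S \<le> 2 * ?S" using S1 by simp
      also have "\<dots> \<le> mu k" unfolding mu_def using two_pi_bounds S1 by (intro mult_right_mono) auto
      finally have m: "1 + ?S \<le> mu k" .
      have "1 / (mu k)\<^sup>2 \<le> 1 / (1 + ?S)\<^sup>2"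
        using m S1 by (intro divide_left_mono power_mono) auto
      also have "\<dots> = (1 + ?S) powr (- 2)" using S1 by (simp add: powr_minus powr_numeral divide_inverse)
      also have "\<dots> = ((1 + ?S) powr 3) powr (- (2/3))" by (simp add: powr_powr)
      also have "(1 + ?S) powr 3 = (1 + ?S) ^ 3" using S1 by (simp add: powr_numeral)
      also have "((1 + ?S) ^ 3) powr (- (2/3)) \<le> (\<Prod>i\<in>UNIV. 1 + (of_int (k $ i))\<^sup>2) powr (- (2/3))"
      proof (rule powr_mono2')
        have "(\<Prod>i\<in>UNIV. 1 + (of_int (k $ i))\<^sup>2) \<le> (\<Prod>i\<in>(UNIV::3 set). 1 + ?S)"
          by (intro prod_mono conjI add_left_mono member_le_sum) (auto intro: add_nonneg_nonneg)
        then show "(\<Prod>i\<in>UNIV. 1 + (of_int (k $ i))\<^sup>2) \<le> (1 + ?S) ^ 3" by simp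
        show "0 < (\<Prod>i\<in>UNIV. 1 + (of_int (k $ i))\<^sup>2 :: real)"
          by (intro prod_pos) (auto intro: add_pos_nonneg)
      qed simp
      also have "\<dots> = (\<Prod>i\<in>UNIV. a (k $ i))" by (simp add: prod_powr_distrib a_def)
      finally show ?thesis .
    qed
    have "(\<Sum>k\<in>freq_box n - {0}. 1 / (mu k)\<^sup>2) \<le> (\<Sum>k\<in>freq_box n - {0}. \<Prod>i\<in>UNIV. a (k $ i))"
      by (intro sum_mono le) auto
    also have "\<dots> \<le> (\<Sum>k\<in>freq_box n. \<Prod>i\<in>UNIV. a (k $ i))"
      by (intro sum_mono2) (auto intro!: prod_nonneg a0)
    also have "\<dots> = (\<Sum>g\<in>PiE UNIV (\<lambda>_::3. {- int n..int n}). \<Prod>i\<in>UNIV. a (g i))"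
      unfolding freq_box_eq by (subst sum.reindex) (auto simp: inj_on_def vec_lambda_inject)
    also have "\<dots> = (\<Prod>i\<in>(UNIV::3 set). \<Sum>j\<in>{- int n..int n}. a j)"
      by (rule prod_sum_PiE[symmetric]) auto
    also have "\<dots> \<le> (\<Prod>i\<in>(UNIV::3 set). A)"
      by (intro prod_mono conjI An sum_nonneg a0)
    finally show ?thesis by simp
  qed
  then show ?thesis by blast
qed

text \<open>Cauchy-Schwarz separates the coefficients of \<open>G\<close>, which Bessel's inequality bounds, from the
  factors \<open>1 / mu k\<close>.\<close>
lemma poisson_sup_bound:
  "\<exists>C. \<forall>n G t. continuous_on UNIV G \<longrightarrow> (poisson n G t)\<^sup>2 \<le> C * mean (\<lambda>t. (G t)\<^sup>2)"
proof -
  obtain C where C: "\<And>n. (\<Sum>k\<in>freq_box n - {0}. 1 / (mu k)\<^sup>2) \<le> C"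
    using sum_inverse_mu_sq_bounded by blast
  have "(poisson n G t)\<^sup>2 \<le> 64 * C * mean (\<lambda>t. (G t)\<^sup>2)" if G: "continuous_on UNIV G" for n G t
  proof -
    let ?K = "freq_box n - {0}"
    have "poisson n G t = (\<Sum>k\<in>?K. (coef G k / mu k) * hartley k t)"
      unfolding poisson_def trig_poly_def by (intro sum.mono_neutral_cong_right) auto
    also have "\<dots> = (\<Sum>k\<in>?K. (1 / mu k) * (coef G k * hartley k t))" by simp
    also have "\<dots>\<^sup>2 \<le> (\<Sum>k\<in>?K. (1 / mu k)\<^sup>2) * (\<Sum>k\<in>?K. (coef G k * hartley k t)\<^sup>2)"
      by (rule Cauchy_Schwarz_ineq_sum)
    also have "\<dots> \<le> C * (64 * mean (\<lambda>t. (G t)\<^sup>2))"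
    proof (rule mult_mono)
      show "(\<Sum>k\<in>?K. (1 / mu k)\<^sup>2) \<le> C" using C[of n] by (simp add: power_one_over)
      have "(\<Sum>k\<in>?K. (coef G k * hartley k t)\<^sup>2) \<le> (\<Sum>k\<in>?K. 64 * (coef G k)\<^sup>2)"
      proof (rule sum_mono)
        fix k
        have "(hartley k t)\<^sup>2 \<le> 8\<^sup>2" using power_mono[OF abs_hartley_le[of k t], of 2] by simp
        then have "(coef G k)\<^sup>2 * (hartley k t)\<^sup>2 \<le> (coef G k)\<^sup>2 * 64" by (intro mult_left_mono) auto
        then show "(coef G k * hartley k t)\<^sup>2 \<le> 64 * (coef G k)\<^sup>2" by (simp add: power_mult_distrib)
      qed
      also have "\<dots> \<le> (\<Sum>k\<in>freq_box n. 64 * (coef G k)\<^sup>2)" by (intro sum_mono2) auto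
      also have "\<dots> \<le> 64 * mean (\<lambda>t. (G t)\<^sup>2)"
        using Bessel[OF G, of n] by (simp add: sum_distrib_left[symmetric])
      finally show "(\<Sum>k\<in>?K. (coef G k * hartley k t)\<^sup>2) \<le> 64 * mean (\<lambda>t. (G t)\<^sup>2)" .
      show "0 \<le> C" using C[of 0] by (rule order_trans[rotated]) (auto intro: sum_nonneg)
    qed (auto intro: sum_nonneg)
    finally show ?thesis by simp
  qed
  then show ?thesis by blast
qed

lemma coef_laplace_poisson:
  assumes "k \<in> freq_box n" "k \<noteq> 0"
  shows "coef (\<lambda>t. - (\<Sum>i\<in>UNIV. \<delta> i (\<delta> i (poisson n G)) t)) k = coef G k"
proof -
  let ?c = "\<lambda>k. if k = 0 then 0 else coef G k / mu k"
  have "coef (\<delta> i (\<delta> i (poisson n G))) k = - ((2 * pi)\<^sup>2 * (of_int (k $ i))\<^sup>2 * (coef G k / mu k))" for i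
    using assms by (simp add: poisson_def pdiff_trig_poly coef_trig_poly dcoef_def flip_nth power2_eq_square)
  moreover have "coef (\<lambda>t. - (\<Sum>i\<in>UNIV. \<delta> i (\<delta> i (poisson n G)) t)) k =
      - (\<Sum>i\<in>UNIV. coef (\<delta> i (\<delta> i (poisson n G))) k)"
    unfolding coef_def
  proof -
    have "(\<lambda>t. - (\<Sum>i\<in>UNIV. \<delta> i (\<delta> i (poisson n G)) t) * hartley k t) =
        (\<lambda>t. - (\<Sum>i\<in>UNIV. \<delta> i (\<delta> i (poisson n G)) t * hartley k t))" by (simp add: sum_distrib_right)
    then show "mean (\<lambda>t. - (\<Sum>i\<in>UNIV. \<delta> i (\<delta> i (poisson n G)) t) * hartley k t) =
        - (\<Sum>i\<in>UNIV. mean (\<lambda>t. \<delta> i (\<delta> i (poisson n G)) t * hartley k t))"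
      using mean_sum[of UNIV "\<lambda>i t. \<delta> i (\<delta> i (poisson n G)) t * hartley k t"]
      by (simp add: mean_uminus smooth_periodicD(3)[OF smooth_periodic_mult[OF smooth_periodic_pdiff[OF smooth_periodic_pdiff[OF smooth_periodic_poisson]] smooth_periodic_hartley]])
  qed
  moreover have "(\<Sum>i\<in>UNIV. (2 * pi)\<^sup>2 * (of_int (k $ i))\<^sup>2 * q) = mu k * q" for q
    by (simp add: mu_def sum_distrib_left sum_distrib_right)
  ultimately have "coef (\<lambda>t. - (\<Sum>i\<in>UNIV. \<delta> i (\<delta> i (poisson n G)) t)) k = mu k * (coef G k / mu k)"
    by (simp only: sum_negf minus_minus)
  then show ?thesis using mu_ge_1[OF assms(2)] by simp
qed

section \<open>Sequences of smooth periodic functions with uniform bounds\<close>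

text \<open>All estimates have to be uniform along the sequence of truncated solutions. They are
  therefore formulated as properties of the whole sequence, and the constants never need names.\<close>
type_synonym fseq = "nat \<Rightarrow> real ^ 3 \<Rightarrow> real"

definition sup_bounded :: "(nat \<Rightarrow> 'a \<Rightarrow> real) \<Rightarrow> bool" where
  "sup_bounded u \<longleftrightarrow> (\<exists>C. \<forall>n t. \<bar>u n t\<bar> \<le> C)"

definition L2_bounded :: "fseq \<Rightarrow> bool" where
  "L2_bounded u \<longleftrightarrow> (\<exists>C. \<forall>n. mean (\<lambda>t. (u n t)\<^sup>2) \<le> C)"

definition periodic_seq :: "fseq \<Rightarrow> bool" where
  "periodic_seq u \<longleftrightarrow> (\<forall>n. smooth_periodic (u n))"

definition \<delta>s :: "3 \<Rightarrow> fseq \<Rightarrow> fseq" where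
  "\<delta>s i u = (\<lambda>n. \<delta> i (u n))"

lemma periodic_seq_continuous: "periodic_seq u \<Longrightarrow> continuous_on S (u n)"
  by (simp add: periodic_seq_def smooth_periodicD)

lemma periodic_seq_smooth: "periodic_seq u \<Longrightarrow> smooth (u n)"
  by (simp add: periodic_seq_def smooth_periodicD)

lemma periodic_seq_deriv_seq: "periodic_seq u \<Longrightarrow> periodic_seq (\<delta>s i u)"
  by (simp add: periodic_seq_def \<delta>s_def smooth_periodic_pdiff)

lemma periodic_seq_add: "periodic_seq u \<Longrightarrow> periodic_seq v \<Longrightarrow> periodic_seq (\<lambda>n t. u n t + v n t)"
  by (simp add: periodic_seq_def smooth_periodic_add)

lemma periodic_seq_mult: "periodic_seq u \<Longrightarrow> periodic_seq v \<Longrightarrow> periodic_seq (\<lambda>n t. u n t * v n t)"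
  by (simp add: periodic_seq_def smooth_periodic_mult)

lemma periodic_seq_const: "periodic_seq (\<lambda>n t. c n)"
  by (simp add: periodic_seq_def smooth_periodic_const)

lemma deriv_seq_add: "periodic_seq u \<Longrightarrow> periodic_seq v \<Longrightarrow> \<delta>s i (\<lambda>n t. u n t + v n t) = (\<lambda>n t. \<delta>s i u n t + \<delta>s i v n t)"
  unfolding \<delta>s_def by (rule ext) (rule pdiff_add; rule periodic_seq_smooth; assumption)

lemma deriv_seq_mult: "periodic_seq u \<Longrightarrow> periodic_seq v \<Longrightarrow> \<delta>s i (\<lambda>n t. u n t * v n t) = (\<lambda>n t. u n t * \<delta>s i v n t + \<delta>s i u n t * v n t)"
  unfolding \<delta>s_def by (rule ext) (rule pdiff_mult; rule periodic_seq_smooth; assumption)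

lemma sup_bounded_const: "(\<And>n. \<bar>c n\<bar> \<le> C) \<Longrightarrow> sup_bounded (\<lambda>n t. c n)"
  unfolding sup_bounded_def by blast

lemma sup_bounded_add: "sup_bounded u \<Longrightarrow> sup_bounded v \<Longrightarrow> sup_bounded (\<lambda>n t. u n t + v n t)"
  unfolding sup_bounded_def by (meson abs_triangle_ineq add_mono order_trans)

lemma sup_bounded_mult: "sup_bounded u \<Longrightarrow> sup_bounded v \<Longrightarrow> sup_bounded (\<lambda>n t. u n t * v n t)"
proof -
  assume "sup_bounded u" "sup_bounded v"
  then obtain C D where CD: "\<And>n t. \<bar>u n t\<bar> \<le> C" "\<And>n t. \<bar>v n t\<bar> \<le> D" by (auto simp: sup_bounded_def)
  have "\<bar>u n t * v n t\<bar> \<le> C * D" for n t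
    unfolding abs_mult using CD[of n t] by (intro mult_mono) (auto intro: order_trans[OF abs_ge_zero])
  then show ?thesis unfolding sup_bounded_def by blast
qed

lemma L2_bounded_const: "(\<And>n. \<bar>c n\<bar> \<le> C) \<Longrightarrow> L2_bounded (\<lambda>n t. c n)"
proof -
  assume c: "\<And>n. \<bar>c n\<bar> \<le> C"
  have "(c n)\<^sup>2 \<le> C\<^sup>2" for n using power_mono[OF c[of n], of 2] by simp
  then show ?thesis unfolding L2_bounded_def by (intro exI[of _ "C\<^sup>2"]) simp
qed

lemma L2_bounded_add:
  assumes "periodic_seq u" "periodic_seq v" "L2_bounded u" "L2_bounded v"
  shows "L2_bounded (\<lambda>n t. u n t + v n t)"
proof -
  obtain C D where CD: "\<And>n. mean (\<lambda>t. (u n t)\<^sup>2) \<le> C" "\<And>n. mean (\<lambda>t. (v n t)\<^sup>2) \<le> D"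
    using assms by (auto simp: L2_bounded_def)
  note c = periodic_seq_continuous[OF assms(1)] periodic_seq_continuous[OF assms(2)]
  have "mean (\<lambda>t. (u n t + v n t)\<^sup>2) \<le> 2 * C + 2 * D" for n
  proof -
    have "mean (\<lambda>t. (u n t + v n t)\<^sup>2) \<le> mean (\<lambda>t. 2 * (u n t)\<^sup>2 + 2 * (v n t)\<^sup>2)"
    proof (rule mean_mono)
      fix t
      show "(u n t + v n t)\<^sup>2 \<le> 2 * (u n t)\<^sup>2 + 2 * (v n t)\<^sup>2"
        using sum_squares_bound[of "u n t" "v n t"] by (simp add: power2_sum)
    qed (intro continuous_intros c)+
    also have "\<dots> = 2 * mean (\<lambda>t. (u n t)\<^sup>2) + 2 * mean (\<lambda>t. (v n t)\<^sup>2)"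
      by (subst mean_add) (auto simp: mean_cmult intro!: continuous_intros c)
    finally show ?thesis using CD[of n] by linarith
  qed
  then show ?thesis unfolding L2_bounded_def by blast
qed

lemma L2_bounded_mult_sup:
  assumes "periodic_seq u" "periodic_seq v" "sup_bounded u" "L2_bounded v"
  shows "L2_bounded (\<lambda>n t. u n t * v n t)"
proof -
  obtain C D where CD: "\<And>n t. \<bar>u n t\<bar> \<le> C" "\<And>n. mean (\<lambda>t. (v n t)\<^sup>2) \<le> D"
    using assms by (auto simp: L2_bounded_def sup_bounded_def)
  note c = periodic_seq_continuous[OF assms(1)] periodic_seq_continuous[OF assms(2)]
  have "mean (\<lambda>t. (u n t * v n t)\<^sup>2) \<le> C\<^sup>2 * D" for n
  proof -
    have "mean (\<lambda>t. (u n t * v n t)\<^sup>2) \<le> mean (\<lambda>t. C\<^sup>2 * (v n t)\<^sup>2)"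
    proof (rule mean_mono)
      fix t
      have "(u n t)\<^sup>2 \<le> C\<^sup>2" using power_mono[OF CD(1)[of n t], of 2] by simp
      then show "(u n t * v n t)\<^sup>2 \<le> C\<^sup>2 * (v n t)\<^sup>2" by (simp add: power_mult_distrib mult_right_mono)
    qed (intro continuous_intros c)+
    also have "\<dots> = C\<^sup>2 * mean (\<lambda>t. (v n t)\<^sup>2)" by (simp add: mean_cmult)
    also have "\<dots> \<le> C\<^sup>2 * D" using CD(2) by (intro mult_left_mono) auto
    finally show ?thesis .
  qed
  then show ?thesis unfolding L2_bounded_def by blast
qed

lemma sup_imp_L2_bounded:
  assumes "periodic_seq u" "sup_bounded u"
  shows "L2_bounded u"
proof -
  have "L2_bounded (\<lambda>n t. u n t * 1)"
    by (intro L2_bounded_mult_sup assms periodic_seq_const L2_bounded_const[of "\<lambda>_. 1" 1]) simp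
  then show ?thesis by simp
qed

lemma L2_bounded_mult_L4:
  assumes "periodic_seq u" "periodic_seq v" "L2_bounded (\<lambda>n t. (u n t)\<^sup>2)" "L2_bounded (\<lambda>n t. (v n t)\<^sup>2)"
  shows "L2_bounded (\<lambda>n t. u n t * v n t)"
proof -
  obtain C D where CD: "\<And>n. mean (\<lambda>t. ((u n t)\<^sup>2)\<^sup>2) \<le> C" "\<And>n. mean (\<lambda>t. ((v n t)\<^sup>2)\<^sup>2) \<le> D"
    using assms by (auto simp: L2_bounded_def)
  note c = periodic_seq_continuous[OF assms(1)] periodic_seq_continuous[OF assms(2)]
  have "mean (\<lambda>t. (u n t * v n t)\<^sup>2) \<le> 1 * C + 1 * D" for n
  proof -
    have "mean (\<lambda>t. (u n t * v n t)\<^sup>2) \<le> mean (\<lambda>t. 1 * ((u n t)\<^sup>2)\<^sup>2 + 1 * ((v n t)\<^sup>2)\<^sup>2)"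
    proof (rule mean_mono)
      fix t
      show "(u n t * v n t)\<^sup>2 \<le> 1 * ((u n t)\<^sup>2)\<^sup>2 + 1 * ((v n t)\<^sup>2)\<^sup>2"
      proof -
        have "2 * ((u n t)\<^sup>2 * (v n t)\<^sup>2) \<le> ((u n t)\<^sup>2)\<^sup>2 + ((v n t)\<^sup>2)\<^sup>2"
          using sum_squares_bound[of "(u n t)\<^sup>2" "(v n t)\<^sup>2"] by (simp only: mult.assoc)
        moreover have "0 \<le> (u n t)\<^sup>2 * (v n t)\<^sup>2" by simp
        ultimately show ?thesis unfolding power_mult_distrib by linarith
      qed
    qed (intro continuous_intros c)+
    also have "\<dots> = 1 * mean (\<lambda>t. ((u n t)\<^sup>2)\<^sup>2) + 1 * mean (\<lambda>t. ((v n t)\<^sup>2)\<^sup>2)"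
      by (subst mean_add) (auto intro!: continuous_intros c)
    finally show ?thesis using CD[of n] by linarith
  qed
  then show ?thesis unfolding L2_bounded_def by blast
qed

text \<open>Integration by parts turns \<open>\<integral> (\<partial>u)\<^sup>4\<close> into \<open>- 3 \<integral> u (\<partial>u)\<^sup>2 \<partial>\<^sup>2u\<close>, where \<open>u\<close> is bounded, and
  the factor \<open>(\<partial>u)\<^sup>2\<close> is absorbed into the left-hand side. This takes the place of a Sobolev
  embedding: it is what makes products of two first derivatives square integrable.\<close>
lemma mean_pdiff_power4_le:
  assumes u: "smooth_periodic u" and B: "\<And>t. \<bar>u t\<bar> \<le> B"
  shows "mean (\<lambda>t. ((\<delta> i u t)\<^sup>2)\<^sup>2) \<le> 9 * B\<^sup>2 * mean (\<lambda>t. (\<delta> i (\<delta> i u) t)\<^sup>2)"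
proof -
  let ?v = "\<delta> i u" and ?w = "\<delta> i (\<delta> i u)"
  have v: "smooth_periodic ?v" and w: "smooth_periodic ?w" using u by (auto intro: smooth_periodic_pdiff)
  note c = smooth_periodicD(3)[OF u] smooth_periodicD(3)[OF v] smooth_periodicD(3)[OF w]
  note s = smooth_periodicD(1)[OF v]
  have d3: "\<delta> i (\<lambda>t. ?v t * (?v t * ?v t)) = (\<lambda>t. 3 * (?v t)\<^sup>2 * ?w t)"
    by (simp add: pdiff_mult s smooth_mult power2_eq_square) (simp add: algebra_simps)
  have "mean (\<lambda>t. ((?v t)\<^sup>2)\<^sup>2) = mean (\<lambda>t. ?v t * (?v t * (?v t * ?v t)))"
    by (simp add: power2_eq_square mult.assoc)
  also have "\<dots> = - mean (\<lambda>t. u t * \<delta> i (\<lambda>t. ?v t * (?v t * ?v t)) t)"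
    using mean_by_parts[OF u smooth_periodic_mult[OF v smooth_periodic_mult[OF v v]], of i] by simp
  also have "\<dots> = mean (\<lambda>t. - (u t * (3 * (?v t)\<^sup>2 * ?w t)))" unfolding d3 by (simp add: mean_uminus)
  also have "\<dots> \<le> mean (\<lambda>t. 1/2 * ((?v t)\<^sup>2)\<^sup>2 + 9/2 * B\<^sup>2 * (?w t)\<^sup>2)"
  proof (rule mean_mono)
    fix t
    have "- (u t * (3 * (?v t)\<^sup>2 * ?w t)) = (?v t)\<^sup>2 * (- 3 * u t * ?w t)" by simp
    also have "\<dots> \<le> 1/2 * ((?v t)\<^sup>2)\<^sup>2 + 1/2 * (- 3 * u t * ?w t)\<^sup>2"
      using sum_squares_bound[of "(?v t)\<^sup>2" "- 3 * u t * ?w t"] by simp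
    also have "(- 3 * u t * ?w t)\<^sup>2 = 9 * ((u t)\<^sup>2 * (?w t)\<^sup>2)" by (simp add: power_mult_distrib)
    also have "(u t)\<^sup>2 * (?w t)\<^sup>2 \<le> B\<^sup>2 * (?w t)\<^sup>2"
      using power_mono[OF B[of t], of 2] by (intro mult_right_mono) auto
    finally show "- (u t * (3 * (?v t)\<^sup>2 * ?w t)) \<le> 1/2 * ((?v t)\<^sup>2)\<^sup>2 + 9/2 * B\<^sup>2 * (?w t)\<^sup>2" by simp
  qed (intro continuous_intros c)+
  also have "\<dots> = 1/2 * mean (\<lambda>t. ((?v t)\<^sup>2)\<^sup>2) + 9/2 * B\<^sup>2 * mean (\<lambda>t. (?w t)\<^sup>2)"
    unfolding mean_cmult[symmetric] by (rule mean_add) (intro continuous_intros c)+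
  finally show ?thesis by simp
qed

lemma L4_bounded_deriv_seq:
  assumes "periodic_seq u" "sup_bounded u" "L2_bounded (\<delta>s i (\<delta>s i u))"
  shows "L2_bounded (\<lambda>n t. (\<delta>s i u n t)\<^sup>2)"
proof -
  obtain B where B: "\<And>n t. \<bar>u n t\<bar> \<le> B" using assms(2) by (auto simp: sup_bounded_def)
  obtain C where C: "\<And>n. mean (\<lambda>t. (\<delta>s i (\<delta>s i u) n t)\<^sup>2) \<le> C" using assms(3) by (auto simp: L2_bounded_def)
  have "mean (\<lambda>t. ((\<delta>s i u n t)\<^sup>2)\<^sup>2) \<le> 9 * B\<^sup>2 * C" for n
  proof -
    have "mean (\<lambda>t. ((\<delta>s i u n t)\<^sup>2)\<^sup>2) \<le> 9 * B\<^sup>2 * mean (\<lambda>t. (\<delta>s i (\<delta>s i u) n t)\<^sup>2)"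
      unfolding \<delta>s_def using assms(1) by (intro mean_pdiff_power4_le B) (simp add: periodic_seq_def)
    also have "\<dots> \<le> 9 * B\<^sup>2 * C" using C by (intro mult_left_mono) auto
    finally show ?thesis .
  qed
  then show ?thesis unfolding L2_bounded_def by blast
qed

text \<open>For the sequences satisfying \<open>regular s\<close>, the derivatives of order at most \<open>s\<close> are bounded
  in the sup-norm and those of order at most \<open>s + 2\<close> in \<open>L\<^sup>2\<close>. This class is closed under products
  and, as long as the derivatives of the outer function stay bounded, under composition, and the
  inverse Laplacian improves it by two derivatives. A sup-bound has to be part of it since
  \<open>L\<^sup>2\<close>-bounds alone do not survive products.\<close>
definition regular0 :: "fseq \<Rightarrow> bool" where
  "regular0 u \<longleftrightarrow> periodic_seq u \<and> sup_bounded u \<and> (\<forall>i. L2_bounded (\<delta>s i u)) \<and> (\<forall>i j. L2_bounded (\<delta>s j (\<delta>s i u)))"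

primrec regular :: "nat \<Rightarrow> fseq \<Rightarrow> bool" where
  "regular 0 u \<longleftrightarrow> regular0 u"
| "regular (Suc s) u \<longleftrightarrow> regular0 u \<and> (\<forall>i. regular s (\<delta>s i u))"

lemma regular_0: "regular s u \<Longrightarrow> regular0 u"
  by (cases s) auto

lemma regular_periodic_seq: "regular s u \<Longrightarrow> periodic_seq u"
  using regular_0 by (auto simp: regular0_def)

lemma regular_Suc_imp: "regular (Suc s) u \<Longrightarrow> regular s u"
proof (induction s arbitrary: u)
  case (Suc s)
  then show ?case by (metis regular.simps(2))
qed simp

lemma regular0_const: "(\<And>n. \<bar>c n\<bar> \<le> C) \<Longrightarrow> regular0 (\<lambda>n t. c n)"
proof -
  assume "\<And>n. \<bar>c n\<bar> \<le> C"
  then have "sup_bounded (\<lambda>n (t :: real ^ 3). c n)" by (rule sup_bounded_const)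
  moreover have "L2_bounded (\<lambda>n t. 0)" using L2_bounded_const[of "\<lambda>_. 0" 0] by simp
  ultimately show ?thesis unfolding regular0_def \<delta>s_def pdiff_const by (simp add: periodic_seq_const)
qed

lemma regular_const: "(\<And>n. \<bar>c n\<bar> \<le> C) \<Longrightarrow> regular s (\<lambda>n t. c n)"
proof (induction s arbitrary: c C)
  case 0
  then show ?case using regular0_const[of c C] by simp
next
  case (Suc s)
  have "regular s (\<lambda>n t. 0)" using Suc.IH[of "\<lambda>_. 0" 0] by simp
  then show ?case using regular0_const[OF Suc.prems] by (simp add: \<delta>s_def pdiff_const)
qed

lemma regular0_add:
  assumes "regular0 u" "regular0 v"
  shows "regular0 (\<lambda>n t. u n t + v n t)"
proof -
  have u: "periodic_seq u" "sup_bounded u" "\<And>i. L2_bounded (\<delta>s i u)" "\<And>i j. L2_bounded (\<delta>s j (\<delta>s i u))"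
    and v: "periodic_seq v" "sup_bounded v" "\<And>i. L2_bounded (\<delta>s i v)" "\<And>i j. L2_bounded (\<delta>s j (\<delta>s i v))"
    using assms by (auto simp: regular0_def)
  show ?thesis
    unfolding regular0_def deriv_seq_add[OF u(1) v(1)] deriv_seq_add[OF periodic_seq_deriv_seq[OF u(1)] periodic_seq_deriv_seq[OF v(1)]]
    by (intro conjI allI periodic_seq_add sup_bounded_add L2_bounded_add periodic_seq_deriv_seq u v)
qed

lemma regular_add: "regular s u \<Longrightarrow> regular s v \<Longrightarrow> regular s (\<lambda>n t. u n t + v n t)"
proof (induction s arbitrary: u v)
  case 0
  then show ?case by (simp add: regular0_add)
next
  case (Suc s)
  have "\<delta>s i (\<lambda>n t. u n t + v n t) = (\<lambda>n t. \<delta>s i u n t + \<delta>s i v n t)" for i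
    using Suc.prems[THEN regular_periodic_seq] by (rule deriv_seq_add)
  moreover have "regular0 (\<lambda>n t. u n t + v n t)" using Suc.prems[THEN regular_0] by (rule regular0_add)
  moreover have "regular s (\<lambda>n t. \<delta>s i u n t + \<delta>s i v n t)" for i
    using Suc.prems by (intro Suc.IH) auto
  ultimately show ?case by simp
qed

text \<open>In the second derivatives of a product, every term has a bounded factor except the products
  of first derivatives, which the \<open>L\<^sup>4\<close>-bounds control.\<close>
lemma regular0_mult:
  assumes "regular0 u" "regular0 v"
  shows "regular0 (\<lambda>n t. u n t * v n t)"
proof -
  have u: "periodic_seq u" "sup_bounded u" "\<And>i. L2_bounded (\<delta>s i u)" "\<And>i j. L2_bounded (\<delta>s j (\<delta>s i u))"
    and v: "periodic_seq v" "sup_bounded v" "\<And>i. L2_bounded (\<delta>s i v)" "\<And>i j. L2_bounded (\<delta>s j (\<delta>s i v))"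
    using assms by (auto simp: regular0_def)
  note su = u(1) periodic_seq_deriv_seq[OF u(1)] periodic_seq_deriv_seq[OF periodic_seq_deriv_seq[OF u(1)]]
  note sv = v(1) periodic_seq_deriv_seq[OF v(1)] periodic_seq_deriv_seq[OF periodic_seq_deriv_seq[OF v(1)]]
  have 1: "L2_bounded (\<lambda>n t. a n t * b n t)" "L2_bounded (\<lambda>n t. b n t * a n t)"
    if "periodic_seq a" "periodic_seq b" "sup_bounded a" "L2_bounded b" for a b
    using L2_bounded_mult_sup[OF that] by (simp_all add: mult.commute)
  have 4: "L2_bounded (\<lambda>n t. (\<delta>s i u n t)\<^sup>2)" "L2_bounded (\<lambda>n t. (\<delta>s i v n t)\<^sup>2)" for i
    using u v by (auto intro: L4_bounded_deriv_seq)
  have d1: "\<delta>s i (\<lambda>n t. u n t * v n t) = (\<lambda>n t. u n t * \<delta>s i v n t + \<delta>s i u n t * v n t)" for i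
    by (rule deriv_seq_mult[OF u(1) v(1)])
  have d2: "\<delta>s j (\<delta>s i (\<lambda>n t. u n t * v n t)) = (\<lambda>n t. (u n t * \<delta>s j (\<delta>s i v) n t + \<delta>s j u n t * \<delta>s i v n t)
      + (\<delta>s i u n t * \<delta>s j v n t + \<delta>s j (\<delta>s i u) n t * v n t))" for i j
    unfolding d1 by (simp add: deriv_seq_add deriv_seq_mult periodic_seq_mult su sv)
  have a: "L2_bounded (\<lambda>n t. u n t * \<delta>s i v n t)" "L2_bounded (\<lambda>n t. \<delta>s i u n t * v n t)" for i
    by (rule 1(1)[OF su(1) sv(2) u(2) v(3)], rule 1(2)[OF sv(1) su(2) v(2) u(3)])
  have b: "L2_bounded (\<lambda>n t. u n t * \<delta>s j (\<delta>s i v) n t)" "L2_bounded (\<lambda>n t. \<delta>s j (\<delta>s i u) n t * v n t)" for i j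
    by (rule 1(1)[OF su(1) sv(3) u(2) v(4)], rule 1(2)[OF sv(1) su(3) v(2) u(4)])
  have c: "L2_bounded (\<lambda>n t. \<delta>s j u n t * \<delta>s i v n t)" for i j
    by (rule L2_bounded_mult_L4[OF su(2) sv(2) 4(1) 4(2)])
  have "L2_bounded (\<delta>s i (\<lambda>n t. u n t * v n t))" for i
    unfolding d1 by (rule L2_bounded_add[OF periodic_seq_mult[OF su(1) sv(2)] periodic_seq_mult[OF su(2) sv(1)] a])
  moreover have "L2_bounded (\<delta>s j (\<delta>s i (\<lambda>n t. u n t * v n t)))" for i j
    unfolding d2
    by (rule L2_bounded_add[OF periodic_seq_add[OF periodic_seq_mult[OF su(1) sv(3)] periodic_seq_mult[OF su(2) sv(2)]]
        periodic_seq_add[OF periodic_seq_mult[OF su(2) sv(2)] periodic_seq_mult[OF su(3) sv(1)]]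
        L2_bounded_add[OF periodic_seq_mult[OF su(1) sv(3)] periodic_seq_mult[OF su(2) sv(2)] b(1) c]
        L2_bounded_add[OF periodic_seq_mult[OF su(2) sv(2)] periodic_seq_mult[OF su(3) sv(1)] c b(2)]])
  ultimately show ?thesis
    unfolding regular0_def using periodic_seq_mult[OF su(1) sv(1)] sup_bounded_mult[OF u(2) v(2)] by blast
qed

lemma regular_mult: "regular s u \<Longrightarrow> regular s v \<Longrightarrow> regular s (\<lambda>n t. u n t * v n t)"
proof (induction s arbitrary: u v)
  case 0
  then show ?case by (simp add: regular0_mult)
next
  case (Suc s)
  have "\<delta>s i (\<lambda>n t. u n t * v n t) = (\<lambda>n t. u n t * \<delta>s i v n t + \<delta>s i u n t * v n t)" for i
    using Suc.prems[THEN regular_periodic_seq] by (rule deriv_seq_mult)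
  moreover have "regular0 (\<lambda>n t. u n t * v n t)" using Suc.prems[THEN regular_0] by (rule regular0_mult)
  moreover have "regular s (\<lambda>n t. u n t * \<delta>s i v n t + \<delta>s i u n t * v n t)" for i
    using Suc.prems regular_Suc_imp[OF Suc.prems(1)] regular_Suc_imp[OF Suc.prems(2)] by (intro regular_add Suc.IH) auto
  ultimately show ?case by simp
qed

lemma regular_sum:
  assumes "\<And>b. b \<in> I \<Longrightarrow> regular s (u b)"
  shows "regular s (\<lambda>n t. \<Sum>b\<in>I. u b n t)"
  using assms
proof (induction I rule: infinite_finite_induct)
  case (insert b I)
  then have "regular s (\<lambda>n t. u b n t + (\<Sum>b\<in>I. u b n t))" by (intro regular_add) auto
  then show ?case using insert by simp
qed (use regular_const[of "\<lambda>_. 0" 0] in auto)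

section \<open>Solutions of Poisson's equation with bounded right-hand side\<close>

definition poisson_seq :: "fseq \<Rightarrow> fseq" where
  "poisson_seq G = (\<lambda>n. poisson n (G n))"

lemma periodic_seq_poisson_seq: "periodic_seq (poisson_seq G)"
  by (simp add: periodic_seq_def poisson_seq_def smooth_periodic_poisson)

lemma deriv_seq_poisson_seq: "periodic_seq G \<Longrightarrow> \<delta>s i (poisson_seq G) = poisson_seq (\<delta>s i G)"
  unfolding poisson_seq_def \<delta>s_def by (rule ext, rule pdiff_poisson) (simp add: periodic_seq_def)

lemma poisson_seq_bounds:
  assumes "periodic_seq G" "L2_bounded G"
  shows "L2_bounded (poisson_seq G)" "L2_bounded (\<delta>s i (poisson_seq G))" "L2_bounded (\<delta>s j (\<delta>s i (poisson_seq G)))" "sup_bounded (poisson_seq G)"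
proof -
  obtain C where C: "\<And>n. mean (\<lambda>t. (G n t)\<^sup>2) \<le> C" using assms by (auto simp: L2_bounded_def)
  note b = poisson_bounds[OF periodic_seq_continuous[OF assms(1)]]
  show "L2_bounded (poisson_seq G)" "L2_bounded (\<delta>s i (poisson_seq G))" "L2_bounded (\<delta>s j (\<delta>s i (poisson_seq G)))"
    unfolding L2_bounded_def poisson_seq_def \<delta>s_def using order_trans[OF b(1) C] order_trans[OF b(2) C] order_trans[OF b(3) C] by blast+
  obtain D where D: "\<And>n G t. continuous_on UNIV G \<Longrightarrow> (poisson n G t)\<^sup>2 \<le> D * mean (\<lambda>t. (G t)\<^sup>2)"
    using poisson_sup_bound by blast
  have "\<bar>poisson_seq G n t\<bar> \<le> sqrt (\<bar>D\<bar> * \<bar>C\<bar>)" for n t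
  proof -
    have m0: "0 \<le> mean (\<lambda>t. (G n t)\<^sup>2)"
      by (intro mean_nonneg continuous_intros periodic_seq_continuous[OF assms(1)]) auto
    have "(poisson_seq G n t)\<^sup>2 \<le> D * mean (\<lambda>t. (G n t)\<^sup>2)" unfolding poisson_seq_def by (intro D periodic_seq_continuous[OF assms(1)])
    also have "\<dots> \<le> \<bar>D\<bar> * \<bar>C\<bar>" using C[of n] m0 by (intro mult_mono) auto
    finally show ?thesis by (simp add: real_le_rsqrt)
  qed
  then show "sup_bounded (poisson_seq G)" unfolding sup_bounded_def by blast
qed

lemma regular0_L2: "regular0 u \<Longrightarrow> L2_bounded u"
  using sup_imp_L2_bounded[of u] by (auto simp: regular0_def)

text \<open>The derivatives of the solution solve the equation whose right-hand side is differentiated,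
  so the bounds for the latter carry over.\<close>
lemma regular0_poisson_seq:
  assumes "regular0 G"
  shows "regular0 (poisson_seq G)" "regular0 (\<delta>s i (poisson_seq G))" "regular0 (\<delta>s j (\<delta>s i (poisson_seq G)))"
proof -
  have G: "periodic_seq G" "L2_bounded G" "\<And>i. L2_bounded (\<delta>s i G)" "\<And>i j. L2_bounded (\<delta>s j (\<delta>s i G))"
    using assms regular0_L2[OF assms] by (auto simp: regular0_def)
  note s1 = G(1) periodic_seq_deriv_seq[OF G(1)] periodic_seq_deriv_seq[OF periodic_seq_deriv_seq[OF G(1)]]
  have "regular0 (poisson_seq G)"
    unfolding regular0_def using poisson_seq_bounds[OF s1(1) G(2)] periodic_seq_poisson_seq by simp
  moreover have "regular0 (poisson_seq (\<delta>s i G))" for i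
    unfolding regular0_def using poisson_seq_bounds[OF s1(2) G(3)] periodic_seq_poisson_seq by simp
  moreover have "regular0 (poisson_seq (\<delta>s j (\<delta>s i G)))" for i j
    unfolding regular0_def using poisson_seq_bounds[OF s1(3) G(4)] periodic_seq_poisson_seq by simp
  ultimately show "regular0 (poisson_seq G)" "regular0 (\<delta>s i (poisson_seq G))" "regular0 (\<delta>s j (\<delta>s i (poisson_seq G)))"
    by (simp_all only: deriv_seq_poisson_seq[OF s1(1)] deriv_seq_poisson_seq[OF s1(2)])
qed

lemma regular_poisson_seq: "regular s G \<Longrightarrow> regular s (poisson_seq G) \<and> regular s (\<delta>s i (poisson_seq G)) \<and> regular s (\<delta>s j (\<delta>s i (poisson_seq G)))"
proof (induction s arbitrary: G i j)
  case 0
  then show ?case by (simp add: regular0_poisson_seq)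
next
  case (Suc s)
  then have G: "periodic_seq G" "regular0 G" using regular_periodic_seq regular_0 by blast+
  have "regular s (poisson_seq (\<delta>s l G))" "regular s (\<delta>s i (poisson_seq (\<delta>s l G)))" "regular s (\<delta>s j (\<delta>s i (poisson_seq (\<delta>s l G))))" for l i j
    using Suc.IH[of "\<delta>s l G" i j] Suc.prems by simp_all
  then have "regular s (\<delta>s l (poisson_seq G))" "regular s (\<delta>s i (\<delta>s l (poisson_seq G)))" "regular s (\<delta>s j (\<delta>s i (\<delta>s l (poisson_seq G))))" for l i j
    by (simp_all only: deriv_seq_poisson_seq[OF G(1)])
  then show ?case using regular0_poisson_seq[OF G(2)] by simp
qed

section \<open>Composition with smooth functions\<close>

lemma periodic_seq_sum: "(\<And>b. b \<in> I \<Longrightarrow> periodic_seq (u b)) \<Longrightarrow> periodic_seq (\<lambda>n t. \<Sum>b\<in>I. u b n t)"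
proof (induction I rule: infinite_finite_induct)
  case (insert b I)
  then have "periodic_seq (\<lambda>n t. u b n t + (\<Sum>b\<in>I. u b n t))" by (intro periodic_seq_add) auto
  then show ?case using insert by simp
qed (simp_all add: periodic_seq_const)

lemma L2_bounded_sum:
  "(\<And>b. b \<in> I \<Longrightarrow> periodic_seq (u b)) \<Longrightarrow> (\<And>b. b \<in> I \<Longrightarrow> L2_bounded (u b)) \<Longrightarrow> L2_bounded (\<lambda>n t. \<Sum>b\<in>I. u b n t)"
proof (induction I rule: infinite_finite_induct)
  case (insert b I)
  then have "L2_bounded (\<lambda>n t. u b n t + (\<Sum>b\<in>I. u b n t))" by (intro L2_bounded_add periodic_seq_sum) auto
  then show ?case using insert by simp
qed (use L2_bounded_const[of "\<lambda>_. 0" 0] in auto)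

lemma sup_bounded_sum:
  "(\<And>b. b \<in> I \<Longrightarrow> sup_bounded (u b)) \<Longrightarrow> sup_bounded (\<lambda>n t. \<Sum>b\<in>I. u b n t)"
proof (induction I rule: infinite_finite_induct)
  case (insert b I)
  then have "sup_bounded (\<lambda>n t. u b n t + (\<Sum>b\<in>I. u b n t))" by (intro sup_bounded_add) auto
  then show ?case using insert by simp
qed (use sup_bounded_const[of "\<lambda>_. 0" 0] in auto)

lemma deriv_seq_sum: "(\<And>b. b \<in> I \<Longrightarrow> periodic_seq (u b)) \<Longrightarrow> \<delta>s i (\<lambda>n t. \<Sum>b\<in>I. u b n t) = (\<lambda>n t. \<Sum>b\<in>I. \<delta>s i (u b) n t)"
  unfolding \<delta>s_def by (rule ext, rule pdiff_sum) (rule periodic_seq_smooth)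

lemma L2_bounded_mult_sup':
  assumes "periodic_seq u" "periodic_seq v" "L2_bounded u" "sup_bounded v"
  shows "L2_bounded (\<lambda>n t. u n t * v n t)"
  using L2_bounded_mult_sup[OF assms(2,1,4,3)] by (simp add: mult.commute)

text \<open>The maps \<open>Y n\<close> go to a covering space, and one of their components will be the identity. So
  they need not be periodic themselves, but their derivatives are, and so are their compositions
  with the functions in \<open>Fs\<close>.\<close>
locale composition =
  fixes Y :: "nat \<Rightarrow> real ^ 3 \<Rightarrow> 'e::euclidean_space" and Fs :: "('e \<Rightarrow> real) set"
  assumes smooth_Y: "smooth (Y n)"
    and smooth_F: "F \<in> Fs \<Longrightarrow> smooth F"
    and pdiff_F: "F \<in> Fs \<Longrightarrow> pdiff b F \<in> Fs"
    and periodic_FY: "F \<in> Fs \<Longrightarrow> periodic3 (\<lambda>t. F (Y n t))"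
    and periodic_seq_DY: "b \<in> Basis \<Longrightarrow> periodic_seq (\<delta>s i (\<lambda>n t. Y n t \<bullet> b))"
begin

abbreviation D :: "'e \<Rightarrow> 3 \<Rightarrow> fseq" where
  "D b i \<equiv> \<delta>s i (\<lambda>n t. Y n t \<bullet> b)"

abbreviation comp :: "('e \<Rightarrow> real) \<Rightarrow> fseq" where
  "comp F \<equiv> (\<lambda>n t. F (Y n t))"

lemma periodic_seq_comp: "F \<in> Fs \<Longrightarrow> periodic_seq (comp F)"
  unfolding periodic_seq_def smooth_periodic_def using smooth_compose[OF smooth_F smooth_Y] periodic_FY by blast

lemma deriv_seq_comp: "F \<in> Fs \<Longrightarrow> \<delta>s i (comp F) = (\<lambda>n t. \<Sum>b\<in>Basis. D b i n t * comp (pdiff b F) n t)"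
  unfolding \<delta>s_def by (rule ext, rule pdiff_compose[OF smooth_F smooth_Y])

lemma L2_bounded_deriv_seq_comp:
  assumes "F \<in> Fs" "\<And>b. b \<in> Basis \<Longrightarrow> L2_bounded (D b i)" "\<And>b. b \<in> Basis \<Longrightarrow> sup_bounded (comp (pdiff b F))"
  shows "L2_bounded (\<delta>s i (comp F))"
  unfolding deriv_seq_comp[OF assms(1)]
  by (rule L2_bounded_sum[OF periodic_seq_mult[OF periodic_seq_DY periodic_seq_comp[OF pdiff_F[OF assms(1)]]]
        L2_bounded_mult_sup'[OF periodic_seq_DY periodic_seq_comp[OF pdiff_F[OF assms(1)]] assms(2,3)]])

text \<open>The second derivatives contain products of two first derivatives of \<open>Y\<close>, whence the
  \<open>L\<^sup>4\<close>-bounds among the hypotheses.\<close>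
lemma regular0_comp:
  assumes F: "F \<in> Fs"
    and sup: "\<And>F. F \<in> Fs \<Longrightarrow> sup_bounded (comp F)"
    and D4: "\<And>b i. b \<in> Basis \<Longrightarrow> L2_bounded (\<lambda>n t. (D b i n t)\<^sup>2)"
    and D2: "\<And>b i. b \<in> Basis \<Longrightarrow> L2_bounded (D b i)"
    and DD: "\<And>b i j. b \<in> Basis \<Longrightarrow> L2_bounded (\<delta>s j (D b i))"
  shows "regular0 (comp F)"
proof -
  have "L2_bounded (\<delta>s j (\<delta>s i (comp F)))" for i j
  proof -
    have sc: "periodic_seq (comp (pdiff b F))" "sup_bounded (comp (pdiff b F))" for b
      using periodic_seq_comp[OF pdiff_F[OF F]] sup[OF pdiff_F[OF F]] by auto
    have sc2: "periodic_seq (comp (pdiff c (pdiff b F)))" "sup_bounded (comp (pdiff c (pdiff b F)))" for b c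
      using periodic_seq_comp[OF pdiff_F[OF pdiff_F[OF F]]] sup[OF pdiff_F[OF pdiff_F[OF F]]] by auto
    have L: "L2_bounded (\<delta>s j (\<lambda>n t. D b i n t * comp (pdiff b F) n t))" if b: "b \<in> Basis" for b
    proof -
      have "L2_bounded (\<lambda>n t. D b i n t * \<delta>s j (comp (pdiff b F)) n t)"
      proof -
        have "L2_bounded (\<lambda>n t. \<Sum>c\<in>Basis. (D b i n t * D c j n t) * comp (pdiff c (pdiff b F)) n t)"
        proof (rule L2_bounded_sum)
          fix c :: 'e assume c: "c \<in> Basis"
          show "periodic_seq (\<lambda>n t. (D b i n t * D c j n t) * comp (pdiff c (pdiff b F)) n t)"
            by (rule periodic_seq_mult[OF periodic_seq_mult[OF periodic_seq_DY[OF b] periodic_seq_DY[OF c]] sc2(1)])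
          show "L2_bounded (\<lambda>n t. (D b i n t * D c j n t) * comp (pdiff c (pdiff b F)) n t)"
            by (rule L2_bounded_mult_sup'[OF periodic_seq_mult[OF periodic_seq_DY[OF b] periodic_seq_DY[OF c]] sc2(1)
                  L2_bounded_mult_L4[OF periodic_seq_DY[OF b] periodic_seq_DY[OF c] D4[OF b] D4[OF c]] sc2(2)])
        qed
        then show ?thesis
          unfolding deriv_seq_comp[OF pdiff_F[OF F]] by (simp add: sum_distrib_left mult.assoc)
      qed
      moreover have "L2_bounded (\<lambda>n t. \<delta>s j (D b i) n t * comp (pdiff b F) n t)"
        by (rule L2_bounded_mult_sup'[OF periodic_seq_deriv_seq[OF periodic_seq_DY[OF b]] sc(1) DD[OF b] sc(2)])
      ultimately show ?thesis
        unfolding deriv_seq_mult[OF periodic_seq_DY[OF b] sc(1)]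
        by (intro L2_bounded_add periodic_seq_mult periodic_seq_deriv_seq periodic_seq_DY[OF b] sc(1))
    qed
    have eq: "\<delta>s j (\<lambda>n t. \<Sum>b\<in>Basis. D b i n t * comp (pdiff b F) n t)
        = (\<lambda>n t. \<Sum>b\<in>Basis. \<delta>s j (\<lambda>n t. D b i n t * comp (pdiff b F) n t) n t)"
      by (rule deriv_seq_sum) (rule periodic_seq_mult[OF periodic_seq_DY sc(1)])
    show ?thesis
      unfolding deriv_seq_comp[OF F] eq
      by (rule L2_bounded_sum[OF periodic_seq_deriv_seq[OF periodic_seq_mult[OF periodic_seq_DY sc(1)]] L])
  qed
  then show ?thesis
    unfolding regular0_def using F L2_bounded_deriv_seq_comp[OF F D2 sup[OF pdiff_F[OF F]]] sup periodic_seq_comp by blast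
qed

text \<open>By the chain rule the derivatives of \<open>F \<circ> Y\<close> are sums of products of derivatives of \<open>Y\<close> and
  functions of the form \<open>F' \<circ> Y\<close> with \<open>F'\<close> in \<open>Fs\<close>, to which the induction applies.\<close>
lemma regular_Suc_comp:
  assumes F: "F \<in> Fs" and regular0: "\<And>F. F \<in> Fs \<Longrightarrow> regular0 (comp F)"
    and D: "\<And>b i. b \<in> Basis \<Longrightarrow> regular s (D b i)"
  shows "regular (Suc s) (comp F)"
  using F D
proof (induction s arbitrary: F)
  case 0
  have "regular 0 (\<delta>s i (comp F))" for i
    unfolding deriv_seq_comp[OF 0(1)]
    by (rule regular_sum, rule regular_mult, rule 0(2)) (simp_all add: regular0 pdiff_F 0(1))
  then show ?case using regular0[OF 0(1)] by simp
next
  case (Suc s)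
  have "regular (Suc s) (\<delta>s i (comp F))" for i
    unfolding deriv_seq_comp[OF Suc(2)]
  proof (rule regular_sum, rule regular_mult)
    fix b :: 'e assume b: "b \<in> Basis"
    show "regular (Suc s) (D b i)" by (rule Suc.prems(2)[OF b])
    show "regular (Suc s) (comp (pdiff b F))"
      by (rule Suc.IH[OF pdiff_F[OF Suc.prems(1)]]) (rule regular_Suc_imp[OF Suc.prems(2)])
  qed
  then show ?case using regular0[OF Suc.prems(1)] unfolding regular.simps(2)[of "Suc s"] by blast
qed

end

section \<open>Bootstrapping\<close>

text \<open>The universal cover of the domain of \<open>W\<close>, with coordinates \<open>(t, q, p)\<close>; the functions below
  that are invariant under the lattice are those which descend.\<close>
type_synonym 'd cover = "(real ^ 3) \<times> (real ^ 'd) \<times> (real ^ 'd ^ 3)"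

definition lattice :: "'d::finite cover set" where
  "lattice = {(m, l, 0) | m l. (\<forall>i. m $ i \<in> \<int>) \<and> (\<forall>i. l $ i \<in> \<int>)}"

definition admissible :: "('d::finite cover \<Rightarrow> real) \<Rightarrow> bool" where
  "admissible F \<longleftrightarrow> smooth F \<and> (\<forall>z m. m \<in> lattice \<longrightarrow> F (z + m) = F z)"

lemma admissible_pdiff: "admissible F \<Longrightarrow> admissible (pdiff v F)"
  unfolding admissible_def using smooth_pdiff[of F v] pdiff_translate[of F _ v] by (simp only:) blast

lemma admissible_smooth: "admissible F \<Longrightarrow> smooth F"
  unfolding admissible_def by blast

lemma admissible_periodic: "admissible F \<Longrightarrow> m \<in> lattice \<Longrightarrow> F (z + m) = F z"
  unfolding admissible_def by blast

text \<open>By periodicity in \<open>(t, q)\<close> it suffices to consider a compact set.\<close>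
lemma admissible_bounded:
  assumes "admissible F"
  shows "\<exists>C. \<forall>t q p. (\<forall>i j. \<bar>p $ i $ j\<bar> \<le> R) \<longrightarrow> \<bar>F (t, q, p)\<bar> \<le> C"
proof -
  let ?c = "\<chi> i j. R"
  define K :: "'a cover set" where "K = cbox 0 1 \<times> cbox 0 1 \<times> {p. \<forall>i j. \<bar>p $ i $ j\<bar> \<le> R}"
  have "compact {p :: real ^ 'a ^ 3. \<forall>i j. \<bar>p $ i $ j\<bar> \<le> R}"
  proof -
    have "{p :: real ^ 'a ^ 3. \<forall>i j. \<bar>p $ i $ j\<bar> \<le> R} = cbox (- ?c) ?c"
      by (auto simp: mem_box_cart interval_cbox_cart[symmetric] less_eq_vec_def abs_le_iff minus_le_iff cbox_interval)
    then show ?thesis by (metis compact_cbox)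
  qed
  then have "compact K" unfolding K_def by (intro compact_Times compact_cbox)
  then have "compact (F ` K)"
    using assms by (intro compact_continuous_image) (auto simp: admissible_def intro: smooth_continuous)
  then obtain C where C: "\<And>z. z \<in> K \<Longrightarrow> \<bar>F z\<bar> \<le> C"
    using compact_imp_bounded[of "F ` K"] by (auto simp: bounded_iff)
  have "\<bar>F (t, q, p)\<bar> \<le> C" if p: "\<forall>i j. \<bar>p $ i $ j\<bar> \<le> R" for t q p
  proof -
    define m l where "m = (\<chi> i. - real_of_int \<lfloor>t $ i\<rfloor>)" and "l = (\<chi> i. - real_of_int \<lfloor>q $ i\<rfloor>)"
    have "(m, l, 0) \<in> (lattice :: 'a cover set)" unfolding lattice_def m_def l_def by auto
    then have "F ((t, q, p) + (m, l, 0)) = F (t, q, p)" by (rule admissible_periodic[OF assms])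
    moreover have "(t, q, p) + (m, l, 0) \<in> K"
    proof -
      have "0 \<le> x - of_int \<lfloor>x\<rfloor> \<and> x - of_int \<lfloor>x\<rfloor> \<le> 1" for x :: real by linarith
      then show ?thesis using p by (simp add: K_def m_def l_def mem_box_cart)
    qed
    ultimately show ?thesis using C by metis
  qed
  then show ?thesis by blast
qed

abbreviation unit_t :: "3 \<Rightarrow> 'd::finite cover" where "unit_t i \<equiv> (axis i 1, 0, 0)"
abbreviation unit_q :: "'d \<Rightarrow> 'd::finite cover" where "unit_q \<alpha> \<equiv> (0, axis \<alpha> 1, 0)"
abbreviation unit_p :: "3 \<Rightarrow> 'd \<Rightarrow> 'd::finite cover" where "unit_p i \<alpha> \<equiv> (0, 0, axis i (axis \<alpha> 1))"

lemma cover_Basis_cases: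
  assumes "b \<in> (Basis :: 'd::finite cover set)"
  obtains (t) i where "b = unit_t i" | (q) \<alpha> where "b = unit_q \<alpha>" | (p) i \<alpha> where "b = unit_p i \<alpha>"
proof -
  have "(\<exists>i. b = unit_t i) \<or> (\<exists>\<alpha>. b = unit_q \<alpha>) \<or> (\<exists>i \<alpha>. b = unit_p i \<alpha>)"
    using assms by (auto simp: Basis_prod_def Basis_vec_def zero_prod_def)
  then show ?thesis using t q p by blast
qed

lemma cover_Basis: "unit_t i \<in> (Basis :: 'd::finite cover set)" "unit_q \<alpha> \<in> (Basis :: 'd::finite cover set)" "unit_p i \<alpha> \<in> (Basis :: 'd::finite cover set)"
  by (simp_all add: in_Basis_prod_iff axis_in_Basis_iff zero_prod_def)

lemma cover_inner [simp]: "(t, q, p) \<bullet> unit_t i = t $ i" "(t, q, p) \<bullet> unit_q \<alpha> = q $ \<alpha>" "(t, q, p) \<bullet> unit_p i \<alpha> = p $ i $ \<alpha>"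
  by (simp_all add: inner_axis)

text \<open>A sequence of solutions of the truncated equations: here \<open>phi\<close> and \<open>chi\<close> below are the
  potentials, and \<open>qs\<close>, \<open>ps\<close> are the components of \<open>Y\<close>. The equations are used in the resolved form
  \<open>\<phi> = (-\<Delta>)\<^sup>-\<^sup>1 \<partial>q F\<close>, \<open>\<chi> = (-\<Delta>)\<^sup>-\<^sup>1 \<partial>p F\<close>, and the bounds on \<open>F\<close> are just those which a finite
  \<open>C\<^sup>2\<close>-norm provides.\<close>
locale approximate_solutions =
  fixes F :: "'d::finite cover \<Rightarrow> real" and C :: real and q0 :: "nat \<Rightarrow> real ^ 'd"
    and a :: "nat \<Rightarrow> real ^ 'd ^ 3" and Y :: "nat \<Rightarrow> real ^ 3 \<Rightarrow> 'd cover"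
  assumes admissible_F: "admissible F"
    and F1: "b \<in> Basis \<Longrightarrow> \<bar>pdiff b F z\<bar> \<le> C"
    and F2: "b \<in> Basis \<Longrightarrow> c \<in> Basis \<Longrightarrow> \<bar>pdiff c (pdiff b F) z\<bar> \<le> C"
    and q0: "\<bar>q0 n $ \<alpha>\<bar> \<le> 1" and a: "\<bar>a n $ i $ \<alpha>\<bar> \<le> C"
    and Y: "Y n t = (t,
        \<chi> \<alpha>. q0 n $ \<alpha> + (poisson_seq (\<lambda>n t. pdiff (unit_q \<alpha>) F (Y n t)) n t
          + (\<Sum>i\<in>UNIV. - 1 * \<delta>s i (poisson_seq (\<lambda>n t. pdiff (unit_p i \<alpha>) F (Y n t))) n t)),
        \<chi> i \<alpha>. a n $ i $ \<alpha> + \<delta>s i (poisson_seq (\<lambda>n t. pdiff (unit_q \<alpha>) F (Y n t))) n t)"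
begin

definition phi :: "'d \<Rightarrow> fseq" where "phi \<alpha> = poisson_seq (\<lambda>n t. pdiff (unit_q \<alpha>) F (Y n t))"
definition chi :: "3 \<Rightarrow> 'd \<Rightarrow> fseq" where "chi i \<alpha> = poisson_seq (\<lambda>n t. pdiff (unit_p i \<alpha>) F (Y n t))"
definition qs :: "'d \<Rightarrow> fseq" where
  "qs \<alpha> = (\<lambda>n t. q0 n $ \<alpha> + (phi \<alpha> n t + (\<Sum>i\<in>UNIV. - 1 * \<delta>s i (chi i \<alpha>) n t)))"
definition ps :: "3 \<Rightarrow> 'd \<Rightarrow> fseq" where
  "ps i \<alpha> = (\<lambda>n t. a n $ i $ \<alpha> + \<delta>s i (phi \<alpha>) n t)"

lemma Y_inner:
  "(\<lambda>n t. Y n t \<bullet> unit_t i) = (\<lambda>n t. t $ i)" "(\<lambda>n t. Y n t \<bullet> unit_q \<alpha>) = qs \<alpha>" "(\<lambda>n t. Y n t \<bullet> unit_p i \<alpha>) = ps i \<alpha>"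
  by (rule ext, rule ext, subst Y, simp add: qs_def ps_def phi_def chi_def inner_axis)+

lemma periodic_seq_phi: "periodic_seq (phi \<alpha>)" and periodic_seq_chi: "periodic_seq (chi i \<alpha>)"
  by (simp_all add: phi_def chi_def periodic_seq_poisson_seq)

lemma periodic_seq_cmult: "periodic_seq u \<Longrightarrow> periodic_seq (\<lambda>n t. c * u n t)"
  by (rule periodic_seq_mult[OF periodic_seq_const])

lemma periodic_seq_qs: "periodic_seq (qs \<alpha>)" and periodic_seq_ps: "periodic_seq (ps i \<alpha>)"
  unfolding qs_def ps_def by (intro periodic_seq_add periodic_seq_const periodic_seq_sum periodic_seq_cmult periodic_seq_deriv_seq periodic_seq_phi periodic_seq_chi)+

lemma deriv_seq_const: "\<delta>s i (\<lambda>n t. c n) = (\<lambda>n t. 0)"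
  by (simp add: \<delta>s_def pdiff_const)

lemma deriv_seq_cmult: "periodic_seq u \<Longrightarrow> \<delta>s i (\<lambda>n t. c * u n t) = (\<lambda>n t. c * \<delta>s i u n t)"
  using deriv_seq_mult[OF periodic_seq_const[of "\<lambda>_. c"], of u i] deriv_seq_const[of i "\<lambda>_. c"] by simp

lemma deriv_seq_qs: "\<delta>s j (qs \<alpha>) = (\<lambda>n t. \<delta>s j (phi \<alpha>) n t + (\<Sum>i\<in>UNIV. - 1 * \<delta>s j (\<delta>s i (chi i \<alpha>)) n t))"
  unfolding qs_def
  by (simp only: deriv_seq_add deriv_seq_sum deriv_seq_cmult deriv_seq_const periodic_seq_add periodic_seq_const periodic_seq_sum periodic_seq_cmult periodic_seq_deriv_seq periodic_seq_phi periodic_seq_chi add_0_left)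

lemma deriv_seq_ps: "\<delta>s j (ps i \<alpha>) = \<delta>s j (\<delta>s i (phi \<alpha>))"
  unfolding ps_def
  by (simp only: deriv_seq_add deriv_seq_const periodic_seq_const periodic_seq_deriv_seq periodic_seq_phi add_0_left)

lemma deriv_seq_coordinate: "\<delta>s j (\<lambda>n t. t $ i) = (\<lambda>n t. axis j 1 $ i)"
proof -
  have h: "((\<lambda>t::real^3. t $ i) has_derivative (\<lambda>t. t $ i)) (at t)" for t
    by (intro bounded_linear_imp_has_derivative bounded_linear_vec_nth)
  show ?thesis unfolding \<delta>s_def by (intro ext) (rule pdiff_eq[OF h])
qed

lemma D_prop:
  assumes "b \<in> Basis" "\<And>c. Q (\<lambda>n t. c)" "\<And>\<alpha>. Q (\<delta>s j (qs \<alpha>))" "\<And>i \<alpha>. Q (\<delta>s j (ps i \<alpha>))"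
  shows "Q (\<delta>s j (\<lambda>n t. Y n t \<bullet> b))"
  using assms(1)
proof (cases rule: cover_Basis_cases)
  case t
  then show ?thesis by (simp only: Y_inner deriv_seq_coordinate assms(2))
next
  case q
  then show ?thesis by (simp only: Y_inner assms(3))
next
  case p
  then show ?thesis by (simp only: Y_inner assms(4))
qed

sublocale composition Y "Collect admissible"
proof
  fix n
  show "smooth (Y n)"
  proof (rule smooth_euclidean)
    fix b :: "'d cover" assume "b \<in> Basis"
    then show "smooth (\<lambda>t. Y n t \<bullet> b)"
    proof (cases rule: cover_Basis_cases)
      case (t i)
      have "(\<lambda>t. Y n t \<bullet> b) = (\<lambda>t. t $ i)" using t fun_cong[OF Y_inner(1)[of i], of n] by (simp only:)
      then show ?thesis using smooth_linear[OF bounded_linear_vec_nth[of i]] by (simp only:)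
    next
      case (q \<alpha>)
      have "(\<lambda>t. Y n t \<bullet> b) = qs \<alpha> n" using q fun_cong[OF Y_inner(2)[of \<alpha>], of n] by (simp only:)
      then show ?thesis using periodic_seq_smooth[OF periodic_seq_qs[of \<alpha>]] by (simp only:)
    next
      case (p i \<alpha>)
      have "(\<lambda>t. Y n t \<bullet> b) = ps i \<alpha> n" using p fun_cong[OF Y_inner(3)[of i \<alpha>], of n] by (simp only:)
      then show ?thesis using periodic_seq_smooth[OF periodic_seq_ps[of i \<alpha>]] by (simp only:)
    qed
  qed
next
  fix f :: "'d cover \<Rightarrow> real" and n assume f: "f \<in> Collect admissible"
  show "periodic3 (\<lambda>t. f (Y n t))"
    unfolding periodic3_def
  proof (intro allI)
    fix i t
    have Yeq: "Y n t = (t, \<chi> \<alpha>. qs \<alpha> n t, \<chi> i \<alpha>. ps i \<alpha> n t)" for t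
      by (subst Y) (simp add: qs_def ps_def phi_def chi_def)
    have "qs \<alpha> n (t + axis i 1) = qs \<alpha> n t" "ps j \<alpha> n (t + axis i 1) = ps j \<alpha> n t" for \<alpha> j
      using periodic_seq_qs[of \<alpha>] periodic_seq_ps[of j \<alpha>] by (auto simp: periodic_seq_def smooth_periodic_def periodic3_def)
    then have "Y n (t + axis i 1) = Y n t + unit_t i" by (simp add: Yeq)
    moreover have "unit_t i \<in> (lattice :: 'd cover set)" by (auto simp: lattice_def axis_def)
    ultimately show "f (Y n (t + axis i 1)) = f (Y n t)" using f admissible_periodic[of f "unit_t i" "Y n t"] by (simp only: mem_Collect_eq)
  qed
next
  fix b :: "'d cover" and i assume "b \<in> Basis"
  then show "periodic_seq (\<delta>s i (\<lambda>n t. Y n t \<bullet> b))"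
    by (rule D_prop) (intro periodic_seq_const periodic_seq_deriv_seq periodic_seq_qs periodic_seq_ps)+
qed (simp_all add: admissible_pdiff admissible_smooth)

lemma L2_const: "L2_bounded (\<lambda>n t. c)"
  using L2_bounded_const[of "\<lambda>_. c" "\<bar>c\<bar>"] by simp

lemma supb_const: "sup_bounded (\<lambda>n t. c)"
  using sup_bounded_const[of "\<lambda>_. c" "\<bar>c\<bar>"] by simp

lemma L2_cmult: "periodic_seq u \<Longrightarrow> L2_bounded u \<Longrightarrow> L2_bounded (\<lambda>n t. c * u n t)"
  by (rule L2_bounded_mult_sup[OF periodic_seq_const _ supb_const])

lemma supb_cmult: "sup_bounded u \<Longrightarrow> sup_bounded (\<lambda>n t. c * u n t)"
  by (rule sup_bounded_mult[OF supb_const])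

abbreviation W :: "'d cover \<Rightarrow> fseq" where "W b \<equiv> comp (pdiff b F)"

lemma periodic_seq_W: "periodic_seq (W b)"
  by (rule periodic_seq_comp) (simp add: admissible_F admissible_pdiff)

lemma phi_W: "phi \<alpha> = poisson_seq (W (unit_q \<alpha>))" and chi_W: "chi i \<alpha> = poisson_seq (W (unit_p i \<alpha>))"
  by (simp_all add: phi_def chi_def)

lemma W_sup_bounded: "b \<in> Basis \<Longrightarrow> sup_bounded (W b)"
  using F1 unfolding sup_bounded_def by blast

text \<open>First round: the right-hand sides are bounded, so the second derivatives of the potentials,
  and with them the first derivatives of \<open>q\<close> and \<open>p\<close>, are bounded in \<open>L\<^sup>2\<close>.\<close>
lemma L2_bounded_qs_ps:
  assumes "\<And>b. b \<in> Basis \<Longrightarrow> L2_bounded (W b)"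
  shows "L2_bounded (\<delta>s j (qs \<alpha>))" "L2_bounded (\<delta>s j (ps i \<alpha>))"
proof -
  note L = poisson_seq_bounds[OF periodic_seq_W assms[OF cover_Basis(2)], folded phi_W] poisson_seq_bounds[OF periodic_seq_W assms[OF cover_Basis(3)], folded chi_W]
  note s = periodic_seq_deriv_seq[OF periodic_seq_deriv_seq[OF periodic_seq_chi]]
  show "L2_bounded (\<delta>s j (qs \<alpha>))"
    unfolding deriv_seq_qs
    by (rule L2_bounded_add[OF periodic_seq_deriv_seq[OF periodic_seq_phi] periodic_seq_sum[OF periodic_seq_cmult[OF s]] L(2) L2_bounded_sum[OF periodic_seq_cmult[OF s] L2_cmult[OF s L(7)]]])
  show "L2_bounded (\<delta>s j (ps i \<alpha>))" unfolding deriv_seq_ps by (rule L(3))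
qed

lemma W_L2: "b \<in> Basis \<Longrightarrow> L2_bounded (W b)"
  by (rule sup_imp_L2_bounded[OF periodic_seq_W W_sup_bounded])

text \<open>Second round: hence the first derivatives of the right-hand sides are bounded in \<open>L\<^sup>2\<close>, by
  the bound on the second derivatives of \<open>F\<close>.\<close>
lemma deriv_seq_W_L2: "b \<in> Basis \<Longrightarrow> L2_bounded (\<delta>s i (W b))"
proof (rule L2_bounded_deriv_seq_comp)
  fix c :: "'d cover" assume c: "c \<in> Basis"
  show "L2_bounded (D c i)" using c by (rule D_prop) (intro L2_const L2_bounded_qs_ps W_L2; assumption)+
  assume b: "b \<in> Basis"
  show "sup_bounded (comp (pdiff c (pdiff b F)))" using F2[OF b c] unfolding sup_bounded_def by blast
qed (simp add: admissible_F admissible_pdiff)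

text \<open>Applying the estimates for the inverse Laplacian to the differentiated equations gives
  sup-bounds for the first derivatives of the potentials and \<open>L\<^sup>2\<close>-bounds for the third ones.\<close>
lemma regular0_qs: "regular0 (qs \<alpha>)" and regular0_ps: "regular0 (ps i \<alpha>)"
proof -
  have P2: "sup_bounded (\<delta>s k (poisson_seq (W b)))" "L2_bounded (\<delta>s l (\<delta>s j (\<delta>s k (poisson_seq (W b)))))" if "b \<in> Basis" for b j k l
    using poisson_seq_bounds(3,4)[OF periodic_seq_deriv_seq[OF periodic_seq_W] deriv_seq_W_L2[OF that]]
    by (simp_all only: deriv_seq_poisson_seq[OF periodic_seq_W])
  note P1 = poisson_seq_bounds[OF periodic_seq_W W_L2]
  note p1 = P1[OF cover_Basis(2), folded phi_W] and x1 = P1[OF cover_Basis(3), folded chi_W]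
  note p2 = P2[OF cover_Basis(2), folded phi_W] and x2 = P2[OF cover_Basis(3), folded chi_W]
  note s = periodic_seq_deriv_seq[OF periodic_seq_chi] periodic_seq_deriv_seq[OF periodic_seq_deriv_seq[OF periodic_seq_chi]] periodic_seq_deriv_seq[OF periodic_seq_deriv_seq[OF periodic_seq_deriv_seq[OF periodic_seq_chi]]]
  have "sup_bounded (qs \<alpha>)"
    unfolding qs_def by (rule sup_bounded_add[OF sup_bounded_const[OF q0] sup_bounded_add[OF p1(4) sup_bounded_sum[OF supb_cmult[OF x2(1)]]]])
  moreover have "L2_bounded (\<delta>s k (\<delta>s j (qs \<alpha>)))" for j k
  proof -
    have e: "\<delta>s k (\<delta>s j (qs \<alpha>)) = (\<lambda>n t. \<delta>s k (\<delta>s j (phi \<alpha>)) n t + (\<Sum>i\<in>UNIV. - 1 * \<delta>s k (\<delta>s j (\<delta>s i (chi i \<alpha>))) n t))"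
      unfolding deriv_seq_qs
      by (simp only: deriv_seq_add deriv_seq_sum deriv_seq_cmult periodic_seq_add periodic_seq_sum periodic_seq_cmult periodic_seq_deriv_seq periodic_seq_phi periodic_seq_chi)
    show ?thesis
      unfolding e
      by (rule L2_bounded_add[OF periodic_seq_deriv_seq[OF periodic_seq_deriv_seq[OF periodic_seq_phi]] periodic_seq_sum[OF periodic_seq_cmult[OF s(3)]] p1(3) L2_bounded_sum[OF periodic_seq_cmult[OF s(3)] L2_cmult[OF s(3) x2(2)]]])
  qed
  ultimately show "regular0 (qs \<alpha>)"
    unfolding regular0_def using L2_bounded_qs_ps(1)[OF W_L2] periodic_seq_qs by blast
  have "sup_bounded (ps i \<alpha>)"
    unfolding ps_def by (rule sup_bounded_add[OF sup_bounded_const[OF a] p2(1)])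
  then show "regular0 (ps i \<alpha>)"
    unfolding regular0_def using L2_bounded_qs_ps(2)[OF W_L2] periodic_seq_ps p2(2) deriv_seq_ps by simp
qed

text \<open>Derivatives of \<open>F\<close> of order three and higher are bounded only where \<open>p\<close> is bounded; by now
  the values of \<open>Y\<close> lie in such a region.\<close>
lemma comp_sup_bounded:
  assumes f: "admissible f"
  shows "sup_bounded (comp f)"
proof -
  have "\<exists>R. \<forall>n t. \<bar>ps i \<alpha> n t\<bar> \<le> R" for i \<alpha>
    using regular0_ps[of i \<alpha>] by (auto simp: regular0_def sup_bounded_def)
  then obtain r where r: "\<And>i \<alpha> n t. \<bar>ps i \<alpha> n t\<bar> \<le> r i \<alpha>" by metis
  define R where "R = (\<Sum>i\<in>UNIV. \<Sum>\<alpha>\<in>UNIV. \<bar>r i \<alpha>\<bar>)"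
  have R: "\<bar>ps i \<alpha> n t\<bar> \<le> R" for i \<alpha> n t
  proof -
    have "\<bar>ps i \<alpha> n t\<bar> \<le> \<bar>r i \<alpha>\<bar>" using r[of i \<alpha> n t] by linarith
    also have "\<dots> \<le> (\<Sum>\<alpha>\<in>UNIV. \<bar>r i \<alpha>\<bar>)" by (rule member_le_sum) auto
    also have "\<dots> \<le> R" unfolding R_def by (rule member_le_sum) (auto intro: sum_nonneg)
    finally show ?thesis .
  qed
  obtain K where K: "\<And>t q p. (\<forall>i j. \<bar>p $ i $ j\<bar> \<le> R) \<Longrightarrow> \<bar>f (t, q, p)\<bar> \<le> K"
    using admissible_bounded[OF f, of R] by blast
  have "\<bar>comp f n t\<bar> \<le> K" for n t
  proof -
    have "Y n t = (t, \<chi> \<alpha>. qs \<alpha> n t, \<chi> i \<alpha>. ps i \<alpha> n t)"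
      by (subst Y) (simp add: qs_def ps_def phi_def chi_def)
    then show ?thesis using K[of "\<chi> i \<alpha>. ps i \<alpha> n t"] R by simp
  qed
  then show ?thesis unfolding sup_bounded_def by blast
qed

lemma regular0_admissible_comp: "admissible f \<Longrightarrow> regular0 (comp f)"
proof (rule regular0_comp)
  have q: "periodic_seq (qs \<alpha>)" "sup_bounded (qs \<alpha>)" "L2_bounded (\<delta>s i (qs \<alpha>))" "L2_bounded (\<delta>s j (\<delta>s i (qs \<alpha>)))"
    and p: "periodic_seq (ps k \<alpha>)" "sup_bounded (ps k \<alpha>)" "L2_bounded (\<delta>s i (ps k \<alpha>))" "L2_bounded (\<delta>s j (\<delta>s i (ps k \<alpha>)))"
    for \<alpha> i j k using regular0_qs[of \<alpha>] regular0_ps[of k \<alpha>] by (auto simp: regular0_def)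
  fix b :: "'d cover" assume b: "b \<in> Basis"
  fix i j
  show "L2_bounded (\<lambda>n t. (D b i n t)\<^sup>2)"
    by (rule D_prop[OF b, of "\<lambda>u. L2_bounded (\<lambda>n t. (u n t)\<^sup>2)"]) (intro L2_const L4_bounded_deriv_seq q p)+
  show "L2_bounded (D b i)" by (rule D_prop[OF b]) (intro L2_const q p)+
  show "L2_bounded (\<delta>s j (D b i))"
    by (rule D_prop[OF b, of "\<lambda>u. L2_bounded (\<delta>s j u)"]) (simp_all add: deriv_seq_const L2_const q p)
qed (simp_all add: comp_sup_bounded)

lemma regular_const1: "regular s (\<lambda>n t. c)"
  using regular_const[of "\<lambda>_. c" "\<bar>c\<bar>"] by simp

lemma regular_qs_ps:
  assumes "\<And>b. regular s (W b)"
  shows "regular s (\<delta>s j (qs \<alpha>))" "regular s (\<delta>s j (ps i \<alpha>))"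
proof -
  have p: "regular s (phi \<alpha>)" "regular s (\<delta>s j (phi \<alpha>))" "regular s (\<delta>s j (\<delta>s i (phi \<alpha>)))"
    and x: "regular s (chi i \<alpha>)" "regular s (\<delta>s j (chi i \<alpha>))" "regular s (\<delta>s j (\<delta>s k (chi i \<alpha>)))" for i j k \<alpha>
    using regular_poisson_seq[OF assms] unfolding phi_W chi_W by blast+
  show "regular s (\<delta>s j (qs \<alpha>))"
    unfolding deriv_seq_qs by (rule regular_add[OF p(2) regular_sum[OF regular_mult[OF regular_const1 x(3)]]])
  show "regular s (\<delta>s j (ps i \<alpha>))" unfolding deriv_seq_ps by (rule p(3))
qed

text \<open>The bootstrap: regularity of the right-hand sides passes to the first derivatives of \<open>Y\<close>
  through the inverse Laplacian, and by composition to the first derivatives of the right-hand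
  sides.\<close>
lemma regular_W: "regular s (W b)"
proof (induction s arbitrary: b)
  case 0
  show ?case using regular0_admissible_comp[OF admissible_pdiff[OF admissible_F]] by simp
next
  case (Suc s)
  show ?case
  proof (rule regular_Suc_comp)
    show "regular0 (comp f)" if "f \<in> Collect admissible" for f using regular0_admissible_comp that by simp
    fix c :: "'d cover" and i assume c: "c \<in> Basis"
    show "regular s (D c i)" by (rule D_prop[OF c]) (intro regular_const1 regular_qs_ps Suc.IH)+
  qed (simp add: admissible_F admissible_pdiff)
qed

lemma regular_phi: "regular s (phi \<alpha>)" and regular_chi: "regular s (chi i \<alpha>)"
  using regular_poisson_seq[OF regular_W] unfolding phi_W chi_W by blast+

end

section \<open>The Galerkin problem\<close>

text \<open>The sum norm fits bounds on the partial derivatives without any constants depending on the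
  dimension.\<close>
definition norm1 :: "'a::euclidean_space \<Rightarrow> real" where
  "norm1 z = (\<Sum>b\<in>Basis. \<bar>z \<bullet> b\<bar>)"

lemma norm1_nonneg: "0 \<le> norm1 z"
  by (simp add: norm1_def sum_nonneg)

lemma norm1_scaleR: "norm1 (c *\<^sub>R z) = \<bar>c\<bar> * norm1 z"
  by (simp add: norm1_def abs_mult sum_distrib_left)

lemma norm1_triangle: "norm1 (y + z) \<le> norm1 y + norm1 z"
  unfolding norm1_def sum.distrib[symmetric] by (intro sum_mono) (simp add: inner_add_left abs_triangle_ineq)

lemma norm1_sum: "norm1 (\<Sum>i\<in>I. f i) \<le> (\<Sum>i\<in>I. norm1 (f i))"
proof (induction I rule: infinite_finite_induct)
  case (insert i I)
  then show ?case using norm1_triangle[of "f i" "\<Sum>i\<in>I. f i"] by simp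
qed (simp_all add: norm1_def)

lemma pdiff_Basis_sum:
  fixes F :: "'e::euclidean_space \<Rightarrow> real"
  assumes "smooth F"
  shows "pdiff w F z = (\<Sum>b\<in>Basis. (w \<bullet> b) * pdiff b F z)"
  by (rule has_derivative_pdiff_Basis_sum[OF smooth_has_derivative[OF assms]])

lemma abs_pdiff_le:
  fixes F :: "'e::euclidean_space \<Rightarrow> real"
  assumes "smooth F" "\<And>b. b \<in> Basis \<Longrightarrow> \<bar>pdiff b F z\<bar> \<le> C"
  shows "\<bar>pdiff w F z\<bar> \<le> C * norm1 w"
proof -
  have "\<bar>pdiff w F z\<bar> \<le> (\<Sum>b\<in>Basis. \<bar>(w \<bullet> b) * pdiff b F z\<bar>)"
    unfolding pdiff_Basis_sum[OF assms(1), of w] by (rule sum_abs)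
  also have "\<dots> \<le> (\<Sum>b\<in>Basis. \<bar>w \<bullet> b\<bar> * C)"
    unfolding abs_mult using assms(2) by (intro sum_mono mult_left_mono) auto
  finally show ?thesis by (simp add: norm1_def sum_distrib_left mult.commute)
qed

lemma smooth_mvt:
  fixes F :: "'e::euclidean_space \<Rightarrow> real"
  assumes "smooth F"
  shows "\<exists>s\<in>{0..1}. F (z + h) - F z = pdiff h F (z + s *\<^sub>R h)"
proof -
  have d: "((\<lambda>s. F (z + s *\<^sub>R h)) has_derivative (\<lambda>r. pdiff (r *\<^sub>R h) F (z + s *\<^sub>R h))) (at s within {0..1})" for s :: real
    by (rule has_derivative_compose[OF _ smooth_has_derivative[OF assms]]) (auto intro!: derivative_eq_intros)
  obtain s where s: "s \<in> {0<..<1}" "F (z + 1 *\<^sub>R h) - F (z + 0 *\<^sub>R h) = pdiff ((1 - 0) *\<^sub>R h) F (z + s *\<^sub>R h)"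
    using mvt_simple[of 0 1 "\<lambda>s. F (z + s *\<^sub>R h)", OF _ d] by auto
  then show ?thesis by (intro bexI[of _ s]) auto
qed

locale bounded_C2 =
  fixes F :: "'e::euclidean_space \<Rightarrow> real" and C :: real
  assumes smooth_F: "smooth F"
    and F0: "\<bar>F z\<bar> \<le> C"
    and F1: "b \<in> Basis \<Longrightarrow> \<bar>pdiff b F z\<bar> \<le> C"
    and F2: "b \<in> Basis \<Longrightarrow> c \<in> Basis \<Longrightarrow> \<bar>pdiff c (pdiff b F) z\<bar> \<le> C"
begin

lemma C_nonneg: "0 \<le> C"
  using F0[of 0] by linarith

lemma Lipschitz_pdiff_Basis:
  assumes "b \<in> Basis"
  shows "\<bar>pdiff b F (z + h) - pdiff b F z\<bar> \<le> C * norm1 h"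
proof -
  obtain s where "pdiff b F (z + h) - pdiff b F z = pdiff h (pdiff b F) (z + s *\<^sub>R h)"
    using smooth_mvt[OF smooth_pdiff[OF smooth_F]] by blast
  then show ?thesis using abs_pdiff_le[OF smooth_pdiff[OF smooth_F] F2[OF assms]] by metis
qed

lemma Lipschitz_pdiff: "\<bar>pdiff w F (z + h) - pdiff w F z\<bar> \<le> C * norm1 w * norm1 h"
proof -
  have "pdiff w F (z + h) - pdiff w F z = (\<Sum>b\<in>Basis. (w \<bullet> b) * (pdiff b F (z + h) - pdiff b F z))"
    unfolding pdiff_Basis_sum[OF smooth_F, of w] by (simp add: right_diff_distrib sum_subtractf)
  also have "\<bar>\<dots>\<bar> \<le> (\<Sum>b\<in>Basis. \<bar>(w \<bullet> b) * (pdiff b F (z + h) - pdiff b F z)\<bar>)" by (rule sum_abs)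
  also have "\<dots> \<le> (\<Sum>b\<in>Basis. \<bar>w \<bullet> b\<bar> * (C * norm1 h))"
    unfolding abs_mult by (intro sum_mono mult_left_mono Lipschitz_pdiff_Basis) auto
  finally show ?thesis by (simp add: norm1_def sum_distrib_right sum_distrib_left mult_ac)
qed

lemma Taylor: "\<bar>F (z + h) - F z - pdiff h F z\<bar> \<le> C * (norm1 h)\<^sup>2"
proof -
  obtain s where s: "s \<in> {0..1}" "F (z + h) - F z = pdiff h F (z + s *\<^sub>R h)"
    using smooth_mvt[OF smooth_F] by blast
  have "\<bar>pdiff h F (z + s *\<^sub>R h) - pdiff h F z\<bar> \<le> C * norm1 h * norm1 (s *\<^sub>R h)" by (rule Lipschitz_pdiff)
  also have "\<dots> \<le> C * norm1 h * norm1 h"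
    using s C_nonneg norm1_nonneg[of h] by (intro mult_left_mono) (auto simp: norm1_scaleR mult_left_le_one_le)
  finally show ?thesis using s by (simp add: power2_eq_square mult.assoc)
qed

text \<open>The saddle lemma applied to \<open>g x = - mean (F \<circ> Y x)\<close>, where \<open>Y x\<close> is the affine combination
  of \<open>y0\<close> and the \<open>v i\<close> with coefficients \<open>x\<close>. The \<open>C\<^sup>2\<close>-bounds on \<open>F\<close> are inherited by \<open>g\<close>, as
  taking means does not increase them.\<close>
lemma critical_point_of_mean:
  fixes y0 :: "real ^ 3 \<Rightarrow> 'e" and v :: "'i \<Rightarrow> real ^ 3 \<Rightarrow> 'e" and \<kappa> :: "'i \<Rightarrow> real"
  assumes fin: "finite I" and y0: "continuous_on UNIV y0"
    and v: "\<And>i. i \<in> I \<Longrightarrow> continuous_on UNIV (v i)" and V: "\<And>i t. i \<in> I \<Longrightarrow> norm1 (v i t) \<le> V"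
    and per: "\<And>m t z. (\<And>j. m j \<in> \<int>) \<Longrightarrow> (\<And>j. \<kappa> j \<noteq> 0 \<Longrightarrow> m j = 0) \<Longrightarrow>
      (\<And>w. pdiff w F (z + (\<Sum>i\<in>I. m i *\<^sub>R v i t)) = pdiff w F z)"
  shows "\<exists>x. (\<forall>i\<in>I. \<kappa> i * x i = mean (\<lambda>t. pdiff (v i t) F (y0 t + (\<Sum>i\<in>I. x i *\<^sub>R v i t)))) \<and>
    (\<forall>i\<in>I. \<kappa> i = 0 \<longrightarrow> 0 \<le> x i \<and> x i \<le> 1)"
proof -
  define Y where "Y = (\<lambda>x t. y0 t + (\<Sum>i\<in>I. x i *\<^sub>R v i t))"
  define g where "g = (\<lambda>x. - mean (\<lambda>t. F (Y x t)))"
  define D where "D = (\<lambda>x i. - mean (\<lambda>t. pdiff (v i t) F (Y x t)))"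
  define W where "W = max V 0"
  have W: "norm1 (v i t) \<le> W" "0 \<le> W" if "i \<in> I" for i t using V[OF that, of t] by (auto simp: W_def)
  have W0: "0 \<le> W" by (simp add: W_def)
  have cY: "continuous_on UNIV (Y x)" for x
    unfolding Y_def by (intro continuous_on_add continuous_on_sum continuous_on_scaleR continuous_on_const y0 v)
  have cF: "continuous_on UNIV (\<lambda>t. F (Y x t))" for x
    by (rule continuous_on_compose2[OF smooth_continuous[OF smooth_F] cY subset_UNIV])
  have cD: "continuous_on UNIV (\<lambda>t. pdiff (v i t) F (Y x t))" if "i \<in> I" for i x
  proof -
    have eq: "(\<lambda>t. pdiff (v i t) F (Y x t)) = (\<lambda>t. \<Sum>b\<in>Basis. (v i t \<bullet> b) * pdiff b F (Y x t))"
      by (rule ext) (rule pdiff_Basis_sum[OF smooth_F])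
    show ?thesis
      unfolding eq
      by (intro continuous_on_sum continuous_on_mult continuous_on_inner continuous_on_const v that
        continuous_on_compose2[OF smooth_continuous[OF smooth_pdiff[OF smooth_F]] cY subset_UNIV])
  qed
  have Ydiff: "Y y t = Y x t + (\<Sum>i\<in>I. (y i - x i) *\<^sub>R v i t)" for x y t
    by (simp add: Y_def scaleR_diff_left sum_subtractf)
  have n1: "norm1 (\<Sum>i\<in>I. h i *\<^sub>R v i t) \<le> W * (\<Sum>i\<in>I. \<bar>h i\<bar>)" for h t
  proof -
    have "norm1 (\<Sum>i\<in>I. h i *\<^sub>R v i t) \<le> (\<Sum>i\<in>I. norm1 (h i *\<^sub>R v i t))" by (rule norm1_sum)
    also have "\<dots> \<le> (\<Sum>i\<in>I. \<bar>h i\<bar> * W)"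
      unfolding norm1_scaleR using W by (intro sum_mono mult_left_mono) auto
    finally show ?thesis by (simp add: sum_distrib_left mult.commute)
  qed
  \<comment> \<open>The factor \<open>1\<close> serves the Lipschitz bound in the sum norm, and \<open>card I\<close> the Taylor bound,
    where the square of the sum norm is compared with the sum of squares.\<close>
  define L where "L = C * W\<^sup>2 * (1 + real (card I))"
  have CW: "0 \<le> C * W\<^sup>2" using C_nonneg by simp
  have "\<exists>x. (\<forall>i\<in>I. \<kappa> i * x i + D x i = 0) \<and> (\<forall>i\<in>I. \<kappa> i = 0 \<longrightarrow> 0 \<le> x i \<and> x i \<le> 1)"
  proof (rule saddle_critical_point[OF fin, where g = g and C = "C + C * W" and L = L])
    show "0 \<le> L" using CW by (simp add: L_def)
    show "\<bar>g x\<bar> \<le> C + C * W" for x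
    proof -
      have "\<bar>g x\<bar> \<le> C" unfolding g_def abs_minus_cancel by (rule mean_abs_le[OF cF F0])
      then show ?thesis using C_nonneg W0 by (simp add: add_increasing2)
    qed
    show "\<bar>D x i\<bar> \<le> C + C * W" if i: "i \<in> I" for x i
    proof -
      have "\<bar>D x i\<bar> \<le> C * W"
        unfolding D_def abs_minus_cancel
      proof (rule mean_abs_le[OF cD[OF i]])
        fix t
        have "\<bar>pdiff (v i t) F (Y x t)\<bar> \<le> C * norm1 (v i t)" by (rule abs_pdiff_le[OF smooth_F F1])
        also have "\<dots> \<le> C * W" using C_nonneg W[OF i] by (intro mult_left_mono) auto
        finally show "\<bar>pdiff (v i t) F (Y x t)\<bar> \<le> C * W" .
      qed
      then show ?thesis using C_nonneg by simp
    qed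
    show "\<bar>D x i - D y i\<bar> \<le> L * (\<Sum>j\<in>I. \<bar>x j - y j\<bar>)" if i: "i \<in> I" for x y i
    proof -
      define s where "s = (\<Sum>j\<in>I. \<bar>x j - y j\<bar>)"
      have s0: "0 \<le> s" by (simp add: s_def sum_nonneg)
      have "D x i - D y i = - mean (\<lambda>t. pdiff (v i t) F (Y x t) - pdiff (v i t) F (Y y t))"
        unfolding D_def by (subst mean_diff[OF cD[OF i] cD[OF i]]) simp
      also have "\<bar>\<dots>\<bar> \<le> C * W\<^sup>2 * s"
        unfolding abs_minus_cancel
      proof (rule mean_abs_le[OF continuous_on_diff[OF cD[OF i] cD[OF i]]])
        fix t
        let ?h = "\<Sum>j\<in>I. (x j - y j) *\<^sub>R v j t"
        have "\<bar>pdiff (v i t) F (Y x t) - pdiff (v i t) F (Y y t)\<bar> \<le> C * norm1 (v i t) * norm1 ?h"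
          unfolding Ydiff[of x t y] by (rule Lipschitz_pdiff)
        also have "\<dots> \<le> C * W * (W * s)"
          using C_nonneg W[OF i] n1[of "\<lambda>j. x j - y j" t] norm1_nonneg W0
          by (intro mult_mono mult_nonneg_nonneg) (auto simp: s_def)
        finally show "\<bar>pdiff (v i t) F (Y x t) - pdiff (v i t) F (Y y t)\<bar> \<le> C * W\<^sup>2 * s"
          by (simp add: power2_eq_square mult_ac)
      qed
      also have "C * W\<^sup>2 * s \<le> L * s"
      proof (rule mult_right_mono[OF _ s0])
        have "C * W\<^sup>2 * 1 \<le> L" unfolding L_def by (rule mult_left_mono[OF _ CW]) simp
        then show "C * W\<^sup>2 \<le> L" by simp
      qed
      finally show ?thesis by (simp add: s_def)
    qed
    show "\<bar>g y - g x - (\<Sum>i\<in>I. D x i * (y i - x i))\<bar> \<le> L * (\<Sum>i\<in>I. (y i - x i)\<^sup>2)" for x y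
    proof -
      let ?h = "\<lambda>t. \<Sum>j\<in>I. (y j - x j) *\<^sub>R v j t"
      have lin: "pdiff (?h t) F (Y x t) = (\<Sum>i\<in>I. pdiff (v i t) F (Y x t) * (y i - x i))" for t
      proof -
        note l = pdiff_linear[OF smooth_F, of "Y x t"]
        show ?thesis by (simp add: linear_sum[OF l] linear_scale[OF l] mult.commute)
      qed
      have cs: "continuous_on UNIV (\<lambda>t. \<Sum>i\<in>I. pdiff (v i t) F (Y x t) * (y i - x i))"
        by (intro continuous_on_sum continuous_on_mult continuous_on_const cD)
      have "(\<Sum>i\<in>I. D x i * (y i - x i)) = - mean (\<lambda>t. \<Sum>i\<in>I. pdiff (v i t) F (Y x t) * (y i - x i))"
        unfolding D_def
        by (subst mean_sum)
           (auto simp: mean_cmult_right sum_negf intro!: continuous_on_mult continuous_on_const cD)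
      then have "g y - g x - (\<Sum>i\<in>I. D x i * (y i - x i)) =
          - mean (\<lambda>t. F (Y y t) - F (Y x t) - (\<Sum>i\<in>I. pdiff (v i t) F (Y x t) * (y i - x i)))"
        unfolding g_def mean_diff[OF continuous_on_diff[OF cF cF] cs] mean_diff[OF cF cF] by simp
      also have "\<bar>\<dots>\<bar> \<le> C * W\<^sup>2 * (real (card I) * (\<Sum>i\<in>I. (y i - x i)\<^sup>2))"
        unfolding abs_minus_cancel
      proof (rule mean_abs_le[OF continuous_on_diff[OF continuous_on_diff[OF cF cF] cs]])
        fix t
        have "\<bar>F (Y y t) - F (Y x t) - (\<Sum>i\<in>I. pdiff (v i t) F (Y x t) * (y i - x i))\<bar> \<le> C * (norm1 (?h t))\<^sup>2"
          unfolding lin[symmetric] Ydiff[of y t x] by (rule Taylor)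
        also have "\<dots> \<le> C * (W * (\<Sum>i\<in>I. \<bar>y i - x i\<bar>))\<^sup>2"
          using C_nonneg n1[of "\<lambda>j. y j - x j" t] norm1_nonneg by (intro mult_left_mono power_mono) auto
        also have "\<dots> = C * W\<^sup>2 * (\<Sum>i\<in>I. \<bar>y i - x i\<bar>)\<^sup>2" by (simp add: power_mult_distrib)
        also have "\<dots> \<le> C * W\<^sup>2 * (real (card I) * (\<Sum>i\<in>I. (y i - x i)\<^sup>2))"
          using Cauchy_Schwarz_ineq_sum[of "\<lambda>_. 1" "\<lambda>i. \<bar>y i - x i\<bar>" I] CW by (intro mult_left_mono) auto
        finally show "\<bar>F (Y y t) - F (Y x t) - (\<Sum>i\<in>I. pdiff (v i t) F (Y x t) * (y i - x i))\<bar>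
            \<le> C * W\<^sup>2 * (real (card I) * (\<Sum>i\<in>I. (y i - x i)\<^sup>2))" .
      qed
      also have "\<dots> \<le> L * (\<Sum>i\<in>I. (y i - x i)\<^sup>2)"
        unfolding L_def mult.assoc[symmetric] using CW
        by (intro mult_right_mono mult_left_mono) (auto intro: sum_nonneg)
      finally show ?thesis .
    qed
    show "D (\<lambda>j. x j + m j) i = D x i"
      if "i \<in> I" "\<And>j. m j \<in> \<int>" "\<And>j. \<kappa> j \<noteq> 0 \<Longrightarrow> m j = 0" for x m i
    proof -
      have "Y (\<lambda>j. x j + m j) t = Y x t + (\<Sum>i\<in>I. m i *\<^sub>R v i t)" for t
        using Ydiff[of "\<lambda>j. x j + m j" t x] by simp
      moreover have "pdiff w F (Y x t + (\<Sum>i\<in>I. m i *\<^sub>R v i t)) = pdiff w F (Y x t)" for w t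
        by (rule per) (use that in auto)
      ultimately have "pdiff w F (Y (\<lambda>j. x j + m j) t) = pdiff w F (Y x t)" for w t
        by (simp only:)
      then show ?thesis by (simp add: D_def)
    qed
  qed
  then show ?thesis by (auto simp: D_def Y_def)
qed

end

text \<open>Coordinates for the truncated problem: the mean of \<open>q\<close>, the mean \<open>a\<close> of \<open>p\<close>, and for each
  nonzero frequency two coefficients which diagonalise the quadratic form \<open>\<integral> \<nabla>\<phi> \<cdot> \<nabla>q - \<bar>\<nabla>\<phi>\<bar>\<^sup>2/2\<close>.
  With \<open>\<phi> = u + v\<close> and \<open>q = (3 u - v) / 2\<close> it becomes \<open>\<integral> \<bar>\<nabla>u\<bar>\<^sup>2 - \<bar>\<nabla>v\<bar>\<^sup>2\<close>; the function \<open>u\<close> is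
  expanded in the directions \<open>Mode_plus\<close> and \<open>v\<close> in the directions \<open>Mode_minus\<close>.\<close>
datatype 'd index = Mean_q 'd | Mean_p 3 'd | Mode_plus 'd "int ^ 3" | Mode_minus 'd "int ^ 3"

definition modes :: "nat \<Rightarrow> (int ^ 3) set" where
  "modes n = freq_box n - {0}"

definition indices :: "nat \<Rightarrow> 'd::finite index set" where
  "indices n = range Mean_q \<union> (\<lambda>(i, \<alpha>). Mean_p i \<alpha>) ` UNIV \<union> (\<lambda>(\<alpha>, k). Mode_plus \<alpha> k) ` (UNIV \<times> modes n)
      \<union> (\<lambda>(\<alpha>, k). Mode_minus \<alpha> k) ` (UNIV \<times> modes n)"

lemma finite_modes [simp]: "finite (modes n)"
  by (simp add: modes_def)

lemma finite_indices: "finite (indices n :: 'd::finite index set)"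
  by (simp add: indices_def)

lemma sum_indices:
  fixes f :: "'d::finite index \<Rightarrow> 'b::comm_monoid_add"
  shows "(\<Sum>x\<in>indices n. f x) = (\<Sum>\<alpha>\<in>UNIV. f (Mean_q \<alpha>)) + (\<Sum>i\<in>UNIV. \<Sum>\<alpha>\<in>UNIV. f (Mean_p i \<alpha>))
    + (\<Sum>\<alpha>\<in>UNIV. \<Sum>k\<in>modes n. f (Mode_plus \<alpha> k)) + (\<Sum>\<alpha>\<in>UNIV. \<Sum>k\<in>modes n. f (Mode_minus \<alpha> k))"
proof -
  have "(\<Sum>x\<in>indices n. f x) = sum f (range Mean_q) + sum f ((\<lambda>(i, \<alpha>). Mean_p i \<alpha>) ` UNIV)
    + sum f ((\<lambda>(\<alpha>, k). Mode_plus \<alpha> k) ` (UNIV \<times> modes n)) + sum f ((\<lambda>(\<alpha>, k). Mode_minus \<alpha> k) ` (UNIV \<times> modes n))"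
    unfolding indices_def by (subst sum.union_disjoint, (auto)[3])+ simp
  also have "sum f (range Mean_q) = (\<Sum>\<alpha>\<in>UNIV. f (Mean_q \<alpha>))"
    by (subst sum.reindex) (auto simp: inj_on_def)
  also have "sum f ((\<lambda>(i, \<alpha>). Mean_p i \<alpha>) ` UNIV) = (\<Sum>i\<in>UNIV. \<Sum>\<alpha>\<in>UNIV. f (Mean_p i \<alpha>))"
    by (subst sum.reindex) (auto simp: inj_on_def sum.cartesian_product UNIV_Times_UNIV[symmetric] simp del: UNIV_Times_UNIV intro!: sum.cong)
  also have "sum f ((\<lambda>(\<alpha>, k). Mode_plus \<alpha> k) ` (UNIV \<times> modes n)) = (\<Sum>\<alpha>\<in>UNIV. \<Sum>k\<in>modes n. f (Mode_plus \<alpha> k))"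
    by (subst sum.reindex) (auto simp: inj_on_def sum.cartesian_product intro!: sum.cong)
  also have "sum f ((\<lambda>(\<alpha>, k). Mode_minus \<alpha> k) ` (UNIV \<times> modes n)) = (\<Sum>\<alpha>\<in>UNIV. \<Sum>k\<in>modes n. f (Mode_minus \<alpha> k))"
    by (subst sum.reindex) (auto simp: inj_on_def sum.cartesian_product intro!: sum.cong)
  finally show ?thesis .
qed

text \<open>Twice the coefficients of the quadratic form, the term \<open>-\<bar>a\<bar>\<^sup>2/2\<close> included.\<close>
fun signature :: "'d index \<Rightarrow> real" where
  "signature (Mean_q \<alpha>) = 0"
| "signature (Mean_p i \<alpha>) = - 1"
| "signature (Mode_plus \<alpha> k) = 2 * mu k"
| "signature (Mode_minus \<alpha> k) = - 2 * mu k"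

text \<open>The change of \<open>(t, q, p)\<close> when one coordinate increases at unit speed, by \<open>p = a + \<nabla>\<phi>\<close> and
  the expressions for \<open>\<phi>\<close> and \<open>q\<close> in terms of \<open>u\<close> and \<open>v\<close>.\<close>
fun direction :: "'d::finite index \<Rightarrow> real ^ 3 \<Rightarrow> 'd cover" where
  "direction (Mean_q \<alpha>) t = unit_q \<alpha>"
| "direction (Mean_p i \<alpha>) t = unit_p i \<alpha>"
| "direction (Mode_plus \<alpha> k) t = (3/2 * hartley k t) *\<^sub>R unit_q \<alpha> + (\<Sum>i\<in>UNIV. \<delta> i (hartley k) t *\<^sub>R unit_p i \<alpha>)"
| "direction (Mode_minus \<alpha> k) t = (- 1/2 * hartley k t) *\<^sub>R unit_q \<alpha> + (\<Sum>i\<in>UNIV. \<delta> i (hartley k) t *\<^sub>R unit_p i \<alpha>)"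

lemma direction_components:
  "fst (direction j t) = 0"
  "fst (snd (direction (Mean_q \<alpha>) t)) $ \<beta> = (if \<alpha> = \<beta> then 1 else 0)"
  "fst (snd (direction (Mean_p i \<alpha>) t)) $ \<beta> = 0"
  "fst (snd (direction (Mode_plus \<alpha> k) t)) $ \<beta> = (if \<alpha> = \<beta> then 3/2 * hartley k t else 0)"
  "fst (snd (direction (Mode_minus \<alpha> k) t)) $ \<beta> = (if \<alpha> = \<beta> then - 1/2 * hartley k t else 0)"
  "snd (snd (direction (Mean_q \<alpha>) t)) $ l $ \<beta> = 0"
  "snd (snd (direction (Mean_p i \<alpha>) t)) $ l $ \<beta> = (if \<alpha> = \<beta> then if i = l then 1 else 0 else 0)"
  "snd (snd (direction (Mode_plus \<alpha> k) t)) $ l $ \<beta> = (if \<alpha> = \<beta> then \<delta> l (hartley k) t else 0)"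
  "snd (snd (direction (Mode_minus \<alpha> k) t)) $ l $ \<beta> = (if \<alpha> = \<beta> then \<delta> l (hartley k) t else 0)"
proof -
  have *: "(\<Sum>i\<in>UNIV. \<delta> i (hartley k) t * (axis i (axis \<alpha> 1) $ l $ \<beta>)) = (if \<alpha> = \<beta> then \<delta> l (hartley k) t else 0)" for \<alpha> k
    by (simp add: axis_def if_distrib[of "\<lambda>x. x $ _"] if_distrib[of "\<lambda>x. _ * x"] cong: if_cong)
  show "fst (direction j t) = 0" by (cases j) (simp_all add: fst_sum)
  show "fst (snd (direction (Mean_q \<alpha>) t)) $ \<beta> = (if \<alpha> = \<beta> then 1 else 0)"
    "fst (snd (direction (Mean_p i \<alpha>) t)) $ \<beta> = 0"
    "fst (snd (direction (Mode_plus \<alpha> k) t)) $ \<beta> = (if \<alpha> = \<beta> then 3/2 * hartley k t else 0)"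
    "fst (snd (direction (Mode_minus \<alpha> k) t)) $ \<beta> = (if \<alpha> = \<beta> then - 1/2 * hartley k t else 0)"
    "snd (snd (direction (Mean_q \<alpha>) t)) $ l $ \<beta> = 0"
    "snd (snd (direction (Mean_p i \<alpha>) t)) $ l $ \<beta> = (if \<alpha> = \<beta> then if i = l then 1 else 0 else 0)"
    by (simp_all add: axis_def fst_sum snd_sum)
  show "snd (snd (direction (Mode_plus \<alpha> k) t)) $ l $ \<beta> = (if \<alpha> = \<beta> then \<delta> l (hartley k) t else 0)"
    "snd (snd (direction (Mode_minus \<alpha> k) t)) $ l $ \<beta> = (if \<alpha> = \<beta> then \<delta> l (hartley k) t else 0)"
    using * by (simp_all add: fst_sum snd_sum)
qed

lemma continuous_deriv_hartley: "continuous_on UNIV (\<delta> i (hartley k))"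
  by (intro smooth_periodicD(3) smooth_periodic_pdiff smooth_periodic_hartley)

lemma continuous_direction: "continuous_on UNIV (direction j)"
proof (cases j)
  case (Mean_q \<alpha>)
  then have "direction j = (\<lambda>t. unit_q \<alpha>)" by (auto intro!: ext)
  then show ?thesis by simp
next
  case (Mean_p i \<alpha>)
  then have "direction j = (\<lambda>t. unit_p i \<alpha>)" by (auto intro!: ext)
  then show ?thesis by simp
next
  case (Mode_plus \<alpha> k)
  then have "direction j = (\<lambda>t. (3/2 * hartley k t) *\<^sub>R unit_q \<alpha> + (\<Sum>i\<in>UNIV. \<delta> i (hartley k) t *\<^sub>R unit_p i \<alpha>))" by (auto intro!: ext)
  then show ?thesis
    by (simp only:) (intro continuous_on_add continuous_on_sum continuous_on_scaleR continuous_on_mult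
      continuous_on_const continuous_deriv_hartley smooth_periodicD(3)[OF smooth_periodic_hartley])
next
  case (Mode_minus \<alpha> k)
  then have "direction j = (\<lambda>t. (- 1/2 * hartley k t) *\<^sub>R unit_q \<alpha> + (\<Sum>i\<in>UNIV. \<delta> i (hartley k) t *\<^sub>R unit_p i \<alpha>))" by (auto intro!: ext)
  then show ?thesis
    by (simp only:) (intro continuous_on_add continuous_on_sum continuous_on_scaleR continuous_on_mult
      continuous_on_const continuous_deriv_hartley smooth_periodicD(3)[OF smooth_periodic_hartley])
qed

lemma norm1_Basis: "b \<in> Basis \<Longrightarrow> norm1 b = 1"
  unfolding norm1_def by (subst sum.cong[OF refl, of _ _ "\<lambda>c. if c = b then 1 else 0"]) (auto simp: inner_Basis)

lemma bounded_direction: "\<exists>K. \<forall>t. norm1 (direction j t) \<le> K"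
proof -
  have *: "norm1 ((c * hartley k t) *\<^sub>R unit_q \<alpha> + (\<Sum>i\<in>UNIV. \<delta> i (hartley k) t *\<^sub>R unit_p i \<alpha>))
      \<le> \<bar>c\<bar> * 8 + (\<Sum>i\<in>UNIV. \<bar>2 * pi * of_int (k $ i)\<bar> * 8)" for c k t \<alpha>
  proof -
    have "norm1 ((c * hartley k t) *\<^sub>R unit_q \<alpha> + (\<Sum>i\<in>UNIV. \<delta> i (hartley k) t *\<^sub>R unit_p i \<alpha>))
      \<le> norm1 ((c * hartley k t) *\<^sub>R unit_q \<alpha>) + (\<Sum>i\<in>UNIV. norm1 (\<delta> i (hartley k) t *\<^sub>R unit_p i \<alpha>))"
      by (rule order_trans[OF norm1_triangle add_left_mono[OF norm1_sum]])
    also have "\<dots> = \<bar>c\<bar> * \<bar>hartley k t\<bar> + (\<Sum>i\<in>UNIV. \<bar>2 * pi * of_int (k $ i)\<bar> * \<bar>hartley (flip i k) t\<bar>)"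
      unfolding norm1_scaleR norm1_Basis[OF cover_Basis(2)] norm1_Basis[OF cover_Basis(3)] pdiff_hartley abs_mult by simp
    also have "\<dots> \<le> \<bar>c\<bar> * 8 + (\<Sum>i\<in>UNIV. \<bar>2 * pi * of_int (k $ i)\<bar> * 8)"
      by (intro add_mono sum_mono mult_left_mono abs_hartley_le) auto
    finally show ?thesis .
  qed
  show ?thesis
  proof (cases j)
    case (Mean_q \<alpha>)
    then show ?thesis unfolding Mean_q direction.simps norm1_Basis[OF cover_Basis(2)] by blast
  next
    case (Mean_p i \<alpha>)
    then show ?thesis unfolding Mean_p direction.simps norm1_Basis[OF cover_Basis(3)] by blast
  next
    case (Mode_plus \<alpha> k)
    show ?thesis unfolding Mode_plus direction.simps using *[of "3/2" k] by blast
  next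
    case (Mode_minus \<alpha> k)
    show ?thesis unfolding Mode_minus direction.simps using *[of "- 1/2" k] by blast
  qed
qed

text \<open>The pairing of \<open>\<partial>p F\<close> along \<open>Y\<close> with the gradient of a basis function; by parts, this is the
  coefficient of \<open>- div (\<partial>p F)\<close>.\<close>
definition gradient_coef :: "('d::finite cover \<Rightarrow> real) \<Rightarrow> (real ^ 3 \<Rightarrow> 'd cover) \<Rightarrow> 'd \<Rightarrow> int ^ 3 \<Rightarrow> real" where
  "gradient_coef F Y \<alpha> k = (\<Sum>i\<in>UNIV. mean (\<lambda>t. pdiff (unit_p i \<alpha>) F (Y t) * \<delta> i (hartley k) t))"

lemma trig_poly_dcoef: "trig_poly n (dcoef i c) t = (\<Sum>k\<in>freq_box n. c k * \<delta> i (hartley k) t)"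
proof -
  have s: "smooth (hartley k)" for k using smooth_periodicD(1)[OF smooth_periodic_hartley] .
  have "trig_poly n c = (\<lambda>t. \<Sum>k\<in>freq_box n. c k * hartley k t)" by (rule ext) (simp add: trig_poly_def)
  then have "\<delta> i (trig_poly n c) t = \<delta> i (\<lambda>t. \<Sum>k\<in>freq_box n. c k * hartley k t) t" by simp
  also have "\<dots> = (\<Sum>k\<in>freq_box n. \<delta> i (\<lambda>t. c k * hartley k t) t)"
    by (subst pdiff_sum) (auto intro: smooth_mult smooth_const s)
  also have "\<dots> = (\<Sum>k\<in>freq_box n. c k * \<delta> i (hartley k) t)" by (simp add: pdiff_cmult s)
  finally show ?thesis by (simp add: pdiff_trig_poly)
qed

lemma poisson_sum: "poisson n G t = (\<Sum>k\<in>modes n. coef G k / mu k * hartley k t)"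
  unfolding poisson_def trig_poly_def modes_def by (rule sum.mono_neutral_cong_right) auto

lemma pdiff_poisson_sum: "\<delta> i (poisson n G) t = (\<Sum>k\<in>modes n. coef G k / mu k * \<delta> i (hartley k) t)"
  unfolding poisson_def pdiff_trig_poly trig_poly_dcoef modes_def by (rule sum.mono_neutral_cong_right) auto

lemma divergence_poisson_sum:
  "(\<Sum>i\<in>UNIV. - 1 * \<delta> i (poisson n (\<lambda>t. pdiff (unit_p i \<alpha>) F (Y t))) t)
    = (\<Sum>k\<in>modes n. gradient_coef F Y \<alpha> k / mu k * hartley k t)"
proof -
  have "(\<Sum>i\<in>UNIV. - 1 * \<delta> i (poisson n (\<lambda>t. pdiff (unit_p i \<alpha>) F (Y t))) t) =
    (\<Sum>i\<in>UNIV. \<Sum>k\<in>modes n. mean (\<lambda>t. pdiff (unit_p i \<alpha>) F (Y t) * \<delta> i (hartley k) t) / mu k * hartley k t)"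
  proof (rule sum.cong[OF refl])
    fix i :: 3
    let ?G = "\<lambda>t. pdiff (unit_p i \<alpha>) F (Y t)"
    have c: "- 1 * dcoef i (\<lambda>k. if k = 0 then 0 else coef ?G k / mu k) k = mean (\<lambda>t. ?G t * \<delta> i (hartley k) t) / mu k"
      if "k \<noteq> 0" for k
    proof -
      have "mean (\<lambda>t. ?G t * \<delta> i (hartley k) t) = 2 * pi * of_int (k $ i) * coef ?G (flip i k)"
        unfolding pdiff_hartley coef_def mean_cmult[symmetric] by (simp add: mult_ac)
      then show ?thesis using that by (simp add: dcoef_def)
    qed
    have "- 1 * \<delta> i (poisson n ?G) t = (\<Sum>k\<in>freq_box n. (- 1 * dcoef i (\<lambda>k. if k = 0 then 0 else coef ?G k / mu k) k) * hartley k t)"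
      unfolding poisson_def pdiff_trig_poly trig_poly_def by (simp add: sum_negf)
    also have "\<dots> = (\<Sum>k\<in>modes n. (- 1 * dcoef i (\<lambda>k. if k = 0 then 0 else coef ?G k / mu k) k) * hartley k t)"
      unfolding modes_def by (rule sum.mono_neutral_right) (auto simp: dcoef_def)
    also have "\<dots> = (\<Sum>k\<in>modes n. mean (\<lambda>t. ?G t * \<delta> i (hartley k) t) / mu k * hartley k t)"
    proof (rule sum.cong[OF refl])
      fix k assume "k \<in> modes n"
      then have "k \<noteq> 0" by (simp add: modes_def)
      then show "(- 1 * dcoef i (\<lambda>k. if k = 0 then 0 else coef ?G k / mu k) k) * hartley k t
          = mean (\<lambda>t. ?G t * \<delta> i (hartley k) t) / mu k * hartley k t" by (rule arg_cong[OF c, of _ "\<lambda>y. y * hartley k t"])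
    qed
    finally show "- 1 * \<delta> i (poisson n ?G) t = (\<Sum>k\<in>modes n. mean (\<lambda>t. ?G t * \<delta> i (hartley k) t) / mu k * hartley k t)" .
  qed
  also have "\<dots> = (\<Sum>k\<in>modes n. \<Sum>i\<in>UNIV. mean (\<lambda>t. pdiff (unit_p i \<alpha>) F (Y t) * \<delta> i (hartley k) t) / mu k * hartley k t)"
    by (rule sum.swap)
  finally show ?thesis by (simp add: gradient_coef_def sum_divide_distrib sum_distrib_right)
qed

text \<open>The truncated equations, solved for \<open>\<phi>\<close> and \<open>\<chi>\<close>, together with the conditions that their
  right-hand sides \<open>\<partial>q F\<close> and \<open>\<partial>p F + a\<close> have mean zero. The mean \<open>q0\<close> of \<open>q\<close> is normalised by
  periodicity, for otherwise a sequence of solutions need not stay bounded.\<close>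
definition Galerkin :: "('d::finite cover \<Rightarrow> real) \<Rightarrow> nat \<Rightarrow> real ^ 'd \<Rightarrow> real ^ 'd ^ 3 \<Rightarrow> (real ^ 3 \<Rightarrow> 'd cover) \<Rightarrow> bool" where
  "Galerkin F n q0 a Y \<longleftrightarrow> (\<forall>\<alpha>. \<bar>q0 $ \<alpha>\<bar> \<le> 1) \<and>
    (\<forall>t. Y t = (t,
        \<chi> \<alpha>. q0 $ \<alpha> + (poisson n (\<lambda>t. pdiff (unit_q \<alpha>) F (Y t)) t
          + (\<Sum>i\<in>UNIV. - 1 * \<delta> i (poisson n (\<lambda>t. pdiff (unit_p i \<alpha>) F (Y t))) t)),
        \<chi> i \<alpha>. a $ i $ \<alpha> + \<delta> i (poisson n (\<lambda>t. pdiff (unit_q \<alpha>) F (Y t))) t)) \<and>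
    (\<forall>\<alpha>. mean (\<lambda>t. pdiff (unit_q \<alpha>) F (Y t)) = 0) \<and>
    (\<forall>i \<alpha>. a $ i $ \<alpha> = - mean (\<lambda>t. pdiff (unit_p i \<alpha>) F (Y t)))"

text \<open>A critical point in the coordinates \<open>index\<close>: criticality in the means gives the two
  conditions on mean values, and criticality in the pair of directions for a frequency \<open>k\<close>
  determines the coefficients of \<open>\<phi>\<close> and of \<open>q\<close>, namely those of \<open>(-\<Delta>)\<^sup>-\<^sup>1 \<partial>q F\<close> and of
  \<open>(-\<Delta>)\<^sup>-\<^sup>1 (\<partial>q F - div (\<partial>p F))\<close>.\<close>
lemma Galerkin_solution:
  fixes F :: "'d::finite cover \<Rightarrow> real"
  assumes b: "bounded_C2 F C" and admissible: "admissible F"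
  shows "\<exists>q0 a Y. Galerkin F n q0 a Y"
proof -
  interpret bounded_C2 F C by (rule b)
  let ?I = "indices n :: 'd index set"
  have c0: "continuous_on UNIV (\<lambda>t. (t, 0, 0) :: 'd cover)"
    by (intro continuous_on_Pair continuous_on_id continuous_on_const)
  obtain K :: "'d index \<Rightarrow> real" where K: "\<And>j t. norm1 (direction j t) \<le> K j" using bounded_direction by metis
  define KK where "KK = (\<Sum>j\<in>?I. \<bar>K j\<bar>)"
  have KK: "norm1 (direction j t) \<le> KK" if "j \<in> ?I" for j t
  proof -
    have "norm1 (direction j t) \<le> \<bar>K j\<bar>" using K[of j t] by linarith
    also have "\<dots> \<le> KK" unfolding KK_def using that finite_indices by (intro member_le_sum) auto
    finally show ?thesis .
  qed
  \<comment> \<open>The form is degenerate only in the means of \<open>q\<close>, in which \<open>F\<close> is periodic.\<close>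
  have per: "pdiff w F (z + (\<Sum>i\<in>?I. m i *\<^sub>R direction i t)) = pdiff w F z"
    if m: "\<And>j. m j \<in> \<int>" "\<And>j. signature j \<noteq> 0 \<Longrightarrow> m j = 0" for m t z w
  proof -
    have mu0: "mu k \<noteq> 0" if "k \<in> modes n" for k using mu_ge_1[of k] that by (auto simp: modes_def)
    have "m (Mean_p i \<alpha>) = 0" "k \<in> modes n \<Longrightarrow> m (Mode_plus \<alpha> k) = 0" "k \<in> modes n \<Longrightarrow> m (Mode_minus \<alpha> k) = 0" for i \<alpha> k
      using m(2)[of "Mean_p i \<alpha>"] m(2)[of "Mode_plus \<alpha> k"] m(2)[of "Mode_minus \<alpha> k"] mu0[of k] by auto
    then have "(\<Sum>i\<in>?I. m i *\<^sub>R direction i t) = (\<Sum>\<alpha>\<in>UNIV. m (Mean_q \<alpha>) *\<^sub>R unit_q \<alpha>)"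
      unfolding sum_indices by (simp add: zero_prod_def[symmetric])
    also have "\<dots> = (0, \<chi> \<alpha>. m (Mean_q \<alpha>), 0)"
    proof -
      have "(\<Sum>\<alpha>\<in>UNIV. m (Mean_q \<alpha>) *\<^sub>R axis \<alpha> 1) = (\<chi> \<alpha>. m (Mean_q \<alpha>))"
        by (simp add: vec_eq_iff axis_def if_distrib[of "\<lambda>x. _ * x"] cong: if_cong)
      then show ?thesis by (simp add: prod_eq_iff fst_sum snd_sum)
    qed
    also have "\<dots> \<in> lattice" using m(1) by (auto simp: lattice_def)
    finally show ?thesis by (intro admissible_periodic[OF admissible_pdiff[OF admissible]])
  qed
  obtain x where x: "\<And>j. j \<in> ?I \<Longrightarrow> signature j * x j = mean (\<lambda>t. pdiff (direction j t) F ((t, 0, 0) + (\<Sum>i\<in>?I. x i *\<^sub>R direction i t)))"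
    and x01: "\<And>j. j \<in> ?I \<Longrightarrow> signature j = 0 \<Longrightarrow> 0 \<le> x j \<and> x j \<le> 1"
    using critical_point_of_mean[of ?I "\<lambda>t. (t, 0, 0)" direction KK signature, OF finite_indices c0 continuous_direction KK per] by blast
  define Y where "Y = (\<lambda>t. (t, 0, 0) + (\<Sum>i\<in>?I. x i *\<^sub>R direction i t))"
  have x': "signature j * x j = mean (\<lambda>t. pdiff (direction j t) F (Y t))" if "j \<in> ?I" for j
    unfolding Y_def by (rule x[OF that])
  have in_I: "Mean_q \<alpha> \<in> ?I" "Mean_p i \<alpha> \<in> ?I" "k \<in> modes n \<Longrightarrow> Mode_plus \<alpha> k \<in> ?I" "k \<in> modes n \<Longrightarrow> Mode_minus \<alpha> k \<in> ?I" for \<alpha> i k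
    by (auto simp: indices_def)
  have cY: "continuous_on UNIV Y"
    unfolding Y_def by (intro continuous_on_add continuous_on_sum continuous_on_scaleR continuous_on_const c0 continuous_direction)
  have cF: "continuous_on UNIV (\<lambda>t. pdiff w F (Y t))" for w
    by (rule continuous_on_compose2[OF smooth_continuous[OF smooth_pdiff[OF smooth_F]] cY subset_UNIV])
  have ch: "continuous_on UNIV (hartley k)" for k by (rule smooth_periodicD(3)[OF smooth_periodic_hartley])
  have lin: "pdiff ((c * hartley k t) *\<^sub>R unit_q \<alpha> + (\<Sum>i\<in>UNIV. \<delta> i (hartley k) t *\<^sub>R unit_p i \<alpha>)) F z =
      c * (pdiff (unit_q \<alpha>) F z * hartley k t) + (\<Sum>i\<in>UNIV. pdiff (unit_p i \<alpha>) F z * \<delta> i (hartley k) t)" for c k t \<alpha> z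
  proof -
    note l = pdiff_linear[OF smooth_F, of z]
    show ?thesis by (simp add: linear_add[OF l] linear_scale[OF l] linear_sum[OF l] mult_ac del: scaleR_Pair)
  qed
  have mlin: "mean (\<lambda>t. c * (pdiff (unit_q \<alpha>) F (Y t) * hartley k t) + (\<Sum>i\<in>UNIV. pdiff (unit_p i \<alpha>) F (Y t) * \<delta> i (hartley k) t))
      = c * coef (\<lambda>t. pdiff (unit_q \<alpha>) F (Y t)) k + gradient_coef F Y \<alpha> k" for c \<alpha> k
    unfolding gradient_coef_def coef_def mean_cmult[symmetric]
    by (subst mean_add, (intro continuous_on_mult continuous_on_const continuous_on_sum cF ch continuous_deriv_hartley)+,
        subst mean_sum, (intro continuous_on_mult continuous_on_const continuous_on_sum cF ch continuous_deriv_hartley)+, simp)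
  have xQ: "mean (\<lambda>t. pdiff (unit_q \<alpha>) F (Y t)) = 0" for \<alpha> using x[OF in_I(1)[of \<alpha>]] by (simp add: Y_def)
  have xA: "x (Mean_p i \<alpha>) = - mean (\<lambda>t. pdiff (unit_p i \<alpha>) F (Y t))" for i \<alpha> using x[OF in_I(2)[of i \<alpha>]] by (simp add: Y_def)
  have xU: "2 * mu k * x (Mode_plus \<alpha> k) = 3/2 * coef (\<lambda>t. pdiff (unit_q \<alpha>) F (Y t)) k + gradient_coef F Y \<alpha> k"
    if "k \<in> modes n" for \<alpha> k
    using x'[OF in_I(3)[OF that, of \<alpha>]] unfolding signature.simps direction.simps lin mlin[symmetric] .
  have xV: "- 2 * mu k * x (Mode_minus \<alpha> k) = - 1/2 * coef (\<lambda>t. pdiff (unit_q \<alpha>) F (Y t)) k + gradient_coef F Y \<alpha> k"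
    if "k \<in> modes n" for \<alpha> k
    using x'[OF in_I(4)[OF that, of \<alpha>]] unfolding signature.simps direction.simps lin mlin[symmetric] .
  \<comment> \<open>The coefficients of \<open>q\<close> and of \<open>\<phi>\<close>, from those of \<open>u\<close> and \<open>v\<close>.\<close>
  have sums: "3/2 * x (Mode_plus \<alpha> k) - 1/2 * x (Mode_minus \<alpha> k) = coef (\<lambda>t. pdiff (unit_q \<alpha>) F (Y t)) k / mu k + gradient_coef F Y \<alpha> k / mu k"
      "x (Mode_plus \<alpha> k) + x (Mode_minus \<alpha> k) = coef (\<lambda>t. pdiff (unit_q \<alpha>) F (Y t)) k / mu k"
    if "k \<in> modes n" for \<alpha> k
  proof -
    have m: "mu k > 0" using mu_ge_1[of k] that by (auto simp: modes_def)
    show "3/2 * x (Mode_plus \<alpha> k) - 1/2 * x (Mode_minus \<alpha> k) = coef (\<lambda>t. pdiff (unit_q \<alpha>) F (Y t)) k / mu k + gradient_coef F Y \<alpha> k / mu k"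
      "x (Mode_plus \<alpha> k) + x (Mode_minus \<alpha> k) = coef (\<lambda>t. pdiff (unit_q \<alpha>) F (Y t)) k / mu k"
      using xU[OF that, of \<alpha>] xV[OF that, of \<alpha>] m by (simp_all add: field_simps)
  qed
  have Yq: "fst (snd (Y t)) $ \<alpha> = x (Mean_q \<alpha>) + (poisson n (\<lambda>t. pdiff (unit_q \<alpha>) F (Y t)) t
          + (\<Sum>i\<in>UNIV. - 1 * \<delta> i (poisson n (\<lambda>t. pdiff (unit_p i \<alpha>) F (Y t))) t))" for t \<alpha>
  proof -
    have "fst (snd (Y t)) $ \<alpha> = x (Mean_q \<alpha>) + (\<Sum>k\<in>modes n. (3/2 * x (Mode_plus \<alpha> k) - 1/2 * x (Mode_minus \<alpha> k)) * hartley k t)"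
    proof -
      have "fst (snd (Y t)) $ \<alpha> = (\<Sum>j\<in>?I. x j * (fst (snd (direction j t)) $ \<alpha>))"
        unfolding Y_def by (simp add: fst_sum snd_sum)
      also have "\<dots> = x (Mean_q \<alpha>) + (\<Sum>k\<in>modes n. x (Mode_plus \<alpha> k) * (3/2 * hartley k t)) + (\<Sum>k\<in>modes n. x (Mode_minus \<alpha> k) * (- 1/2 * hartley k t))"
        unfolding sum_indices direction_components
        by (simp add: if_distrib[of "\<lambda>y. _ * y"] sum.swap[of _ "modes n" UNIV] cong: if_cong)
      also have "\<dots> = x (Mean_q \<alpha>) + (\<Sum>k\<in>modes n. (3/2 * x (Mode_plus \<alpha> k) - 1/2 * x (Mode_minus \<alpha> k)) * hartley k t)"
        by (simp add: sum.distrib[symmetric] add.assoc) (simp add: algebra_simps)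
      finally show ?thesis .
    qed
    also have "\<dots> = x (Mean_q \<alpha>) + (\<Sum>k\<in>modes n. (coef (\<lambda>t. pdiff (unit_q \<alpha>) F (Y t)) k / mu k + gradient_coef F Y \<alpha> k / mu k) * hartley k t)"
      by (simp only: sums cong: sum.cong)
    finally show ?thesis
      unfolding poisson_sum divergence_poisson_sum by (simp only: distrib_right sum.distrib)
  qed
  have Yp: "snd (snd (Y t)) $ i $ \<alpha> = x (Mean_p i \<alpha>) + \<delta> i (poisson n (\<lambda>t. pdiff (unit_q \<alpha>) F (Y t))) t" for t i \<alpha>
  proof -
    have "snd (snd (Y t)) $ i $ \<alpha> = x (Mean_p i \<alpha>) + (\<Sum>k\<in>modes n. (x (Mode_plus \<alpha> k) + x (Mode_minus \<alpha> k)) * \<delta> i (hartley k) t)"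
    proof -
      have "snd (snd (Y t)) $ i $ \<alpha> = (\<Sum>j\<in>?I. x j * (snd (snd (direction j t)) $ i $ \<alpha>))"
        unfolding Y_def by (simp add: fst_sum snd_sum)
      also have "\<dots> = x (Mean_p i \<alpha>) + (\<Sum>k\<in>modes n. x (Mode_plus \<alpha> k) * \<delta> i (hartley k) t) + (\<Sum>k\<in>modes n. x (Mode_minus \<alpha> k) * \<delta> i (hartley k) t)"
        unfolding sum_indices direction_components
        by (simp add: if_distrib[of "\<lambda>y. _ * y"] sum.swap[of _ "modes n" UNIV] cong: if_cong)
      also have "\<dots> = x (Mean_p i \<alpha>) + (\<Sum>k\<in>modes n. (x (Mode_plus \<alpha> k) + x (Mode_minus \<alpha> k)) * \<delta> i (hartley k) t)"
        by (simp add: sum.distrib distrib_right)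
      finally show ?thesis .
    qed
    also have "\<dots> = x (Mean_p i \<alpha>) + (\<Sum>k\<in>modes n. (coef (\<lambda>t. pdiff (unit_q \<alpha>) F (Y t)) k / mu k) * \<delta> i (hartley k) t)"
      by (simp only: sums cong: sum.cong)
    finally show ?thesis unfolding pdiff_poisson_sum .
  qed
  have Yt: "fst (Y t) = t" for t
    unfolding Y_def by (simp add: fst_sum direction_components)
  show ?thesis
    unfolding Galerkin_def
  proof (intro exI[of _ "\<chi> \<alpha>. x (Mean_q \<alpha>)"] exI[of _ "\<chi> i \<alpha>. x (Mean_p i \<alpha>)"] exI[of _ Y] conjI allI)
    fix \<alpha> i t
    show "\<bar>(\<chi> \<alpha>. x (Mean_q \<alpha>)) $ \<alpha>\<bar> \<le> 1" using x01[OF in_I(1)[of \<alpha>]] by simp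
    show "mean (\<lambda>t. pdiff (unit_q \<alpha>) F (Y t)) = 0" by (rule xQ)
    show "(\<chi> i \<alpha>. x (Mean_p i \<alpha>)) $ i $ \<alpha> = - mean (\<lambda>t. pdiff (unit_p i \<alpha>) F (Y t))" by (simp add: xA)
    show "Y t = (t,
        \<chi> \<alpha>. (\<chi> \<alpha>. x (Mean_q \<alpha>)) $ \<alpha> + (poisson n (\<lambda>t. pdiff (unit_q \<alpha>) F (Y t)) t
          + (\<Sum>i\<in>UNIV. - 1 * \<delta> i (poisson n (\<lambda>t. pdiff (unit_p i \<alpha>) F (Y t))) t)),
        \<chi> i \<alpha>. (\<chi> i \<alpha>. x (Mean_p i \<alpha>)) $ i $ \<alpha> + \<delta> i (poisson n (\<lambda>t. pdiff (unit_q \<alpha>) F (Y t))) t)"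
      by (rule prod_eqI, simp add: Yt, rule prod_eqI, simp_all only: snd_conv fst_conv vec_eq_iff vec_lambda_beta Yq Yp simp_thms)
  qed
qed

section \<open>Passing to the limit\<close>

lemma periodic3_int:
  assumes "periodic3 f" "\<And>i. m $ i \<in> \<int>"
  shows "f (t + m) = f t"
proof -
  have 1: "f (t + of_int k *\<^sub>R axis i 1) = f t" for k :: int and i t
  proof (induction k rule: int_induct[where k = 0])
    case (step1 j)
    have "f (t + of_int j *\<^sub>R axis i 1 + axis i 1) = f (t + of_int j *\<^sub>R axis i 1)"
      using assms(1) by (simp add: periodic3_def)
    then show ?case using step1 by (simp add: algebra_simps)
  next
    case (step2 j)
    have "f (t + of_int (j - 1) *\<^sub>R axis i 1 + axis i 1) = f (t + of_int (j - 1) *\<^sub>R axis i 1)"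
      using assms(1) by (simp add: periodic3_def)
    then show ?case using step2 by (simp add: algebra_simps)
  qed simp
  define k where "k = (\<lambda>i. \<lfloor>m $ i\<rfloor>)"
  have k: "m $ i = of_int (k i)" for i using assms(2)[of i] by (auto simp: k_def elim: Ints_cases)
  have "m = of_int (k 1) *\<^sub>R axis 1 1 + of_int (k 2) *\<^sub>R axis 2 1 + of_int (k 3) *\<^sub>R axis 3 1"
    by (simp add: vec_eq_iff forall_3 axis_def k)
  then show ?thesis using 1 by (simp only: add.assoc[symmetric])
qed

lemma pdiff_axis_sum:
  assumes "smooth (f :: real ^ 3 \<Rightarrow> real)"
  shows "pdiff h f t = (\<Sum>i\<in>UNIV. h $ i * \<delta> i f t)"
proof -
  note l = pdiff_linear[OF assms, of t]
  have "h = (\<Sum>i\<in>UNIV. h $ i *\<^sub>R axis i 1)"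
    using basis_expansion[of h] by (simp add: scalar_mult_eq_scaleR)
  then have "pdiff h f t = pdiff (\<Sum>i\<in>UNIV. h $ i *\<^sub>R axis i 1) f t" by simp
  also have "\<dots> = (\<Sum>i\<in>UNIV. h $ i * \<delta> i f t)" by (simp add: linear_sum[OF l] linear_scale[OF l])
  finally show ?thesis .
qed

lemma regular_sup: "regular s u \<Longrightarrow> sup_bounded u"
  using regular_0[of s u] by (simp add: regular0_def)

lemma difference_quotient_estimate:
  assumes s: "smooth (f :: real ^ 3 \<Rightarrow> real)" and C: "\<And>t. \<bar>\<delta> i (\<delta> i f) t\<bar> \<le> C" and h: "0 \<le> h"
  shows "\<bar>f (t + h *\<^sub>R axis i 1) - f t - h * \<delta> i f t\<bar> \<le> C * h\<^sup>2"
proof -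
  have sc: "pdiff (r *\<^sub>R axis i 1) g x = r * \<delta> i g x" if "smooth g" for r x and g :: "real ^ 3 \<Rightarrow> real"
    using linear_scale[OF pdiff_linear[OF that, of x], of r "axis i 1"] by simp
  obtain r where r: "r \<in> {0..1}" "f (t + h *\<^sub>R axis i 1) - f t = h * \<delta> i f (t + r *\<^sub>R h *\<^sub>R axis i 1)"
    using smooth_mvt[OF s, of t "h *\<^sub>R axis i 1"] sc[OF s] by auto
  obtain x where r': "\<delta> i f (t + (r * h) *\<^sub>R axis i 1) - \<delta> i f t = (r * h) * \<delta> i (\<delta> i f) x"
    using smooth_mvt[OF smooth_pdiff[OF s], of "axis i 1" t "(r * h) *\<^sub>R axis i 1"]
    unfolding sc[OF smooth_pdiff[OF s]] by blast
  have "f (t + h *\<^sub>R axis i 1) - f t - h * \<delta> i f t = h * (\<delta> i f (t + (r * h) *\<^sub>R axis i 1) - \<delta> i f t)"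
    using r(2) by (simp add: algebra_simps)
  also have "\<bar>\<dots>\<bar> = h * (r * h * \<bar>\<delta> i (\<delta> i f) x\<bar>)"
    unfolding r' using h r by (simp add: abs_mult)
  also have "\<dots> \<le> h * (1 * h * C)"
    using h r C by (intro mult_mono mult_nonneg_nonneg) (auto intro: order_trans[OF abs_ge_zero C])
  finally show ?thesis by (simp add: power2_eq_square mult_ac)
qed

text \<open>Landau's interpolation: a difference quotient of step \<open>h\<close> differs from the derivative by at
  most \<open>C h\<close>, with \<open>C\<close> a common bound for the second derivatives. So if \<open>u m - u n\<close> is small
  compared with \<open>h\<close>, the derivatives differ little.\<close>
lemma uniform_limit_deriv_seq:
  assumes regular: "\<And>s. regular s u" and lim: "uniform_limit UNIV u w sequentially"
  shows "uniformly_convergent_on UNIV (\<delta>s i u)"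
proof (rule Cauchy_uniformly_convergent, rule uniformly_Cauchy_onI)
  fix e :: real assume e: "e > 0"
  have "regular 1 (\<delta>s i u)" using regular[of 2] by (simp add: numeral_2_eq_2)
  then have "sup_bounded (\<delta>s i (\<delta>s i u))" using regular_sup[of 0 "\<delta>s i (\<delta>s i u)"] by simp
  then obtain C0 where C0: "\<And>n t. \<bar>\<delta> i (\<delta> i (u n)) t\<bar> \<le> C0" by (auto simp: sup_bounded_def \<delta>s_def)
  define C where "C = \<bar>C0\<bar> + 1"
  have C: "\<bar>\<delta> i (\<delta> i (u n)) t\<bar> \<le> C" "C > 0" for n t using C0[of n t] by (auto simp: C_def)
  define h where "h = e / (4 * C)"
  have h: "h > 0" "2 * C * h = e / 2" using e C(2) by (auto simp: h_def)
  define d where "d = h * e / 8"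
  have d: "d > 0" using h e by (simp add: d_def)
  have "uniformly_Cauchy_on UNIV u"
    using lim uniformly_convergent_Cauchy[of UNIV u] by (auto simp: uniformly_convergent_on_def)
  then obtain N where N: "\<And>m n t. m \<ge> N \<Longrightarrow> n \<ge> N \<Longrightarrow> \<bar>u m t - u n t\<bar> < d"
    using d unfolding uniformly_Cauchy_on_def dist_real_def by blast
  have "\<bar>\<delta>s i u m t - \<delta>s i u n t\<bar> < e" if mn: "m \<ge> N" "n \<ge> N" for m n t
  proof -
    have est: "\<bar>u k (t + h *\<^sub>R axis i 1) - u k t - h * \<delta>s i u k t\<bar> \<le> C * h\<^sup>2" for k
      unfolding \<delta>s_def using difference_quotient_estimate[OF periodic_seq_smooth[OF regular_periodic_seq[OF regular[of 0]]] C(1)] h by simp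
    have "h * \<bar>\<delta>s i u m t - \<delta>s i u n t\<bar> = \<bar>h * \<delta>s i u m t - h * \<delta>s i u n t\<bar>"
      using h by (simp add: abs_mult right_diff_distrib[symmetric])
    also have "\<dots> \<le> 2 * d + 2 * (C * h\<^sup>2)"
      using est[of m] est[of n] N[OF mn, of t] N[OF mn, of "t + h *\<^sub>R axis i 1"] by linarith
    also have "\<dots> = h * (e / 4 + 2 * C * h)" by (simp add: d_def power2_eq_square algebra_simps)
    also have "\<dots> < h * e" unfolding h(2) using h e by simp
    finally show ?thesis using h by simp
  qed
  then show "\<exists>M. \<forall>x\<in>UNIV. \<forall>m\<ge>M. \<forall>n\<ge>M. dist (\<delta>s i u m x) (\<delta>s i u n x) < e"
    unfolding dist_real_def by blast
qed

lemma uniform_limit_has_derivative: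
  assumes regular: "\<And>s. regular s u" and lim: "uniform_limit UNIV u w sequentially"
    and wi: "\<And>i. uniform_limit UNIV (\<delta>s i u) (w' i) sequentially"
  shows "(w has_derivative (\<lambda>h. \<Sum>i\<in>UNIV. h $ i * w' i t)) (at t)"
proof -
  have sm: "smooth (u n)" for n using periodic_seq_smooth[OF regular_periodic_seq[OF regular[of 0]]] .
  have "\<exists>g. \<forall>x\<in>UNIV. (\<lambda>n. u n x) \<longlonglongrightarrow> g x \<and> (g has_derivative (\<lambda>h. \<Sum>i\<in>UNIV. h $ i * w' i x)) (at x within UNIV)"
  proof (rule has_derivative_sequence[where f' = "\<lambda>n x h. pdiff h (u n) x"])
    show "(u n has_derivative (\<lambda>h. pdiff h (u n) x)) (at x within UNIV)" for n x
      using smooth_has_derivative[OF sm] by simp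
    show "(\<lambda>n. u n 0) \<longlonglongrightarrow> w 0" by (rule tendsto_uniform_limitI[OF lim]) simp
    fix e :: real assume e: "e > 0"
    have "\<forall>\<^sub>F n in sequentially. \<forall>i. \<forall>x. \<bar>\<delta>s i u n x - w' i x\<bar> < e / 3"
    proof (rule eventually_all_finite)
      fix i
      show "\<forall>\<^sub>F n in sequentially. \<forall>x. \<bar>\<delta>s i u n x - w' i x\<bar> < e / 3"
        using uniform_limitD[OF wi[of i], of "e / 3"] e by (simp add: dist_real_def)
    qed
    then show "\<forall>\<^sub>F n in sequentially. \<forall>x\<in>UNIV. \<forall>h. norm (pdiff h (u n) x - (\<Sum>i\<in>UNIV. h $ i * w' i x)) \<le> e * norm h"
    proof eventually_elim
      case (elim n)
      have "norm (pdiff h (u n) x - (\<Sum>i\<in>UNIV. h $ i * w' i x)) \<le> e * norm h" for x h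
      proof -
        have "pdiff h (u n) x - (\<Sum>i\<in>UNIV. h $ i * w' i x) = (\<Sum>i\<in>UNIV. h $ i * (\<delta>s i u n x - w' i x))"
          unfolding pdiff_axis_sum[OF sm[of n], of h x] by (simp add: \<delta>s_def sum_subtractf right_diff_distrib)
        also have "norm \<dots> \<le> (\<Sum>i\<in>(UNIV::3 set). norm h * (e / 3))"
          unfolding real_norm_def
        proof (rule order_trans[OF sum_abs], rule sum_mono)
          fix i :: 3
          show "\<bar>h $ i * (\<delta>s i u n x - w' i x)\<bar> \<le> norm h * (e / 3)"
            unfolding abs_mult using elim component_le_norm_cart[of h i]
            by (intro mult_mono) (auto intro: less_imp_le)
        qed
        finally show ?thesis by (simp add: mult.commute)
      qed
      then show ?case by blast
    qed
  qed simp_all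
  then obtain g where g: "\<And>x. (\<lambda>n. u n x) \<longlonglongrightarrow> g x" "\<And>x. (g has_derivative (\<lambda>h. \<Sum>i\<in>UNIV. h $ i * w' i x)) (at x)"
    by auto
  have "g = w"
  proof
    fix x
    have "(\<lambda>n. u n x) \<longlonglongrightarrow> w x" by (rule tendsto_uniform_limitI[OF lim]) simp
    then show "g x = w x" using g(1) LIMSEQ_unique by blast
  qed
  then show ?thesis using g(2) by simp
qed

text \<open>All derivatives of the sequence satisfy the same hypotheses, hence the derivatives of the
  limit are limits of derivatives, to any order.\<close>
lemma uniform_limit_smooth:
  assumes regular: "\<And>s. regular s u" and lim: "uniform_limit UNIV u w sequentially"
  shows "smooth_periodic w" "uniform_limit UNIV (\<delta>s i u) (\<delta> i w) sequentially"
proof -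
  have D: "\<exists>w'. (\<forall>i. uniform_limit UNIV (\<delta>s i u) (w' i) sequentially) \<and> (\<forall>t. (w has_derivative (\<lambda>h. \<Sum>i\<in>UNIV. h $ i * w' i t)) (at t))"
    if "\<And>s. regular s u" "uniform_limit UNIV u w sequentially" for u w
  proof -
    have "\<exists>l. uniform_limit UNIV (\<delta>s i u) l sequentially" for i
      using uniform_limit_deriv_seq[OF that] by (simp add: uniformly_convergent_on_def)
    then obtain w' where "\<And>i. uniform_limit UNIV (\<delta>s i u) (w' i) sequentially" by metis
    then show ?thesis using uniform_limit_has_derivative[OF that] by blast
  qed
  have "Ck k w" if "\<And>s. regular s u" "uniform_limit UNIV u w sequentially" for k u w
    using that
  proof (induction k arbitrary: u w)
    case 0
    have "continuous_on UNIV w"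
      by (rule uniform_limit_theorem[OF always_eventually 0(2)])
         (use periodic_seq_continuous[OF regular_periodic_seq[OF 0(1)[of 0]]] in auto)
    then show ?case by simp
  next
    case (Suc k)
    obtain w' where w': "\<And>i. uniform_limit UNIV (\<delta>s i u) (w' i) sequentially"
      "\<And>t. (w has_derivative (\<lambda>h. \<Sum>i\<in>UNIV. h $ i * w' i t)) (at t)"
      using D[OF Suc.prems] by blast
    have "regular s (\<delta>s i u)" for s i using Suc.prems(1)[of "Suc s"] by simp
    then have "Ck k (w' i)" for i using Suc.IH w'(1) by blast
    then show ?case by (intro Ck_SucI[OF w'(2)] Ck_sum Ck_mult Ck_const)
  qed
  then have sm: "smooth w" unfolding smooth_def using assms by blast
  have per: "w (t + axis j 1) = w t" for t j
  proof (rule LIMSEQ_unique)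
    show "(\<lambda>n. u n (t + axis j 1)) \<longlonglongrightarrow> w (t + axis j 1)" by (rule tendsto_uniform_limitI[OF lim]) simp
    have "u n (t + axis j 1) = u n t" for n
      using regular_periodic_seq[OF regular[of 0]] by (auto simp: periodic_seq_def smooth_periodic_def periodic3_def)
    then show "(\<lambda>n. u n (t + axis j 1)) \<longlonglongrightarrow> w t" using tendsto_uniform_limitI[OF lim, of t] by simp
  qed
  show "smooth_periodic w" using sm per by (simp add: smooth_periodic_def periodic3_def)
  obtain w' where w': "\<And>i. uniform_limit UNIV (\<delta>s i u) (w' i) sequentially"
    "\<And>t. (w has_derivative (\<lambda>h. \<Sum>i\<in>UNIV. h $ i * w' i t)) (at t)"
    using D[OF assms] by blast
  have "\<delta> i w = w' i"
  proof
    fix t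
    have "\<delta> i w t = (\<Sum>j\<in>UNIV. axis i 1 $ j * w' j t)" by (rule pdiff_eq[OF w'(2)])
    then show "\<delta> i w t = w' i t" by (simp add: axis_def if_distrib[of "\<lambda>x. x * _"] cong: if_cong)
  qed
  then show "uniform_limit UNIV (\<delta>s i u) (\<delta> i w) sequentially" using w'(1) by simp
qed

lemma regular0_subseq:
  assumes "regular0 u"
  shows "regular0 (\<lambda>n. u (r n))"
proof -
  have L: "L2_bounded (\<lambda>n. v (r n))" if "L2_bounded v" for v
    using that unfolding L2_bounded_def by blast
  have S: "sup_bounded (\<lambda>n. u (r n))" using assms unfolding regular0_def sup_bounded_def by blast
  have "L2_bounded (\<lambda>n. \<delta>s i u (r n))" "L2_bounded (\<lambda>n. \<delta>s j (\<delta>s i u) (r n))" for i j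
    using assms by (simp_all add: regular0_def L)
  then show ?thesis using S assms by (simp add: regular0_def periodic_seq_def \<delta>s_def)
qed

lemma regular_subseq: "regular s u \<Longrightarrow> regular s (\<lambda>n. u (r n))"
proof (induction s arbitrary: u)
  case 0
  then show ?case by (simp add: regular0_subseq)
next
  case (Suc s)
  have "regular s (\<delta>s i (\<lambda>n. u (r n)))" for i
    using Suc.IH[of "\<delta>s i u"] Suc.prems by (simp add: \<delta>s_def)
  then show ?case using Suc.prems by (simp add: regular0_subseq)
qed

text \<open>Arzela-Ascoli on the unit cube; by periodicity the convergence is uniform everywhere.\<close>
lemma convergent_subsequence:
  assumes regular: "\<And>s. regular s u"
  shows "\<exists>r w. strict_mono (r :: nat \<Rightarrow> nat) \<and> uniform_limit UNIV (\<lambda>n. u (r n)) w sequentially"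
proof -
  have per: "periodic3 (u n)" and sm: "smooth (u n)" for n
    using regular_periodic_seq[OF regular[of 0]] by (auto simp: periodic_seq_def smooth_periodic_def)
  obtain M where M: "\<And>n t. \<bar>u n t\<bar> \<le> M" using regular_sup[OF regular[of 0]] by (auto simp: sup_bounded_def)
  have "\<exists>C. \<forall>n t. \<bar>\<delta> i (u n) t\<bar> \<le> C" for i
    using regular[of 1] regular_sup[of 0 "\<delta>s i u"] by (auto simp: sup_bounded_def \<delta>s_def)
  then obtain Ci where Ci: "\<And>i n t. \<bar>\<delta> i (u n) t\<bar> \<le> Ci i" by metis
  define C where "C = (\<Sum>i\<in>UNIV. \<bar>Ci i\<bar>) + 1"
  have C: "C > 0" unfolding C_def by (intro add_nonneg_pos sum_nonneg) auto
  have lip: "\<bar>u n x - u n y\<bar> \<le> C * norm (x - y)" for n x y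
  proof -
    obtain s where "u n (y + (x - y)) - u n y = pdiff (x - y) (u n) (y + s *\<^sub>R (x - y))"
      using smooth_mvt[OF sm, of n y "x - y"] by blast
    then have "u n x - u n y = (\<Sum>i\<in>UNIV. (x - y) $ i * \<delta> i (u n) (y + s *\<^sub>R (x - y)))"
      unfolding pdiff_axis_sum[OF sm[of n], of "x - y"] by simp
    also have "\<bar>\<dots>\<bar> \<le> (\<Sum>i\<in>UNIV. norm (x - y) * \<bar>Ci i\<bar>)"
    proof (rule order_trans[OF sum_abs], rule sum_mono)
      fix i
      show "\<bar>(x - y) $ i * \<delta> i (u n) (y + s *\<^sub>R (x - y))\<bar> \<le> norm (x - y) * \<bar>Ci i\<bar>"
        unfolding abs_mult by (intro mult_mono component_le_norm_cart order_trans[OF Ci]) auto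
    qed
    also have "\<dots> = norm (x - y) * (\<Sum>i\<in>UNIV. \<bar>Ci i\<bar>)" by (simp only: sum_distrib_left)
    also have "\<dots> \<le> norm (x - y) * C" by (intro mult_left_mono) (simp_all add: C_def)
    also have "\<dots> = C * norm (x - y)" by (rule mult.commute)
    finally show ?thesis .
  qed
  obtain g r where r: "strict_mono (r :: nat \<Rightarrow> nat)"
    and g: "\<And>e. 0 < e \<Longrightarrow> \<exists>N. \<forall>n x. n \<ge> N \<and> x \<in> cbox 0 1 \<longrightarrow> norm (u (r n) x - g x) < e"
  proof (rule Arzela_Ascoli[of "cbox 0 (1 :: real ^ 3)" u M])
    show "norm (u n x) \<le> M" for n x using M by simp
    fix x :: "real ^ 3" and e :: real assume e: "0 < e"
    show "\<exists>d. 0 < d \<and> (\<forall>n y. y \<in> cbox 0 1 \<and> norm (x - y) < d \<longrightarrow> norm (u n x - u n y) < e)"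
    proof (intro exI[of _ "e / C"] conjI allI impI)
      show "0 < e / C" using e C by simp
      fix n y assume "y \<in> cbox 0 (1 :: real ^ 3) \<and> norm (x - y) < e / C"
      then have "C * norm (x - y) < e" using C by (simp add: field_simps)
      then show "norm (u n x - u n y) < e" using lip[of n x y] by simp
    qed
  qed (auto intro: that)
  define fl where "fl = (\<lambda>t :: real ^ 3. \<chi> i. real_of_int \<lfloor>t $ i\<rfloor>)"
  have fl: "t - fl t \<in> cbox 0 1" for t
  proof -
    have "0 \<le> x - of_int \<lfloor>x\<rfloor> \<and> x - of_int \<lfloor>x\<rfloor> \<le> 1" for x :: real by linarith
    then show ?thesis by (simp add: fl_def mem_box_cart)
  qed
  have ufl: "u n (t - fl t) = u n t" for n t
    using periodic3_int[OF per, of "- fl t" n t] by (simp add: fl_def)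
  have "uniform_limit UNIV (\<lambda>n. u (r n)) (\<lambda>t. g (t - fl t)) sequentially"
  proof (rule uniform_limitI)
    fix e :: real assume "e > 0"
    then obtain N where N: "\<And>n x. n \<ge> N \<Longrightarrow> x \<in> cbox 0 1 \<Longrightarrow> norm (u (r n) x - g x) < e" using g by blast
    have "dist (u (r n) t) (g (t - fl t)) < e" if "n \<ge> N" for n t
      using N[OF that fl[of t]] by (simp add: ufl dist_real_def)
    then show "\<forall>\<^sub>F n in sequentially. \<forall>x\<in>UNIV. dist (u (r n) x) (g (x - fl x)) < e"
      by (auto simp: eventually_sequentially)
  qed
  then show ?thesis using r by blast
qed

lemma uniform_limit_subseq:
  assumes "uniform_limit S u w sequentially" "strict_mono (r :: nat \<Rightarrow> nat)"
  shows "uniform_limit S (\<lambda>n. u (r n)) w sequentially"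
  using assms(1) filterlim_subseq[OF assms(2)]
  by (rule filterlim_compose[where f = r and g = u, unfolded comp_def]) 

lemma common_convergent_subsequence:
  assumes "finite S" "\<And>u s. u \<in> S \<Longrightarrow> regular s u"
  shows "\<exists>r. strict_mono (r :: nat \<Rightarrow> nat) \<and> (\<forall>u\<in>S. \<exists>w. uniform_limit UNIV (\<lambda>n. u (r n)) w sequentially)"
  using assms
proof (induction S rule: finite_induct)
  case empty
  then show ?case by (intro exI[of _ "\<lambda>n. n"]) (simp add: strict_mono_def)
next
  case (insert u S)
  then obtain r where r: "strict_mono (r :: nat \<Rightarrow> nat)" "\<And>u. u \<in> S \<Longrightarrow> \<exists>w. uniform_limit UNIV (\<lambda>n. u (r n)) w sequentially"
    by auto
  have "regular s (\<lambda>n. u (r n))" for s by (rule regular_subseq[of s u r, OF insert.prems]) simp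
  then obtain r' w where r': "strict_mono (r' :: nat \<Rightarrow> nat)" "uniform_limit UNIV (\<lambda>n. u (r (r' n))) w sequentially"
    using convergent_subsequence[of "\<lambda>n. u (r n)"] by blast
  show ?case
  proof (intro exI[of _ "r \<circ> r'"] conjI ballI)
    show "strict_mono (r \<circ> r')" using r(1) r'(1) by (rule strict_mono_o)
    fix v assume "v \<in> insert u S"
    then show "\<exists>w. uniform_limit UNIV (\<lambda>n. v ((r \<circ> r') n)) w sequentially"
    proof
      assume "v = u"
      then show ?thesis using r'(2) by (auto simp: o_def)
    next
      assume "v \<in> S"
      then obtain w' where "uniform_limit UNIV (\<lambda>n. v (r n)) w' sequentially" using r(2) by blast
      from uniform_limit_subseq[OF this r'(1)] show ?thesis by (auto simp: o_def)
    qed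
  qed
qed

lemma tendsto_mean:
  assumes c: "\<And>n. continuous_on UNIV (u n)" and lim: "uniform_limit UNIV u w sequentially"
  shows "(\<lambda>n. mean (u n)) \<longlonglongrightarrow> mean w"
proof (rule LIMSEQ_I)
  fix e :: real assume e: "e > 0"
  have cw: "continuous_on UNIV w"
    by (rule uniform_limit_theorem[OF always_eventually lim]) (use c in auto)
  obtain N where N: "\<And>n t. n \<ge> N \<Longrightarrow> \<bar>u n t - w t\<bar> < e / 2"
    using uniform_limitD[OF lim, of "e / 2"] e by (auto simp: eventually_sequentially dist_real_def)
  have "norm (mean (u n) - mean w) < e" if "n \<ge> N" for n
  proof -
    have "\<bar>mean (\<lambda>t. u n t - w t)\<bar> \<le> e / 2"
      using N[OF that] by (intro mean_abs_le continuous_on_diff c cw) (auto intro: less_imp_le)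
    then show ?thesis using e by (simp add: mean_diff c cw)
  qed
  then show "\<exists>no. \<forall>n\<ge>no. norm (mean (u n) - mean w) < e" by blast
qed

lemma tendsto_coef:
  assumes c: "\<And>n. continuous_on UNIV (u n)" and lim: "uniform_limit UNIV u w sequentially"
  shows "(\<lambda>n. coef (u n) k) \<longlonglongrightarrow> coef w k"
  unfolding coef_def
proof (rule tendsto_mean)
  show "continuous_on UNIV (\<lambda>t. u n t * hartley k t)" for n
    by (intro continuous_on_mult c smooth_periodicD(3)[OF smooth_periodic_hartley])
  show "uniform_limit UNIV (\<lambda>n t. u n t * hartley k t) (\<lambda>t. w t * hartley k t) sequentially"
  proof (rule uniform_limitI)
    fix e :: real assume e: "e > 0"
    have "\<forall>\<^sub>F n in sequentially. \<forall>x\<in>UNIV. dist (u n x) (w x) < e / 9"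
      using uniform_limitD[OF lim, of "e / 9"] e by simp
    then show "\<forall>\<^sub>F n in sequentially. \<forall>x\<in>UNIV. dist (u n x * hartley k x) (w x * hartley k x) < e"
    proof eventually_elim
      case (elim n)
      have "\<bar>u n x * hartley k x - w x * hartley k x\<bar> < e" for x
      proof -
        have "\<bar>u n x * hartley k x - w x * hartley k x\<bar> = \<bar>u n x - w x\<bar> * \<bar>hartley k x\<bar>"
          by (simp add: left_diff_distrib[symmetric] abs_mult)
        also have "\<dots> \<le> (e / 9) * 8"
          using elim e abs_hartley_le[of k x] by (intro mult_mono) (auto simp: dist_real_def intro: less_imp_le)
        finally show ?thesis using e by linarith
      qed
      then show ?case by (simp add: dist_real_def)
    qed
  qed
qed

text \<open>Schwarz's theorem, read off from the coefficients; it is passed on to uniform limits of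
  trigonometric polynomials.\<close>
lemma trig_poly_commute: "\<delta> i (\<delta> j (trig_poly n c)) = \<delta> j (\<delta> i (trig_poly n c))"
proof (cases "i = j")
  case False
  have "flip i (flip j k) = flip j (flip i k)" for k by (simp add: vec_eq_iff flip_nth)
  then have "dcoef i (dcoef j c) = dcoef j (dcoef i c)"
    using False by (auto simp: dcoef_def flip_nth)
  then show ?thesis by (simp add: pdiff_trig_poly)
qed simp

lemma hartley_0: "hartley 0 t = 1"
  by (simp add: hartley_def cas_def)

lemma uniform_limit_comp:
  assumes sm: "smooth (f :: 'd::finite cover \<Rightarrow> real)" and f: "\<And>b z. b \<in> Basis \<Longrightarrow> \<bar>pdiff b f z\<bar> \<le> C"
    and Y: "\<And>b. b \<in> Basis \<Longrightarrow> uniform_limit UNIV (\<lambda>n t. Y n t \<bullet> b) (\<lambda>t. Z t \<bullet> b) sequentially"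
  shows "uniform_limit UNIV (\<lambda>n t. f (Y n t)) (\<lambda>t. f (Z t)) sequentially"
proof (rule uniform_limitI)
  fix e :: real assume e: "e > 0"
  have C0: "0 \<le> C" using f[OF cover_Basis(1)] by (rule order_trans[OF abs_ge_zero])
  define d where "d = e / ((C + 1) * (1 + real DIM('d cover)))"
  have d: "d > 0" using e C0 by (simp add: d_def)
  have "\<forall>\<^sub>F n in sequentially. \<forall>b\<in>Basis. \<forall>t. \<bar>Y n t \<bullet> b - Z t \<bullet> b\<bar> < d"
  proof (rule eventually_ball_finite)
    show "\<forall>b\<in>Basis. \<forall>\<^sub>F n in sequentially. \<forall>t. \<bar>Y n t \<bullet> b - Z t \<bullet> b\<bar> < d"
      using uniform_limitD[OF Y d] by (auto simp: dist_real_def)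
  qed simp
  then show "\<forall>\<^sub>F n in sequentially. \<forall>t\<in>UNIV. dist (f (Y n t)) (f (Z t)) < e"
  proof eventually_elim
    case (elim n)
    have "\<bar>f (Y n t) - f (Z t)\<bar> < e" for t
    proof -
      let ?h = "Y n t - Z t"
      obtain s where "f (Z t + ?h) - f (Z t) = pdiff ?h f (Z t + s *\<^sub>R ?h)"
        using smooth_mvt[OF sm] by blast
      then have "\<bar>f (Y n t) - f (Z t)\<bar> \<le> C * norm1 ?h" using abs_pdiff_le[OF sm f] by simp
      also have "\<dots> \<le> C * (\<Sum>b\<in>(Basis :: 'd cover set). d)"
        unfolding norm1_def inner_diff_left using elim C0
        by (intro mult_left_mono sum_mono) (auto intro: less_imp_le)
      also have "\<dots> \<le> C * ((1 + real DIM('d cover)) * d)"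
        using C0 d by (intro mult_left_mono) (simp_all add: distrib_right)
      also have "\<dots> < (C + 1) * ((1 + real DIM('d cover)) * d)"
        using d by (intro mult_strict_right_mono mult_pos_pos) auto
      also have "\<dots> = e" using C0 by (simp add: d_def)
      finally show ?thesis .
    qed
    then show ?case by (simp add: dist_real_def)
  qed
qed

lemma uniform_limit_sum_real:
  fixes f :: "'i \<Rightarrow> nat \<Rightarrow> 'a \<Rightarrow> real"
  assumes "\<And>i. i \<in> I \<Longrightarrow> uniform_limit S (f i) (l i) F"
  shows "uniform_limit S (\<lambda>n t. \<Sum>i\<in>I. f i n t) (\<lambda>t. \<Sum>i\<in>I. l i t) F"
  using assms
proof (induction I rule: infinite_finite_induct)
  case (insert i I)
  then have "uniform_limit S (\<lambda>n t. f i n t + (\<Sum>i\<in>I. f i n t)) (\<lambda>t. l i t + (\<Sum>i\<in>I. l i t)) F"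
    by (intro uniform_limit_add) auto
  then show ?case using insert by simp
qed (simp_all add: uniform_limit_const)

text \<open>Both sides are continuous and periodic, so it suffices to compare their Fourier
  coefficients. That of frequency \<open>k\<close> agrees for all terms of the sequence whose truncation admits
  \<open>k\<close>, hence for the limit, and both sides have mean zero.\<close>
lemma poisson_limit:
  assumes u: "\<And>n. u n = poisson (r n) (G n)" and r: "strict_mono (r :: nat \<Rightarrow> nat)"
    and reg_u: "\<And>s. regular s u" and G: "\<And>n. continuous_on UNIV (G n)"
    and lu: "uniform_limit UNIV u w sequentially"
    and lG: "uniform_limit UNIV G H sequentially" and H: "periodic3 H"
  shows "- (\<Sum>i\<in>UNIV. \<delta> i (\<delta> i w) t) = H t - mean H"
proof -
  have reg_d: "regular s (\<delta>s i u)" for s i using reg_u[of "Suc s"] by simp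
  note w = uniform_limit_smooth[OF reg_u lu]
  note dw = uniform_limit_smooth[OF reg_d w(2)]
  have cH: "continuous_on UNIV H"
    by (rule uniform_limit_theorem[OF always_eventually lG]) (use G in auto)
  have sdw: "smooth_periodic (\<delta> i (\<delta> i w))" for i by (intro smooth_periodic_pdiff w(1))
  let ?L = "\<lambda>t. - (\<Sum>i\<in>UNIV. \<delta> i (\<delta> i w) t)"
  have cL: "continuous_on UNIV ?L"
    by (intro continuous_on_minus continuous_on_sum smooth_periodicD(3)[OF sdw])
  have cLu: "continuous_on UNIV (\<lambda>t. - (\<Sum>i\<in>UNIV. \<delta> i (\<delta> i (u n)) t))" for n
    by (intro continuous_on_minus continuous_on_sum smooth_periodicD(3) smooth_periodic_pdiff)
       (simp add: u smooth_periodic_poisson)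
  have limL: "uniform_limit UNIV (\<lambda>n t. - (\<Sum>i\<in>UNIV. \<delta> i (\<delta> i (u n)) t)) ?L sequentially"
    by (rule uniform_limit_uminus, rule uniform_limit_sum_real) (use dw(2) in \<open>simp add: \<delta>s_def\<close>)
  have "coef (\<lambda>t. ?L t - (H t - mean H)) k = 0" for k
  proof -
    have ch: "continuous_on UNIV (hartley k)" by (rule smooth_periodicD(3)[OF smooth_periodic_hartley])
    have split: "coef (\<lambda>t. ?L t - (H t - mean H)) k = coef ?L k - (coef H k - mean H * mean (hartley k))"
      unfolding coef_def
      by (simp only: left_diff_distrib mean_diff mean_cmult continuous_on_diff continuous_on_mult continuous_on_const cL cH ch)
    show ?thesis
    proof (cases "k = 0")
      case True
      have h0: "hartley k = (\<lambda>t. 1)" using True hartley_0 by auto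
      have z: "mean (\<delta> i (\<delta> i w)) = 0" for i
        by (rule mean_pdiff_eq_0[OF smooth_periodicD(2)[OF smooth_periodic_pdiff[OF w(1)]]
            smooth_differentiable[OF smooth_periodicD(1)[OF smooth_periodic_pdiff[OF w(1)]]] smooth_periodicD(3)[OF sdw]])
      have "mean ?L = - mean (\<lambda>t. \<Sum>i\<in>UNIV. \<delta> i (\<delta> i w) t)" by (rule mean_uminus)
      also have "mean (\<lambda>t. \<Sum>i\<in>UNIV. \<delta> i (\<delta> i w) t) = (\<Sum>i\<in>UNIV. mean (\<delta> i (\<delta> i w)))"
        by (rule mean_sum) (rule smooth_periodicD(3)[OF sdw])
      also have "\<dots> = 0" by (simp add: z)
      finally show ?thesis unfolding split by (simp add: coef_def h0)
    next
      case False
      have mh: "mean (hartley k) = 0" using mean_hartley_hartley[of k 0] False by (simp add: hartley_0)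
      obtain N where N: "k \<in> freq_box N" using ex_freq_box by blast
      have "coef (\<lambda>t. - (\<Sum>i\<in>UNIV. \<delta> i (\<delta> i (u n)) t)) k = coef (G n) k" if "n \<ge> N" for n
      proof -
        have "N \<le> r n" using that seq_suble[OF r, of n] by simp
        then have "k \<in> freq_box (r n)" using N unfolding freq_box_def by (auto intro: order_trans)
        then show ?thesis unfolding u by (rule coef_laplace_poisson[OF _ False])
      qed
      then have "(\<lambda>n. coef (\<lambda>t. - (\<Sum>i\<in>UNIV. \<delta> i (\<delta> i (u n)) t)) k) \<longlonglongrightarrow> coef H k"
        using tendsto_coef[OF G lG, of k] by (subst tendsto_cong) (auto simp: eventually_sequentially)
      then have "coef ?L k = coef H k"
        using tendsto_coef[OF cLu limL, of k] LIMSEQ_unique by blast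
      then show ?thesis unfolding split by (simp add: mh)
    qed
  qed
  moreover have "continuous_on UNIV (\<lambda>t. ?L t - (H t - mean H))"
    by (intro continuous_on_diff continuous_on_const cL cH)
  moreover have "periodic3 (\<lambda>t. ?L t - (H t - mean H))"
    using H smooth_periodicD(2)[OF sdw] by (simp add: periodic3_def)
  ultimately have "?L t - (H t - mean H) = 0"
    unfolding coef_def using Fourier_uniqueness[where g = "\<lambda>t. ?L t - (H t - mean H)" and t = t] by simp
  then show ?thesis by simp
qed

text \<open>The limit of a sequence of truncated solutions. The constants \<open>q0\<close> and \<open>a\<close> are treated as
  further sequences of functions, so that a single extraction makes everything converge.\<close>
lemma poisson_system_solution:
  fixes F :: "'d::finite cover \<Rightarrow> real"
  assumes b: "bounded_C2 F C" and admissible: "admissible F"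
  shows "\<exists>\<Phi> X q0 a Y. (\<forall>\<alpha>. smooth_periodic (\<Phi> \<alpha>)) \<and> (\<forall>i \<alpha>. smooth_periodic (X i \<alpha>)) \<and>
    (\<forall>i j \<alpha>. \<delta> i (\<delta> j (\<Phi> \<alpha>)) = \<delta> j (\<delta> i (\<Phi> \<alpha>))) \<and>
    (\<forall>i j k \<alpha>. \<delta> i (\<delta> j (X k \<alpha>)) = \<delta> j (\<delta> i (X k \<alpha>))) \<and>
    (\<forall>t. Y t = (t, \<chi> \<alpha>. q0 $ \<alpha> + (\<Phi> \<alpha> t - (\<Sum>i\<in>UNIV. \<delta> i (X i \<alpha>) t)), \<chi> i \<alpha>. a $ i $ \<alpha> + \<delta> i (\<Phi> \<alpha>) t)) \<and>
    (\<forall>\<alpha> t. - (\<Sum>i\<in>UNIV. \<delta> i (\<delta> i (\<Phi> \<alpha>)) t) = pdiff (unit_q \<alpha>) F (Y t)) \<and>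
    (\<forall>i \<alpha> t. - (\<Sum>j\<in>UNIV. \<delta> j (\<delta> j (X i \<alpha>)) t) = pdiff (unit_p i \<alpha>) F (Y t) + a $ i $ \<alpha>)"
proof -
  interpret bounded_C2 F C by (rule b)
  have "\<forall>n. \<exists>q0 a Y. Galerkin F n q0 a Y" using Galerkin_solution[OF b admissible] by blast
  then obtain q0 a Y where G: "\<And>n. Galerkin F n (q0 n) (a n) (Y n)" by metis
  have q0: "\<bar>q0 n $ \<alpha>\<bar> \<le> 1"
    and Y: "Y n t = (t,
        \<chi> \<alpha>. q0 n $ \<alpha> + (poisson n (\<lambda>t. pdiff (unit_q \<alpha>) F (Y n t)) t
          + (\<Sum>i\<in>UNIV. - 1 * \<delta> i (poisson n (\<lambda>t. pdiff (unit_p i \<alpha>) F (Y n t))) t)),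
        \<chi> i \<alpha>. a n $ i $ \<alpha> + \<delta> i (poisson n (\<lambda>t. pdiff (unit_q \<alpha>) F (Y n t))) t)"
    and mq: "mean (\<lambda>t. pdiff (unit_q \<alpha>) F (Y n t)) = 0"
    and ma: "a n $ i $ \<alpha> = - mean (\<lambda>t. pdiff (unit_p i \<alpha>) F (Y n t))" for n i \<alpha> t
    using G[of n] unfolding Galerkin_def by blast+
  have cYi: "continuous_on UNIV (\<lambda>t. Y n t \<bullet> b)" if "b \<in> Basis" for n and b :: "'d cover"
    using that
  proof (cases rule: cover_Basis_cases)
    case (t i)
    have e: "(\<lambda>t. Y n t \<bullet> b) = (\<lambda>t. t $ i)" by (rule ext, subst Y) (simp add: t inner_axis)
    show ?thesis unfolding e by (intro continuous_on_component continuous_on_id)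
  next
    case (q \<alpha>)
    have e: "(\<lambda>t. Y n t \<bullet> b) = (\<lambda>t. q0 n $ \<alpha> + (poisson n (\<lambda>t. pdiff (unit_q \<alpha>) F (Y n t)) t
          + (\<Sum>i\<in>UNIV. - 1 * \<delta> i (poisson n (\<lambda>t. pdiff (unit_p i \<alpha>) F (Y n t))) t)))"
      by (rule ext, subst Y) (simp add: q inner_axis)
    show ?thesis
      unfolding e by (intro continuous_on_add continuous_on_const continuous_on_sum continuous_on_mult
        smooth_periodicD(3) smooth_periodic_poisson smooth_periodic_pdiff)
  next
    case (p i \<alpha>)
    have e: "(\<lambda>t. Y n t \<bullet> b) = (\<lambda>t. a n $ i $ \<alpha> + \<delta> i (poisson n (\<lambda>t. pdiff (unit_q \<alpha>) F (Y n t))) t)"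
      by (rule ext, subst Y) (simp add: p inner_axis)
    show ?thesis
      unfolding e by (intro continuous_on_add continuous_on_const
        smooth_periodicD(3) smooth_periodic_poisson smooth_periodic_pdiff)
  qed
  have cY: "continuous_on UNIV (Y n)" for n
    by (rule continuous_on_componentwise[THEN iffD2]) (simp add: cYi)
  have cF: "continuous_on UNIV (\<lambda>t. pdiff b F (Y n t))" for b n
    by (rule continuous_on_compose2[OF smooth_continuous[OF smooth_pdiff[OF smooth_F]] cY subset_UNIV])
  have aC: "\<bar>a n $ i $ \<alpha>\<bar> \<le> C" for n i \<alpha>
    unfolding ma abs_minus_cancel by (rule mean_abs_le[OF cF F1[OF cover_Basis(3)]])
  interpret approximate_solutions F C q0 a Y
  proof
    show "Y n t = (t,
        \<chi> \<alpha>. q0 n $ \<alpha> + (poisson_seq (\<lambda>n t. pdiff (unit_q \<alpha>) F (Y n t)) n t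
          + (\<Sum>i\<in>UNIV. - 1 * \<delta>s i (poisson_seq (\<lambda>n t. pdiff (unit_p i \<alpha>) F (Y n t))) n t)),
        \<chi> i \<alpha>. a n $ i $ \<alpha> + \<delta>s i (poisson_seq (\<lambda>n t. pdiff (unit_q \<alpha>) F (Y n t))) n t)" for n t
      unfolding poisson_seq_def \<delta>s_def by (rule Y)
  qed (rule admissible F1 F2 q0 aC; assumption)+
  define S where "S = range phi \<union> (\<lambda>(i, \<alpha>). chi i \<alpha>) ` UNIV \<union> range (\<lambda>\<alpha> n t. q0 n $ \<alpha>) \<union> (\<lambda>(i, \<alpha>) n t. a n $ i $ \<alpha>) ` UNIV"
  have "finite S" by (simp add: S_def)
  moreover have "regular s u" if "u \<in> S" for u s
    using that regular_phi regular_chi regular_const[OF q0] regular_const[OF aC] by (auto simp: S_def)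
  ultimately obtain r where r: "strict_mono (r :: nat \<Rightarrow> nat)"
    and conv: "\<And>u. u \<in> S \<Longrightarrow> \<exists>w. uniform_limit UNIV (\<lambda>n. u (r n)) w sequentially"
    using common_convergent_subsequence[of S] by blast
  have "\<exists>w. uniform_limit UNIV (\<lambda>n. phi \<alpha> (r n)) w sequentially" for \<alpha> by (rule conv) (simp add: S_def)
  then obtain \<Phi> where \<Phi>: "\<And>\<alpha>. uniform_limit UNIV (\<lambda>n. phi \<alpha> (r n)) (\<Phi> \<alpha>) sequentially" by metis
  have "\<exists>w. uniform_limit UNIV (\<lambda>n. chi i \<alpha> (r n)) w sequentially" for i \<alpha> by (rule conv) (auto simp: S_def)
  then obtain X where X: "\<And>i \<alpha>. uniform_limit UNIV (\<lambda>n. chi i \<alpha> (r n)) (X i \<alpha>) sequentially" by metis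
  have "\<exists>w. uniform_limit UNIV (\<lambda>n (t :: real ^ 3). q0 (r n) $ \<alpha>) w sequentially" for \<alpha>
    using conv[of "\<lambda>n t. q0 n $ \<alpha>"] by (auto simp: S_def)
  then obtain qw where qw: "\<And>\<alpha>. uniform_limit UNIV (\<lambda>n (t :: real ^ 3). q0 (r n) $ \<alpha>) (qw \<alpha>) sequentially" by metis
  have "\<exists>w. uniform_limit UNIV (\<lambda>n (t :: real ^ 3). a (r n) $ i $ \<alpha>) w sequentially" for i \<alpha>
    using conv[of "\<lambda>n t. a n $ i $ \<alpha>"] by (force simp: S_def)
  then obtain aw where aw: "\<And>i \<alpha>. uniform_limit UNIV (\<lambda>n (t :: real ^ 3). a (r n) $ i $ \<alpha>) (aw i \<alpha>) sequentially" by metis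
  have tq: "(\<lambda>n. q0 (r n) $ \<alpha>) \<longlonglongrightarrow> qw \<alpha> t" for \<alpha> t using tendsto_uniform_limitI[OF qw] by simp
  have ta: "(\<lambda>n. a (r n) $ i $ \<alpha>) \<longlonglongrightarrow> aw i \<alpha> t" for i \<alpha> t using tendsto_uniform_limitI[OF aw] by simp
  define q where "q = (\<chi> \<alpha>. qw \<alpha> 0)"
  define A where "A = (\<chi> i \<alpha>. aw i \<alpha> 0)"
  have qc: "qw \<alpha> = (\<lambda>t. q $ \<alpha>)" for \<alpha> using LIMSEQ_unique[OF tq tq] by (auto simp: q_def)
  have ac: "aw i \<alpha> = (\<lambda>t. A $ i $ \<alpha>)" for i \<alpha> using LIMSEQ_unique[OF ta ta] by (auto simp: A_def)
  have reg_p: "regular s (\<lambda>n. phi \<alpha> (r n))" and reg_x: "regular s (\<lambda>n. chi i \<alpha> (r n))" for s i \<alpha>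
    by (rule regular_subseq[of s "phi \<alpha>" r, OF regular_phi], rule regular_subseq[of s "chi i \<alpha>" r, OF regular_chi])
  note lp = uniform_limit_smooth[OF reg_p \<Phi>] and lx = uniform_limit_smooth[OF reg_x X]
  define Z where "Z = (\<lambda>t. (t, \<chi> \<alpha>. q $ \<alpha> + (\<Phi> \<alpha> t - (\<Sum>i\<in>UNIV. \<delta> i (X i \<alpha>) t)), \<chi> i \<alpha>. A $ i $ \<alpha> + \<delta> i (\<Phi> \<alpha>) t) :: 'd cover)"
  have limY: "uniform_limit UNIV (\<lambda>n t. Y (r n) t \<bullet> b) (\<lambda>t. Z t \<bullet> b) sequentially" if "b \<in> Basis" for b :: "'d cover"
    using that
  proof (cases rule: cover_Basis_cases)
    case (t i)
    have "(\<lambda>n t. Y (r n) t \<bullet> b) = (\<lambda>n t. t $ i)" using t fun_cong[OF fun_cong[OF Y_inner(1)[of i]]] by (intro ext) simp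
    moreover have "(\<lambda>t. Z t \<bullet> b) = (\<lambda>t. t $ i)" by (simp add: Z_def t inner_axis)
    ultimately show ?thesis by (simp add: uniform_limit_const)
  next
    case (q \<alpha>)
    have e1: "(\<lambda>n t. Y (r n) t \<bullet> b) = (\<lambda>n t. q0 (r n) $ \<alpha> + (phi \<alpha> (r n) t + (\<Sum>i\<in>UNIV. - \<delta>s i (\<lambda>n. chi i \<alpha> (r n)) n t)))"
      using q fun_cong[OF fun_cong[OF Y_inner(2)[of \<alpha>]]] by (intro ext) (simp add: qs_def \<delta>s_def)
    have e2: "(\<lambda>t. Z t \<bullet> b) = (\<lambda>t. qw \<alpha> t + (\<Phi> \<alpha> t + (\<Sum>i\<in>UNIV. - \<delta> i (X i \<alpha>) t)))"
      by (simp add: Z_def q inner_axis qc sum_negf)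
    show ?thesis
      unfolding e1 e2
      by (intro uniform_limit_add uniform_limit_sum_real uniform_limit_uminus qw \<Phi> lx(2))
  next
    case (p i \<alpha>)
    have e1: "(\<lambda>n t. Y (r n) t \<bullet> b) = (\<lambda>n t. a (r n) $ i $ \<alpha> + \<delta>s i (\<lambda>n. phi \<alpha> (r n)) n t)"
      using p fun_cong[OF fun_cong[OF Y_inner(3)[of i \<alpha>]]] by (intro ext) (simp add: ps_def \<delta>s_def)
    have e2: "(\<lambda>t. Z t \<bullet> b) = (\<lambda>t. aw i \<alpha> t + \<delta> i (\<Phi> \<alpha>) t)"
      by (simp add: Z_def p inner_axis ac)
    show ?thesis unfolding e1 e2 by (intro uniform_limit_add aw lp(2))
  qed
  have limF: "uniform_limit UNIV (\<lambda>n t. pdiff b F (Y (r n) t)) (\<lambda>t. pdiff b F (Z t)) sequentially" if "b \<in> Basis" for b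
    by (rule uniform_limit_comp[OF smooth_pdiff[OF admissible_smooth[OF admissible]] F2[OF that] limY])
  have perZ: "periodic3 (\<lambda>t. pdiff b F (Z t))" for b
    unfolding periodic3_def
  proof (intro allI)
    fix i t
    have "\<Phi> \<alpha> (t + axis i 1) = \<Phi> \<alpha> t" "\<delta> j (\<Phi> \<alpha>) (t + axis i 1) = \<delta> j (\<Phi> \<alpha>) t"
      "\<delta> j (X j \<alpha>) (t + axis i 1) = \<delta> j (X j \<alpha>) t" for \<alpha> j
      using smooth_periodicD(2)[OF lp(1)[of \<alpha>]] smooth_periodicD(2)[OF smooth_periodic_pdiff[OF lp(1)[of \<alpha>]]]
        smooth_periodicD(2)[OF smooth_periodic_pdiff[OF lx(1)[of j \<alpha>]]] by (simp_all add: periodic3_def)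
    then have "Z (t + axis i 1) = Z t + unit_t i" by (simp add: Z_def)
    moreover have "unit_t i \<in> (lattice :: 'd cover set)" by (auto simp: lattice_def axis_def)
    ultimately show "pdiff b F (Z (t + axis i 1)) = pdiff b F (Z t)"
      using admissible_periodic[OF admissible_pdiff[OF admissible], of "unit_t i"] by (simp only:)
  qed
  have mZ: "mean (\<lambda>t. pdiff (unit_q \<alpha>) F (Z t)) = 0" for \<alpha>
    using tendsto_mean[OF cF limF[OF cover_Basis(2)], of \<alpha>] LIMSEQ_unique[OF tendsto_const[of 0 sequentially]]
    by (simp add: mq)
  have mA: "mean (\<lambda>t. pdiff (unit_p i \<alpha>) F (Z t)) = - A $ i $ \<alpha>" for i \<alpha>
  proof -
    have "(\<lambda>n. mean (\<lambda>t. pdiff (unit_p i \<alpha>) F (Y (r n) t))) \<longlonglongrightarrow> mean (\<lambda>t. pdiff (unit_p i \<alpha>) F (Z t))"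
      by (rule tendsto_mean[OF cF limF[OF cover_Basis(3)]])
    moreover have "(\<lambda>n. mean (\<lambda>t. pdiff (unit_p i \<alpha>) F (Y (r n) t))) \<longlonglongrightarrow> - A $ i $ \<alpha>"
      using tendsto_minus[OF ta[of i \<alpha> 0]] by (simp add: ma ac)
    ultimately show ?thesis by (rule LIMSEQ_unique)
  qed
  have eq1: "- (\<Sum>i\<in>UNIV. \<delta> i (\<delta> i (\<Phi> \<alpha>)) t) = pdiff (unit_q \<alpha>) F (Z t)" for \<alpha> t
    using poisson_limit[where u = "\<lambda>n. phi \<alpha> (r n)" and G = "\<lambda>n t. pdiff (unit_q \<alpha>) F (Y (r n) t)" and t = t,
        OF _ r reg_p cF \<Phi> limF[OF cover_Basis(2)] perZ] by (simp add: phi_def poisson_seq_def mZ)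
  have eq2: "- (\<Sum>j\<in>UNIV. \<delta> j (\<delta> j (X i \<alpha>)) t) = pdiff (unit_p i \<alpha>) F (Z t) + A $ i $ \<alpha>" for i \<alpha> t
    using poisson_limit[where u = "\<lambda>n. chi i \<alpha> (r n)" and G = "\<lambda>n t. pdiff (unit_p i \<alpha>) F (Y (r n) t)" and t = t,
        OF _ r reg_x cF X limF[OF cover_Basis(3)] perZ] by (simp add: chi_def poisson_seq_def mA)
  have comm: "\<delta> i (\<delta> j w) = \<delta> j (\<delta> i w)"
    if reg_u: "\<And>s. regular s u" and lim: "uniform_limit UNIV u w sequentially" and pu: "\<And>n. \<exists>m G. u n = poisson m G" for u w i j
  proof
    fix t
    have reg_d: "regular s (\<delta>s i u)" for s i using reg_u[of "Suc s"] by simp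
    have 1: "(\<lambda>n. \<delta>s i (\<delta>s j u) n t) \<longlonglongrightarrow> \<delta> i (\<delta> j w) t" for i j
      by (rule tendsto_uniform_limitI[OF uniform_limit_smooth(2)[OF reg_d uniform_limit_smooth(2)[OF reg_u lim]]]) simp
    have "\<delta>s i (\<delta>s j u) = \<delta>s j (\<delta>s i u)"
    proof
      fix n
      obtain m G where "u n = poisson m G" using pu by blast
      then show "\<delta>s i (\<delta>s j u) n = \<delta>s j (\<delta>s i u) n" unfolding \<delta>s_def poisson_def by (simp only: trig_poly_commute[of i j])
    qed
    then show "\<delta> i (\<delta> j w) t = \<delta> j (\<delta> i w) t" using 1[of i j] 1[of j i] LIMSEQ_unique by metis
  qed
  have cp: "\<delta> i (\<delta> j (\<Phi> \<alpha>)) = \<delta> j (\<delta> i (\<Phi> \<alpha>))" for i j \<alpha>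
    by (rule comm[OF reg_p \<Phi>]) (unfold phi_def poisson_seq_def, blast)
  have cx: "\<delta> i (\<delta> j (X k \<alpha>)) = \<delta> j (\<delta> i (X k \<alpha>))" for i j k \<alpha>
    by (rule comm[OF reg_x X]) (unfold chi_def poisson_seq_def, blast)
  show ?thesis
    by (rule exI[of _ \<Phi>], rule exI[of _ X], rule exI[of _ q], rule exI[of _ A], rule exI[of _ Z])
       (use lp(1) lx(1) cp cx eq1 eq2 Z_def in blast)
qed

section \<open>Solutions with prescribed winding\<close>

lemma to_torus_eq_iff: "to_torus x = to_torus y \<longleftrightarrow> (\<forall>i. x $ i - y $ i \<in> \<int>)"
  by (simp add: to_torus_def vec_eq_iff circ_eq_iff)

lemma admissible_W_lift:
  assumes "smooth (W_lift W)"
  shows "admissible (W_lift W)"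
  unfolding admissible_def
proof (intro conjI allI impI)
  fix z m :: "'a cover" assume m: "m \<in> lattice"
  obtain t q p where z: "z = (t, q, p)" by (cases z)
  obtain k l where kl: "m = (k, l, 0)" "\<And>i. k $ i \<in> \<int>" "\<And>i. l $ i \<in> \<int>" using m by (auto simp: lattice_def)
  have "to_torus (t + k) = to_torus t" "to_torus (q + l) = to_torus q" using kl by (simp_all add: to_torus_eq_iff)
  then show "W_lift W (z + m) = W_lift W z" by (simp add: z kl(1) W_lift_def)
qed (rule assms)

lemma bounded_C2_of_C2_norm:
  assumes "smooth f" "C2_norm f < \<infinity>"
  shows "\<exists>C. bounded_C2 f C"
proof -
  let ?S = "{ereal \<bar>f x\<bar> | x. True} \<union> {ereal \<bar>pdiff b f x\<bar> | b x. b \<in> Basis}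
     \<union> {ereal \<bar>pdiff b (pdiff c f) x\<bar> | b c x. b \<in> Basis \<and> c \<in> Basis}"
  have up: "s \<le> C2_norm f" if "s \<in> ?S" for s unfolding C2_norm_def using that by (rule Sup_upper)
  have "ereal \<bar>f 0\<bar> \<le> C2_norm f" by (rule up) blast
  then obtain C where C: "C2_norm f = ereal C" using assms(2) by (cases "C2_norm f") auto
  have le: "s \<le> ereal C" if "s \<in> ?S" for s using up[OF that] C by simp
  have "bounded_C2 f C"
  proof
    fix z
    have "ereal \<bar>f z\<bar> \<le> ereal C" by (rule le) blast
    then show "\<bar>f z\<bar> \<le> C" by simp
    fix b :: 'a assume b: "b \<in> Basis"
    have "ereal \<bar>pdiff b f z\<bar> \<le> ereal C" by (rule le) (use b in blast)
    then show "\<bar>pdiff b f z\<bar> \<le> C" by simp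
    fix c :: 'a assume c: "c \<in> Basis"
    have "ereal \<bar>pdiff c (pdiff b f) z\<bar> \<le> ereal C" by (rule le) (use b c in blast)
    then show "\<bar>pdiff c (pdiff b f) z\<bar> \<le> C" by simp
  qed (rule assms(1))
  then show ?thesis by blast
qed

lemma smooth_Pair: "smooth f \<Longrightarrow> smooth g \<Longrightarrow> smooth (\<lambda>x. (f x, g x))"
proof -
  assume "smooth f" "smooth g"
  then have "smooth (\<lambda>x. (f x, 0) + (0, g x))"
    by (intro smooth_add smooth_linear_compose[of "\<lambda>y. (y, 0)" f] smooth_linear_compose[of "\<lambda>y. (0, y)" g]
        bounded_linear_Pair bounded_linear_ident bounded_linear_zero)
  then show ?thesis by simp
qed

lemma smooth_vec:
  fixes f :: "'a::euclidean_space \<Rightarrow> 'b::euclidean_space ^ 'n::finite"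
  assumes "\<And>i. smooth (\<lambda>x. f x $ i)"
  shows "smooth f"
proof (rule smooth_euclidean)
  fix b :: "'b ^ 'n" assume "b \<in> Basis"
  then obtain i u where "b = axis i u" by (auto simp: Basis_vec_def)
  then show "smooth (\<lambda>x. f x \<bullet> b)"
    using smooth_linear_compose[OF bounded_linear_inner_left assms[of i], of u] by (simp add: inner_axis)
qed

lemma pdiff_Pair: "smooth f \<Longrightarrow> smooth g \<Longrightarrow> pdiff v (\<lambda>x. (f x, g x)) x = (pdiff v f x, pdiff v g x)"
  by (rule pdiff_eq[OF has_derivative_Pair[OF smooth_has_derivative smooth_has_derivative]])

lemma pdiff_nth: "smooth f \<Longrightarrow> pdiff v f x $ i = pdiff v (\<lambda>x. f x $ i) x"
  by (simp add: pdiff_linear_compose[OF bounded_linear_vec_nth])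

lemma pdiff_diff: "smooth f \<Longrightarrow> smooth g \<Longrightarrow> pdiff v (\<lambda>x. f x - g x) = (\<lambda>x. pdiff v f x - pdiff v g x)"
  by (rule ext, rule pdiff_eq[OF has_derivative_diff[OF smooth_has_derivative smooth_has_derivative]])

lemma pdiff_cover:
  fixes F :: "'d::finite cover \<Rightarrow> real"
  assumes "smooth F"
  shows "pdiff (0, hq, hp) F z = hq \<bullet> (\<chi> \<alpha>. pdiff (unit_q \<alpha>) F z) + hp \<bullet> (\<chi> i \<alpha>. pdiff (unit_p i \<alpha>) F z)"
proof -
  note l = pdiff_linear[OF assms, of z]
  have sum_if: "(\<Sum>x\<in>UNIV. if P then f x else 0) = (if P then sum f UNIV else 0)" for P and f :: "'d \<Rightarrow> real"
    by simp
  have "(0, hq, hp) = (\<Sum>\<alpha>\<in>UNIV. hq $ \<alpha> *\<^sub>R unit_q \<alpha>) + (\<Sum>i\<in>UNIV. \<Sum>\<alpha>\<in>UNIV. hp $ i $ \<alpha> *\<^sub>R (unit_p i \<alpha> :: 'd cover))"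
    by (simp add: prod_eq_iff fst_sum snd_sum vec_eq_iff axis_def if_distrib[of "\<lambda>x. x $ _"] if_distrib[of "\<lambda>x. _ * x"] sum_if cong: if_cong)
  then have "pdiff (0, hq, hp) F z = (\<Sum>\<alpha>\<in>UNIV. hq $ \<alpha> * pdiff (unit_q \<alpha>) F z) + (\<Sum>i\<in>UNIV. \<Sum>\<alpha>\<in>UNIV. hp $ i $ \<alpha> * pdiff (unit_p i \<alpha>) F z)"
    by (simp only: linear_add[OF l] linear_sum[OF l] linear_scale[OF l] real_scaleR_def)
  then show ?thesis by (simp add: inner_vec_def)
qed

lemma gradient_Ham:
  assumes "smooth (W_lift W)"
  shows "GDERIV (\<lambda>z. Ham W (to_torus t) (to_B z)) (q, p, om, r) :>
    (\<chi> \<alpha>. pdiff (unit_q \<alpha>) (W_lift W) (t, q, p), p + (\<chi> i \<alpha>. pdiff (unit_p i \<alpha>) (W_lift W) (t, q, p)), 0, r)"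
  unfolding gderiv_def
proof -
  let ?F = "W_lift W"
  have e: "(\<lambda>z. Ham W (to_torus t) (to_B z)) =
      (\<lambda>z. 1/2 * (fst (snd z) \<bullet> fst (snd z) + snd (snd (snd z)) \<bullet> snd (snd (snd z))) + ?F (t, fst z, fst (snd z)))"
    by (rule ext, clarify) (simp add: W_lift_def power2_norm_eq_inner)
  let ?z = "(q, p, om, r)"
  have "((\<lambda>z. ?F (t, fst z, fst (snd z))) has_derivative (\<lambda>h. pdiff (0, fst h, fst (snd h)) ?F (t, q, p))) (at ?z)"
  proof -
    have "((\<lambda>z. (t, fst z, fst (snd z))) has_derivative (\<lambda>h. (0, fst h, fst (snd h)))) (at ?z)"
      by (auto intro!: derivative_eq_intros)
    from has_derivative_compose[OF this, of ?F "\<lambda>v. pdiff v ?F (t, q, p)"] smooth_has_derivative[OF assms, of "(t, q, p)"]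
    show ?thesis by simp
  qed
  moreover have "((\<lambda>z. 1/2 * (fst (snd z) \<bullet> fst (snd z) + snd (snd (snd z)) \<bullet> snd (snd (snd z)))) has_derivative
      (\<lambda>h. fst (snd h) \<bullet> p + snd (snd (snd h)) \<bullet> r)) (at ?z)"
    by (auto intro!: derivative_eq_intros simp: inner_commute algebra_simps)
  ultimately have "((\<lambda>z. Ham W (to_torus t) (to_B z)) has_derivative
      (\<lambda>h. (fst (snd h) \<bullet> p + snd (snd (snd h)) \<bullet> r) + pdiff (0, fst h, fst (snd h)) ?F (t, q, p))) (at ?z)"
    unfolding e by (intro has_derivative_add)
  then show "((\<lambda>z. Ham W (to_torus t) (to_B z)) has_derivative
      (\<lambda>h. h \<bullet> (\<chi> \<alpha>. pdiff (unit_q \<alpha>) ?F (t, q, p), p + (\<chi> i \<alpha>. pdiff (unit_p i \<alpha>) ?F (t, q, p)), 0, r))) (at ?z)"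
    by (rule has_derivative_eq_rhs, intro ext, subst pdiff_cover[OF assms]) (simp add: inner_prod_def inner_add_right)
qed

text \<open>Data as in the ansatz: the potentials \<open>\<Phi>\<close> for \<open>\<phi>\<close> and \<open>X\<close> for \<open>\<chi>\<close>, and the means of \<open>q\<close> and
  \<open>p\<close>. Commuting derivatives are what makes \<open>div curl\<close> and \<open>curl \<nabla>\<close> vanish.\<close>
locale poisson_system =
  fixes F :: "'d::finite cover \<Rightarrow> real" and \<Phi> :: "'d \<Rightarrow> real ^ 3 \<Rightarrow> real" and X :: "3 \<Rightarrow> 'd \<Rightarrow> real ^ 3 \<Rightarrow> real"
    and q0 :: "real ^ 'd" and a :: "real ^ 'd ^ 3"
  assumes \<Phi>: "smooth_periodic (\<Phi> \<alpha>)" and X: "smooth_periodic (X i \<alpha>)"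
    and \<Phi>_commute: "\<delta> i (\<delta> j (\<Phi> \<alpha>)) = \<delta> j (\<delta> i (\<Phi> \<alpha>))"
    and X_commute: "\<delta> i (\<delta> j (X k \<alpha>)) = \<delta> j (\<delta> i (X k \<alpha>))"
begin

definition qf :: "'d \<Rightarrow> real ^ 3 \<Rightarrow> real" where
  "qf \<alpha> = (\<lambda>t. q0 $ \<alpha> + (\<Phi> \<alpha> t - (\<Sum>i\<in>UNIV. \<delta> i (X i \<alpha>) t)))"

definition pf :: "3 \<Rightarrow> 'd \<Rightarrow> real ^ 3 \<Rightarrow> real" where
  "pf i \<alpha> = (\<lambda>t. a $ i $ \<alpha> + \<delta> i (\<Phi> \<alpha>) t)"

definition curl :: "3 \<Rightarrow> 3 \<Rightarrow> 'd \<Rightarrow> real ^ 3 \<Rightarrow> real" where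
  "curl j k \<alpha> = (\<lambda>t. \<delta> j (X k \<alpha>) t - \<delta> k (X j \<alpha>) t)"

text \<open>The summand \<open>n t1\<close> makes \<open>o23\<close> wind \<open>n\<close> times around the circle as \<open>t1\<close> does so once, in
  each of the \<open>d\<close> components; it adds \<open>n\<close> to \<open>div o\<close>, which has to equal \<open>o123\<close>.\<close>
definition lift :: "nat \<Rightarrow> real ^ 3 \<Rightarrow> 'd Bbar" where
  "lift n t = (\<chi> \<alpha>. qf \<alpha> t, \<chi> i \<alpha>. pf i \<alpha> t,
     vector [\<chi> \<alpha>. curl 2 3 \<alpha> t + real n * t $ 1, \<chi> \<alpha>. curl 3 1 \<alpha> t, \<chi> \<alpha>. curl 1 2 \<alpha> t], \<chi> \<alpha>. real n)"

lemmas sX = smooth_periodicD(1)[OF X] and sP = smooth_periodicD(1)[OF \<Phi>]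

lemma smooth_components: "smooth (qf \<alpha>)" "smooth (pf i \<alpha>)" "smooth (curl j k \<alpha>)"
  unfolding qf_def pf_def curl_def by (intro smooth_add smooth_diff smooth_sum smooth_const smooth_pdiff sX sP)+

lemma periodic_components: "periodic3 (qf \<alpha>)" "periodic3 (pf i \<alpha>)" "periodic3 (curl j k \<alpha>)"
  using smooth_periodicD(2)[OF \<Phi>] smooth_periodicD(2)[OF smooth_periodic_pdiff[OF \<Phi>]] smooth_periodicD(2)[OF smooth_periodic_pdiff[OF X]]
  unfolding qf_def pf_def curl_def periodic3_def by simp_all

lemma pdiff_components:
  "\<delta> l (qf \<alpha>) = (\<lambda>t. \<delta> l (\<Phi> \<alpha>) t - (\<Sum>i\<in>UNIV. \<delta> l (\<delta> i (X i \<alpha>)) t))"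
  "\<delta> l (pf i \<alpha>) = \<delta> l (\<delta> i (\<Phi> \<alpha>))"
  "\<delta> l (curl j k \<alpha>) = (\<lambda>t. \<delta> l (\<delta> j (X k \<alpha>)) t - \<delta> l (\<delta> k (X j \<alpha>)) t)"
  unfolding qf_def pf_def curl_def
  by (simp_all add: pdiff_add pdiff_diff pdiff_sum pdiff_const smooth_add smooth_diff smooth_sum smooth_const smooth_pdiff sX sP)

lemma coordinate: "smooth (\<lambda>t::real^3. real n * t $ 1)" "\<delta> l (\<lambda>t. real n * t $ 1) = (\<lambda>t. if l = 1 then real n else 0)"
proof -
  have b: "bounded_linear (\<lambda>t::real^3. real n * t $ 1)"
    by (rule bounded_linear_mult_right[THEN bounded_linear_compose, OF bounded_linear_vec_nth])
  show "smooth (\<lambda>t::real^3. real n * t $ 1)" by (rule smooth_linear[OF b])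
  show "\<delta> l (\<lambda>t. real n * t $ 1) = (\<lambda>t. if l = 1 then real n else 0)"
    using pdiff_eq[OF bounded_linear_imp_has_derivative[OF b], of "axis l 1"] by (auto simp: axis_def)
qed

lemma smooth_parts:
  "smooth (\<lambda>t. \<chi> \<alpha>. qf \<alpha> t)" "smooth (\<lambda>t. \<chi> i \<alpha>. pf i \<alpha> t)"
  "smooth (\<lambda>t. vector [\<chi> \<alpha>. curl 2 3 \<alpha> t + real n * t $ 1, \<chi> \<alpha>. curl 3 1 \<alpha> t, \<chi> \<alpha>. curl 1 2 \<alpha> t] :: real ^ 'd ^ 3)"
  "smooth (\<lambda>t::real^3. (\<chi> \<alpha>. real n) :: real ^ 'd)"
proof -
  show "smooth (\<lambda>t. \<chi> \<alpha>. qf \<alpha> t)" by (rule smooth_vec) (simp add: smooth_components)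
  show "smooth (\<lambda>t. \<chi> i \<alpha>. pf i \<alpha> t)" by (rule smooth_vec, simp, rule smooth_vec) (simp add: smooth_components)
  show "smooth (\<lambda>t. vector [\<chi> \<alpha>. curl 2 3 \<alpha> t + real n * t $ 1, \<chi> \<alpha>. curl 3 1 \<alpha> t, \<chi> \<alpha>. curl 1 2 \<alpha> t] :: real ^ 'd ^ 3)"
  proof (rule smooth_vec, rule smooth_vec)
    fix i :: 3 and \<alpha> :: 'd
    show "smooth (\<lambda>t. (vector [\<chi> \<alpha>. curl 2 3 \<alpha> t + real n * t $ 1, \<chi> \<alpha>. curl 3 1 \<alpha> t, \<chi> \<alpha>. curl 1 2 \<alpha> t] :: real ^ 'd ^ 3) $ i $ \<alpha>)"
      using exhaust_3[of i] smooth_add[OF smooth_components(3)[of 2 3 \<alpha>] coordinate(1)[of n]]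
      by (auto simp: smooth_components)
  qed
  show "smooth (\<lambda>t::real^3. (\<chi> \<alpha>. real n) :: real ^ 'd)" by (rule smooth_const)
qed

lemma smooth_lift: "smooth (lift n)"
  unfolding lift_def[abs_def] by (intro smooth_Pair smooth_parts)

lemma pdiff_lift:
  "pdiff (axis l 1) (lift n) t = (\<chi> \<alpha>. \<delta> l (qf \<alpha>) t, \<chi> i \<alpha>. \<delta> l (pf i \<alpha>) t,
     vector [\<chi> \<alpha>. \<delta> l (curl 2 3 \<alpha>) t + (if l = 1 then real n else 0), \<chi> \<alpha>. \<delta> l (curl 3 1 \<alpha>) t, \<chi> \<alpha>. \<delta> l (curl 1 2 \<alpha>) t], 0)"
proof -
  let ?o = "\<lambda>t. vector [\<chi> \<alpha>. curl 2 3 \<alpha> t + real n * t $ 1, \<chi> \<alpha>. curl 3 1 \<alpha> t, \<chi> \<alpha>. curl 1 2 \<alpha> t] :: real ^ 'd ^ 3"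
  have nn: "pdiff v f t $ i $ \<alpha> = pdiff v (\<lambda>t. f t $ i $ \<alpha>) t" if "smooth f" for v i \<alpha> and f :: "real ^ 3 \<Rightarrow> real ^ 'd ^ 3"
  proof -
    have "smooth (\<lambda>t. f t $ i)" by (rule smooth_linear_compose[OF bounded_linear_vec_nth that])
    then show ?thesis using that by (simp add: pdiff_nth)
  qed
  have o: "pdiff (axis l 1) ?o t = vector [\<chi> \<alpha>. \<delta> l (curl 2 3 \<alpha>) t + (if l = 1 then real n else 0), \<chi> \<alpha>. \<delta> l (curl 3 1 \<alpha>) t, \<chi> \<alpha>. \<delta> l (curl 1 2 \<alpha>) t]"
    by (simp add: vec_eq_iff forall_3 nn[OF smooth_parts(3)] pdiff_add smooth_components coordinate)
  have q: "pdiff (axis l 1) (\<lambda>t. \<chi> \<alpha>. qf \<alpha> t) t = (\<chi> \<alpha>. \<delta> l (qf \<alpha>) t)"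
    by (simp add: vec_eq_iff pdiff_nth smooth_parts)
  have p: "pdiff (axis l 1) (\<lambda>t. \<chi> i \<alpha>. pf i \<alpha> t) t = (\<chi> i \<alpha>. \<delta> l (pf i \<alpha>) t)"
    by (simp add: vec_eq_iff nn smooth_parts)
  show ?thesis
    unfolding lift_def[abs_def]
    by (simp add: pdiff_Pair smooth_Pair smooth_parts pdiff_const o q p)
qed

lemma lift_periodic:
  assumes m: "\<And>i. m $ i \<in> \<int>"
  shows "to_B (lift n (t + m)) = to_B (lift n t)"
proof -
  have "qf \<alpha> (t + m) = qf \<alpha> t" "pf i \<alpha> (t + m) = pf i \<alpha> t" "curl j k \<alpha> (t + m) = curl j k \<alpha> t" for i j k \<alpha>
    using periodic3_int[OF _ m] periodic_components by blast+
  note p = this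
  have "to_torus ((vector [\<chi> \<alpha>. curl 2 3 \<alpha> (t + m) + real n * (t + m) $ 1, \<chi> \<alpha>. curl 3 1 \<alpha> (t + m), \<chi> \<alpha>. curl 1 2 \<alpha> (t + m)] :: real ^ 'd ^ 3) $ i)
      = to_torus ((vector [\<chi> \<alpha>. curl 2 3 \<alpha> t + real n * t $ 1, \<chi> \<alpha>. curl 3 1 \<alpha> t, \<chi> \<alpha>. curl 1 2 \<alpha> t] :: real ^ 'd ^ 3) $ i)" for i
    using exhaust_3[of i] m by (auto simp: p to_torus_eq_iff distrib_left)
  then show ?thesis unfolding lift_def to_B.simps p by simp
qed

text \<open>The choice of representatives of points of the torus is immaterial, because \<open>lift n\<close> is
  periodic modulo the lattice of \<open>B\<close>.\<close>
definition sol :: "nat \<Rightarrow> 3 torus \<Rightarrow> 'd B" where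
  "sol n s = to_B (lift n (\<chi> i. rep_circle (s $ i)))"

lemma sol_to_torus: "sol n (to_torus t) = to_B (lift n t)"
proof -
  define t' where "t' = (\<chi> i. rep_circle (to_torus t $ i))"
  have "circ (rep_circle x) = x" for x by (rule Quotient_abs_rep[OF Quotient_circle])
  then have "to_torus t' = to_torus t" by (simp add: t'_def to_torus_def)
  then have "\<And>i. (t' - t) $ i \<in> \<int>" by (simp add: to_torus_eq_iff)
  from lift_periodic[OF this, of n t] show ?thesis by (simp add: sol_def t'_def)
qed

text \<open>Apart from the winding, the operator maps \<open>(q, p, o, o123)\<close> to
  \<open>(- div p, \<nabla>q + curl o, curl p - \<nabla>o123, div o)\<close>. Under the ansatz \<open>div p = \<Delta>\<phi>\<close>,
  \<open>\<nabla>q + curl o = \<nabla>\<phi> - \<Delta>\<chi>\<close> by \<open>curl curl = \<nabla> div - \<Delta>\<close>, and the other two are \<open>0\<close>. In \<open>\<partial>1 o23\<close> the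
  winding contributes the constant \<open>n\<close>.\<close>
lemma J_lift:
  assumes eq_q: "\<And>\<alpha> t. - (\<Sum>i\<in>UNIV. \<delta> i (\<delta> i (\<Phi> \<alpha>)) t) = gq \<alpha> t"
    and eq_p: "\<And>i \<alpha> t. - (\<Sum>j\<in>UNIV. \<delta> j (\<delta> j (X i \<alpha>)) t) = gp i \<alpha> t + a $ i $ \<alpha>"
  shows "J1 (pdiff (axis 1 1) (lift n) t) + J2 (pdiff (axis 2 1) (lift n) t) + J3 (pdiff (axis 3 1) (lift n) t) =
    (\<chi> \<alpha>. gq \<alpha> t, (\<chi> i \<alpha>. pf i \<alpha> t) + (\<chi> i \<alpha>. gp i \<alpha> t), 0, \<chi> \<alpha>. real n)"
proof -
  have c: "\<delta> 2 (\<delta> 1 (X k \<alpha>)) = \<delta> 1 (\<delta> 2 (X k \<alpha>))" "\<delta> 3 (\<delta> 1 (X k \<alpha>)) = \<delta> 1 (\<delta> 3 (X k \<alpha>))" "\<delta> 3 (\<delta> 2 (X k \<alpha>)) = \<delta> 2 (\<delta> 3 (X k \<alpha>))"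
    "\<delta> 2 (\<delta> 1 (\<Phi> \<alpha>)) = \<delta> 1 (\<delta> 2 (\<Phi> \<alpha>))" "\<delta> 3 (\<delta> 1 (\<Phi> \<alpha>)) = \<delta> 1 (\<delta> 3 (\<Phi> \<alpha>))" "\<delta> 3 (\<delta> 2 (\<Phi> \<alpha>)) = \<delta> 2 (\<delta> 3 (\<Phi> \<alpha>))" for k \<alpha>
    by (rule X_commute \<Phi>_commute)+
  have g: "gq \<alpha> t = - \<delta> 1 (\<delta> 1 (\<Phi> \<alpha>)) t - \<delta> 2 (\<delta> 2 (\<Phi> \<alpha>)) t - \<delta> 3 (\<delta> 3 (\<Phi> \<alpha>)) t"
    "gp i \<alpha> t = - \<delta> 1 (\<delta> 1 (X i \<alpha>)) t - \<delta> 2 (\<delta> 2 (X i \<alpha>)) t - \<delta> 3 (\<delta> 3 (X i \<alpha>)) t - a $ i $ \<alpha>" for i \<alpha>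
    using eq_q[of \<alpha> t] eq_p[of i \<alpha> t] by (simp_all add: sum_3)
  show ?thesis
    unfolding pdiff_lift J1.simps J2.simps J3.simps
    by (simp add: prod_eq_iff vec_eq_iff forall_3 pdiff_components g fun_cong[OF pf_def] sum_3 c)
qed

lemma sol_solution:
  assumes F: "F = W_lift W" and sm: "smooth (W_lift W)"
    and Y: "\<And>t. Y t = (t, \<chi> \<alpha>. qf \<alpha> t, \<chi> i \<alpha>. pf i \<alpha> t)"
    and eq_q: "\<And>\<alpha> t. - (\<Sum>i\<in>UNIV. \<delta> i (\<delta> i (\<Phi> \<alpha>)) t) = pdiff (unit_q \<alpha>) F (Y t)"
    and eq_p: "\<And>i \<alpha> t. - (\<Sum>j\<in>UNIV. \<delta> j (\<delta> j (X i \<alpha>)) t) = pdiff (unit_p i \<alpha>) F (Y t) + a $ i $ \<alpha>"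
  shows "solution W (sol n)"
  unfolding solution_def
proof (intro exI[of _ "lift n"] conjI allI)
  show "lifts_to (sol n) (lift n)"
    by (simp add: lifts_to_def smooth_lift sol_to_torus)
  fix t
  show "GDERIV (\<lambda>z. Ham W (to_torus t) (to_B z)) (lift n t) :>
      J1 (pdiff (axis 1 1) (lift n) t) + J2 (pdiff (axis 2 1) (lift n) t) + J3 (pdiff (axis 3 1) (lift n) t)"
    unfolding J_lift[where gq = "\<lambda>\<alpha> t. pdiff (unit_q \<alpha>) F (Y t)" and gp = "\<lambda>i \<alpha> t. pdiff (unit_p i \<alpha>) F (Y t)", OF eq_q eq_p]
    unfolding lift_def F Y by (rule gradient_Ham[OF sm])
qed

text \<open>Translations do not move the last component, which is the constant \<open>n\<close>.\<close>
lemma orbit_sol_inj: "orbit (sol m) = orbit (sol n) \<Longrightarrow> m = n"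
proof -
  assume eq: "orbit (sol m) = orbit (sol n)"
  have t0: "translate 0 z = z" for z :: "'d B"
    by (cases z) (simp add: vec_eq_iff)
  have "sol m = (\<lambda>t. translate 0 (sol m t))" by (rule ext) (rule t0[symmetric])
  then have "sol m \<in> orbit (sol m)" unfolding orbit_def by blast
  then have "sol m \<in> orbit (sol n)" by (simp only: eq)
  then obtain c where "sol m = (\<lambda>t. translate c (sol n t))" unfolding orbit_def by blast
  then have "sol m (to_torus 0) = translate c (sol n (to_torus 0))" by simp
  then show "m = n" by (simp add: sol_to_torus lift_def vec_eq_iff)
qed

end

theorem theorem2p3:
  fixes W :: "3 torus \<times> 'd::finite torus \<times> (real ^ 'd ^ 3) \<Rightarrow> real"
  assumes W_smooth: "smooth (W_lift W)"
    and W_bounded: "C2_norm (W_lift W) < \<infinity>"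
  shows "\<exists>S \<subseteq> solution_families W. finite S \<and> card S \<ge> CARD('d) + 1"
proof -
  obtain C where C: "bounded_C2 (W_lift W) C" using bounded_C2_of_C2_norm[OF W_smooth W_bounded] by blast
  from poisson_system_solution[OF C admissible_W_lift[OF W_smooth]] show ?thesis
  proof (elim exE conjE, goal_cases)
    case (1 \<Phi> X q0 a Y)
    interpret poisson_system "W_lift W" \<Phi> X q0 a
      using 1(1-4) by unfold_locales blast+
    have sol: "solution W (sol n)" for n
      by (rule sol_solution[OF refl W_smooth _ 1(6)[rule_format] 1(7)[rule_format]])
         (simp add: 1(5) qf_def pf_def)
    let ?S = "(\<lambda>n. orbit (sol n)) ` {..CARD('d)}"
    have "?S \<subseteq> solution_families W" using sol by (auto simp: solution_families_def)
    moreover have "card ?S = CARD('d) + 1"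
      using orbit_sol_inj by (subst card_image) (auto simp: inj_on_def)
    ultimately show ?case by (intro exI[of _ ?S]) simp
  qed
qed

end
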